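(* Let either (i) $\sigma,\sigma_1,\sigma_2\in\mathcal{P}(\mathbb{R}_+)\setminus\{\delta_0\}$ and $\mu_1,\mu_2\in\mathcal{P}(\mathbb{R}_+)$, or (ii) $\sigma,\sigma_1,\sigma_2,\mu_1,\mu_2\in\mathcal{P}(\mathbb{T})$. Then $$\mathbb{B}_\sigma(\mu_1\boxtimes\mu_2)=\mathbb{B}_\sigma(\mu_1)\boxtimes\mathbb{B}_\sigma(\mu_2),$$ and $$\mathbb{B}_{\sigma_1}\circ\mathbb{B}_{\sigma_2}=\mathbb{B}_{\sigma_2\circlearrowright\sigma_1}$$ as maps on $\mathcal{P}(\mathbb{R}_+)$ in case (i) (respectively on $\mathcal{P}(\mathbb{T})$ in case (ii)).
   Context: $\mathcal{P}(I)$ denotes the set of Borel probability measures on $I$; $\mathbb{T}$ is the unit circle, $\mathbb{D}$ the open unit disc. For a probability measure $\mu$ on $\mathbb{R}$ or $\mathbb{T}$, $G_\mu(z)=\int\frac{1}{z-x}\mu(dx)$, $F_\mu=1/G_\mu$, and $\eta_\mu(z)=1-zF_\mu(1/z)$ (for $\mu\in\mathcal{P}(\mathbb{R}_+)$ these are considered on $\mathbb{C}\setminus\mathbb{R}_+$; for $\mu\in\mathcal{P}(\mathbb{T})$, $\eta_\mu$ is considered on $\mathbb{D}$). For $\delta_0\ne\mu\in\mathcal{P}(\mathbb{R}_+)$, $\eta_\mu$ is strictly increasing on $(-\infty,0)$ with $\eta_\mu(0^-)=0$, and $\Sigma_\mu(z):=\eta_\mu^{-1}(z)/z$ on $(\eta_\mu(-\infty),0)$;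 for $\mu\in\mathcal{P}(\mathbb{T})$ with nonzero first moment, $\Sigma_\mu(z):=\eta_\mu^{-1}(z)/z$ near $0$. Multiplicative free convolution $\boxtimes$ (on $\mathcal{P}(\mathbb{R}_+)$ or $\mathcal{P}(\mathbb{T})$) is characterized by $\Sigma_{\mu\boxtimes\nu}=\Sigma_\mu\Sigma_\nu$ near $0$ (law of $X^{1/2}YX^{1/2}$, resp. $UV$, for free $X,Y$, resp. free unitaries $U,V$), and multiplicative monotone convolution $\circlearrowright$ by $\eta_{\mu\circlearrowright\nu}=\eta_\mu\circ\eta_\nu$ (on $(-\infty,0)$, resp. on $\mathbb{D}$). Multiplicative subordination: for $\sigma\in\mathcal{P}(\mathbb{R}_+)\setminus\{\delta_0\}$, $\mu\in\mathcal{P}(\mathbb{R}_+)$ (or $\sigma,\mu\in\mathcal{P}(\mathbb{T})$), $\mathbb{B}_\sigma(\mu)$ denotes the unique probability measure on $\mathbb{R}_+$ (resp. $\mathbb{T}$) such that $\sigma\boxtimes\mu=\sigma\circlearrowright\mathbb{B}_\sigma(\mu)$, i.e. $\eta_{\mathbb{B}_\sigma(\mu)}$ is the subordination function $\omega$ with $\eta_{\sigma\boxtimes\mu}=\eta_\sigma\circ\omega$; when $\mu\ne\delta_0$ it is characterized by $\Sigma_{\mathbb{B}_\sigma(\mu)}(z)=\Sigma_\mu(\eta_\sigma(z))$ for $z$ in some interval $(-\alpha,0)$ (resp. near $0$). *)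

theory Defs
  imports "HOL-Probability.Probability"
begin

definition probRp :: "real measure set" where
  "probRp = {M. prob_space M \<and> sets M = sets (borel :: real measure) \<and> (AE x in M. 0 \<le> x)}"

definition deltaR0 :: "real measure" where
  "deltaR0 = return borel 0"

definition probT :: "complex measure set" where
  "probT = {M. prob_space M \<and> sets M = sets (borel :: complex measure) \<and> (AE z in M. cmod z = 1)}"

text \<open>Cauchy transform G_mu restricted to real arguments off R_+ (where it is real).\<close>
definition GR :: "real measure \<Rightarrow> real \<Rightarrow> real" where
  "GR M y = (LINT t|M. 1 / (y - t))"

text \<open>eta_mu(x) = 1 - x F_mu(1/x) = 1 - x / G_mu(1/x) for x < 0; eta_mu(0) := eta_mu(0^-) = 0.\<close>
definition etaR :: "real measure \<Rightarrow> real \<Rightarrow> real" where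
  "etaR M x = (if x = 0 then 0 else 1 - x / GR M (1 / x))"

definition SigmaR :: "real measure \<Rightarrow> real \<Rightarrow> real" where
  "SigmaR M z = inv_into {..<0} (etaR M) z / z"

definition mfcR :: "real measure \<Rightarrow> real measure \<Rightarrow> real measure" where
  "mfcR \<mu> \<nu> = (if \<mu> = deltaR0 \<or> \<nu> = deltaR0 then deltaR0 else
     (THE \<rho>. \<rho> \<in> probRp \<and> \<rho> \<noteq> deltaR0 \<and>
        (\<exists>\<alpha>>0. \<forall>z\<in>{-\<alpha><..<0}. SigmaR \<rho> z = SigmaR \<mu> z * SigmaR \<nu> z)))"

definition mconvR :: "real measure \<Rightarrow> real measure \<Rightarrow> real measure" where
  "mconvR \<mu> \<nu> = (THE \<rho>. \<rho> \<in> probRp \<and> (\<forall>x<0. etaR \<rho> x = etaR \<mu> (etaR \<nu> x)))"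

definition BR :: "real measure \<Rightarrow> real measure \<Rightarrow> real measure" where
  "BR \<sigma> \<mu> = (THE \<beta>. \<beta> \<in> probRp \<and> mfcR \<sigma> \<mu> = mconvR \<sigma> \<beta>)"

definition GT :: "complex measure \<Rightarrow> complex \<Rightarrow> complex" where
  "GT M w = (LINT x|M. 1 / (w - x))"

text \<open>eta_mu(z) = 1 - z F_mu(1/z) on the disc, with the removable value eta_mu(0) = 0.\<close>
definition etaT :: "complex measure \<Rightarrow> complex \<Rightarrow> complex" where
  "etaT M z = (if z = 0 then 0 else 1 - z / GT M (1 / z))"

text \<open>h_mu(w) = eta_mu(w)/w, extended at 0 by eta_mu'(0) = first moment.\<close>
definition hT :: "complex measure \<Rightarrow> complex \<Rightarrow> complex" where
  "hT M w = (if w = 0 then (LINT x|M. x) else etaT M w / w)"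

text \<open>Subordination functions (Belinschi--Bercovici) for sigma boxtimes mu on T:
  analytic self-maps of the disc fixing 0 with omega1 = z h_mu(omega2), omega2 = z h_sigma(omega1);
  then eta_{sigma boxtimes mu} = eta_sigma o omega1 = eta_mu o omega2.\<close>
definition subordT :: "complex measure \<Rightarrow> complex measure \<Rightarrow> (complex \<Rightarrow> complex) \<Rightarrow> (complex \<Rightarrow> complex) \<Rightarrow> bool" where
  "subordT \<sigma> \<mu> \<omega>1 \<omega>2 \<longleftrightarrow>
     \<omega>1 holomorphic_on ball 0 1 \<and> \<omega>2 holomorphic_on ball 0 1 \<and>
     \<omega>1 ` ball 0 1 \<subseteq> ball 0 1 \<and> \<omega>2 ` ball 0 1 \<subseteq> ball 0 1 \<and>
     \<omega>1 0 = 0 \<and> \<omega>2 0 = 0 \<and>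
     (\<forall>z\<in>ball 0 1. \<omega>1 z = z * hT \<mu> (\<omega>2 z) \<and> \<omega>2 z = z * hT \<sigma> (\<omega>1 z))"

text \<open>Multiplicative free convolution on P(T) (law of UV, U,V free): eta_{sigma boxtimes mu} = eta_sigma o omega1.\<close>
definition mfcT :: "complex measure \<Rightarrow> complex measure \<Rightarrow> complex measure" where
  "mfcT \<sigma> \<mu> = (THE \<rho>. \<rho> \<in> probT \<and>
     (\<exists>\<omega>1 \<omega>2. subordT \<sigma> \<mu> \<omega>1 \<omega>2 \<and> (\<forall>z\<in>ball 0 1. etaT \<rho> z = etaT \<sigma> (\<omega>1 z))))"

definition mconvT :: "complex measure \<Rightarrow> complex measure \<Rightarrow> complex measure" where
  "mconvT \<mu> \<nu> = (THE \<rho>. \<rho> \<in> probT \<and> (\<forall>z\<in>ball 0 1. etaT \<rho> z = etaT \<mu> (etaT \<nu> z)))"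

definition BT :: "complex measure \<Rightarrow> complex measure \<Rightarrow> complex measure" where
  "BT \<sigma> \<mu> = (THE \<beta>. \<beta> \<in> probT \<and> (\<exists>\<omega>2. subordT \<sigma> \<mu> (etaT \<beta>) \<omega>2))"

end

theory Submission
  imports Defs "HOL-Complex_Analysis.Complex_Analysis"
begin

text \<open>Since all convolutions are definite descriptions, the point is to show that the measures exist;
  the two identities are then algebra with the subordination equations, solved pointwise.

  On the circle, \<open>\<eta>\<close> ranges over all holomorphic self-maps of the disc fixing \<open>0\<close> (Herglotz). For fixed \<open>z\<close>
  in the disc the map \<open>w \<mapsto> z h\<^sub>\<mu>(z h\<^sub>\<sigma>(w))\<close> sends the disc into a smaller concentric disc, so it has exactly one
  fixed point, its iterates from \<open>0\<close> converge to it (Schwarz--Pick), and Montel's theorem makes the fixed point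
  holomorphic in \<open>z\<close>.

  On the half-line, \<open>f(y) = -\<eta>(-y)\<close> ranges over the complete Bernstein functions vanishing at \<open>0\<close>, that is, those for
  which \<open>f(w\<^sup>2)/w\<close> extends to a holomorphic map \<open>H\<close> from the right half-plane to itself; the Cayley transform
  reduces this to Herglotz. If \<open>u\<close> is in this class, so are \<open>f(u(y))\<close> and \<open>y f(u(y))/u(y)\<close>. With \<open>k(w) = f(w)/w\<close>, the
  monotone iteration \<open>u \<mapsto> y k\<^sub>\<mu>(y k\<^sub>\<sigma>(u))\<close> therefore stays in the class, and it converges to the unique solution of
  \<open>u v = y f\<^sub>\<sigma>(u) = y f\<^sub>\<mu>(v)\<close>.\<close>

section \<open>Measures determined by moments\<close>

text \<open>On the circle the obstacle is division: a first moment may vanish, so Sigma need not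
  exist, and eta(z)/z has to be continued to 0. Hence everything is phrased with \<open>hT\<close>
  and the pair equations of \<open>subordT\<close>, which stay meaningful there. On the half-line
  only \<open>deltaR0\<close> degenerates and is split off; for all other measures f is positive on
  the positive axis, so real monotonicity (f increasing, f(y)/y nonincreasing) replaces Schwarz-Pick
  for uniqueness and convergence, and complex analysis serves only to show that a function comes
  from a measure. In both settings a pair that solves the equations at a single point is unique. An
  identity is therefore proved by showing that the values of the subordination functions on one side
  solve the system of the other side. Uniqueness of measures runs from transform to measure: values
  along a sequence give moments, and Stone-Weierstrass does the rest. On the half-line moments may
  be infinite, which forces a change of variable to [0,1].\<close>

text \<open>Letting s tend to 0 in W Q^k / (1 - s Q) gives the k-th weighted moment; subtracting it
  and dividing by s gives the same kind of equation for k + 1, so the moments follow one after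
  another. The weight W is 1 on the circle and 1 / (1 + c t) on the half-line.\<close>

lemma moments_eq:
  fixes W W' :: "'a \<Rightarrow> 'k::{real_normed_field,banach,second_countable_topology}" and s :: "nat \<Rightarrow> 'k"
  assumes M: "prob_space M" and N: "prob_space N"
    and [measurable]: "W \<in> borel_measurable M" "Q \<in> borel_measurable M"
       "W' \<in> borel_measurable N" "Q' \<in> borel_measurable N"
    and bM: "AE x in M. norm (W x) \<le> 1 \<and> norm (Q x) \<le> 1"
    and bN: "AE x in N. norm (W' x) \<le> 1 \<and> norm (Q' x) \<le> 1"
    and s: "s \<longlonglongrightarrow> 0" "\<And>n. s n \<noteq> 0" "\<And>n. norm (s n) \<le> 1/2"
    and eq: "\<And>n. (LINT x|M. W x / (1 - s n * Q x)) = (LINT x|N. W' x / (1 - s n * Q' x))"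
  shows "(LINT x|M. W x * Q x ^ k) = (LINT x|N. W' x * Q' x ^ k)"
proof -
  have low: "norm (1 - s n * q) \<ge> 1/2" if "norm q \<le> 1" for n and q :: 'k
  proof -
    have "norm (s n * q) \<le> (1/2) * 1"
      unfolding norm_mult using that s(3)[of n] by (intro mult_mono) auto
    then show ?thesis using norm_triangle_ineq2[of 1 "s n * q"] by simp
  qed
  have bnd: "norm (w * q ^ k / (1 - s n * q)) \<le> 2" if "norm w \<le> 1" "norm q \<le> 1" for w q :: 'k and n k
  proof -
    have "norm (w * q ^ k) \<le> 1 * 1"
      unfolding norm_mult norm_power using that by (intro mult_mono power_le_one) auto
    then have "norm (w * q ^ k) / norm (1 - s n * q) \<le> 1 / (1/2)"
      using low[OF that(2), of n] by (intro frac_le) auto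
    then show ?thesis unfolding norm_divide by simp
  qed
  have lim: "(\<lambda>n. LINT x|M. W x * Q x ^ k / (1 - s n * Q x)) \<longlonglongrightarrow> (LINT x|M. W x * Q x ^ k)"
    if M: "prob_space M" and [measurable]: "W \<in> borel_measurable M" "Q \<in> borel_measurable M"
      and b: "AE x in M. norm (W x) \<le> 1 \<and> norm (Q x) \<le> 1" for M :: "'a measure" and W Q k
  proof -
    interpret prob_space M by fact
    show ?thesis
    proof (rule integral_dominated_convergence[where w="\<lambda>_. 2"])
      show "AE x in M. (\<lambda>n. W x * Q x ^ k / (1 - s n * Q x)) \<longlonglongrightarrow> W x * Q x ^ k"
      proof (rule AE_I2)
        fix x
        have "(\<lambda>n. W x * Q x ^ k / (1 - s n * Q x)) \<longlonglongrightarrow> W x * Q x ^ k / (1 - 0 * Q x)"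
          by (intro tendsto_intros s) auto
        then show "(\<lambda>n. W x * Q x ^ k / (1 - s n * Q x)) \<longlonglongrightarrow> W x * Q x ^ k" by simp
      qed
      show "AE x in M. norm (W x * Q x ^ k / (1 - s n * Q x)) \<le> 2" for n
        using b by eventually_elim (use bnd in auto)
    qed auto
  qed
  have step: "(LINT x|M. W x * Q x ^ k / (1 - s n * Q x)) =
      (LINT x|M. W x * Q x ^ k) + s n * (LINT x|M. W x * Q x ^ Suc k / (1 - s n * Q x))"
    if M: "prob_space M" and [measurable]: "W \<in> borel_measurable M" "Q \<in> borel_measurable M"
      and b: "AE x in M. norm (W x) \<le> 1 \<and> norm (Q x) \<le> 1" for M :: "'a measure" and W Q k n
  proof -
    interpret prob_space M by fact
    have i1: "integrable M (\<lambda>x. W x * Q x ^ k)"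
    proof (rule integrable_const_bound[where B=1])
      show "AE x in M. norm (W x * Q x ^ k) \<le> 1"
        using b by eventually_elim (simp add: norm_mult norm_power mult_le_one power_le_one)
    qed auto
    have i2: "integrable M (\<lambda>x. W x * Q x ^ Suc k / (1 - s n * Q x))"
      by (rule integrable_const_bound[where B=2])
        (use b in eventually_elim, use bnd in blast, auto)
    have "(LINT x|M. W x * Q x ^ k / (1 - s n * Q x)) =
       (LINT x|M. W x * Q x ^ k + s n * (W x * Q x ^ Suc k / (1 - s n * Q x)))"
    proof (rule integral_cong_AE)
      show "AE x in M. W x * Q x ^ k / (1 - s n * Q x) = W x * Q x ^ k + s n * (W x * Q x ^ Suc k / (1 - s n * Q x))"
        using b
      proof eventually_elim
        fix x assume "norm (W x) \<le> 1 \<and> norm (Q x) \<le> 1"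
        then have "norm (1 - s n * Q x) > 0" using low[of "Q x" n] by linarith
        then have "1 - s n * Q x \<noteq> 0" by auto
        then show "W x * Q x ^ k / (1 - s n * Q x) = W x * Q x ^ k + s n * (W x * Q x ^ Suc k / (1 - s n * Q x))"
          by (simp add: field_simps)
      qed
    qed auto
    also have "\<dots> = (LINT x|M. W x * Q x ^ k) + s n * (LINT x|M. W x * Q x ^ Suc k / (1 - s n * Q x))"
      by (subst Bochner_Integration.integral_add[OF i1 integrable_mult_right[OF i2]]) (simp only: integral_mult_right_zero)
    finally show ?thesis .
  qed
  have m: "(LINT x|M. W x * Q x ^ k) = (LINT x|N. W' x * Q' x ^ k)"
    if "\<And>n. (LINT x|M. W x * Q x ^ k / (1 - s n * Q x)) = (LINT x|N. W' x * Q' x ^ k / (1 - s n * Q' x))" for k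
    using lim[OF M _ _ bM, of k] lim[OF N _ _ bN, of k] by (simp add: that LIMSEQ_unique)
  have "(LINT x|M. W x * Q x ^ k / (1 - s n * Q x)) = (LINT x|N. W' x * Q' x ^ k / (1 - s n * Q' x))" for n
  proof (induction k arbitrary: n)
    case 0 then show ?case using eq by simp
  next
    case (Suc k)
    show ?case
      using step[OF M _ _ bM, of k n] step[OF N _ _ bN, of k n] Suc.IH m[OF Suc.IH] s(2) by simp
  qed
  from m[OF this] show ?thesis .
qed

text \<open>Closed sets form an intersection-stable generator of the Borel sets, and the indicator
  of a closed set is a pointwise limit of continuous functions with values in [0,1].\<close>

lemma measure_eqI_continuous:
  fixes M N :: "'a::euclidean_space measure"
  assumes M: "prob_space M" and N: "prob_space N"
    and sM: "sets M = sets borel" and sN: "sets N = sets borel"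
    and eq: "\<And>f :: 'a \<Rightarrow> real. continuous_on UNIV f \<Longrightarrow> (\<And>x. 0 \<le> f x \<and> f x \<le> 1) \<Longrightarrow> (LINT x|M. f x) = (LINT x|N. f x)"
  shows "M = N"
proof (rule measure_eqI_generator_eq[where \<Omega>=UNIV and E="Collect closed" and A="\<lambda>_. UNIV"])
  interpret M: prob_space M by fact
  interpret N: prob_space N by fact
  show "Int_stable (Collect closed :: 'a set set)" by (auto simp: Int_stable_def)
  show "sets M = sigma_sets UNIV (Collect closed)" "sets N = sigma_sets UNIV (Collect closed)"
    using sM sN by (simp_all add: borel_eq_closed)
  show "emeasure M X = emeasure N X" if "X \<in> Collect closed" for X
  proof (cases "X = {}")
    case False
    have X: "closed X" using that by simp
    have Xb: "X \<in> sets borel" using X by auto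
    \<comment> \<open>A ramp of slope n: 1 on \<open>X\<close> and, for positive n, 0 at distance at
      least 1/n from it.\<close>
    define f where "f n x = max 0 (1 - real n * infdist x X)" for n x
    have cf: "continuous_on UNIV (f n)" for n unfolding f_def by (intro continuous_intros)
    have [measurable]: "f n \<in> borel_measurable M" "f n \<in> borel_measurable N" for n
      using borel_measurable_continuous_onI[OF cf[of n]]
      by (simp_all add: measurable_cong_sets[OF sM refl] measurable_cong_sets[OF sN refl])
    have [measurable]: "X \<in> sets M" "X \<in> sets N" using Xb sM sN by auto
    have bf: "0 \<le> f n x \<and> f n x \<le> 1" for n x
      unfolding f_def by (auto simp: infdist_nonneg)
    have lim: "(\<lambda>n. f n x) \<longlonglongrightarrow> indicator X x" for x
    proof (cases "x \<in> X")
      case True then show ?thesis by (simp add: f_def)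
    next
      case F: False
      then have p: "infdist x X > 0" using X False by (simp add: infdist_pos_not_in_closed)
      obtain n0 :: nat where n0: "real n0 > 1 / infdist x X" using reals_Archimedean2 by blast
      have "f n x = 0" if "n \<ge> n0" for n
      proof -
        have "real n * infdist x X \<ge> real n0 * infdist x X" using that p by (intro mult_right_mono) auto
        moreover have "real n0 * infdist x X > 1" using n0 p by (simp add: field_simps)
        ultimately show ?thesis by (simp add: f_def)
      qed
      then have "eventually (\<lambda>n. f n x = 0) sequentially" using eventually_sequentially by auto
      then show ?thesis using F by (simp add: tendsto_eventually)
    qed
    have l: "(\<lambda>n. LINT x|M. f n x) \<longlonglongrightarrow> (LINT x|M. indicator X x)"
      by (rule integral_dominated_convergence[where w="\<lambda>_. 1"]) (use lim bf in \<open>auto intro!: AE_I2\<close>)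
    have l': "(\<lambda>n. LINT x|N. f n x) \<longlonglongrightarrow> (LINT x|N. indicator X x)"
      by (rule integral_dominated_convergence[where w="\<lambda>_. 1"]) (use lim bf in \<open>auto intro!: AE_I2\<close>)
    have "(LINT x|M. indicator X x :: real) = (LINT x|N. indicator X x)"
      using l l' eq[OF cf bf] by (simp add: LIMSEQ_unique)
    then have "measure M X = measure N X" using sets.sets_into_space[of X M] sets.sets_into_space[of X N] by (simp add: Int_absorb2)
    then show ?thesis by (simp add: M.emeasure_eq_measure N.emeasure_eq_measure)
  qed simp
  show "emeasure M UNIV \<noteq> \<infinity>" by (simp add: M.emeasure_eq_measure)
qed auto

text \<open>Approximation on \<open>K\<close> suffices because both measures are carried by
  \<open>K\<close>; the two integrals of f then differ by at most twice the error.\<close>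

lemma measure_eqI_dense:
  fixes M N :: "'a::euclidean_space measure"
  assumes M: "prob_space M" and N: "prob_space N"
    and sM: "sets M = sets borel" and sN: "sets N = sets borel"
    and K: "compact K" "AE x in M. x \<in> K" "AE x in N. x \<in> K"
    and dense: "\<And>(f :: 'a \<Rightarrow> real) e. continuous_on K f \<Longrightarrow> e > 0 \<Longrightarrow>
        \<exists>g. continuous_on UNIV g \<and> (\<forall>x\<in>K. \<bar>f x - g x\<bar> < e) \<and> (LINT x|M. g x) = (LINT x|N. g x)"
  shows "M = N"
proof (rule measure_eqI_continuous[OF M N sM sN])
  interpret M: prob_space M by fact
  interpret N: prob_space N by fact
  fix f :: "'a \<Rightarrow> real" assume f: "continuous_on UNIV f" "\<And>x. 0 \<le> f x \<and> f x \<le> 1"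
  have mM: "h \<in> borel_measurable M" "h \<in> borel_measurable N" if "continuous_on UNIV h" for h :: "'a \<Rightarrow> real"
    using borel_measurable_continuous_onI[OF that] measurable_cong_sets[OF sM refl] measurable_cong_sets[OF sN refl] by auto
  have "\<bar>(LINT x|M. f x) - (LINT x|N. f x)\<bar> \<le> 2 * e" if e: "e > 0" for e
  proof -
    obtain g where g: "continuous_on UNIV g" "\<forall>x\<in>K. \<bar>f x - g x\<bar> < e" "(LINT x|M. g x) = (LINT x|N. g x)"
      using dense[OF continuous_on_subset[OF f(1)] e] by blast
    have est: "\<bar>(LINT x|P. f x) - (LINT x|P. g x)\<bar> \<le> e"
      if P: "prob_space P" "AE x in P. x \<in> K" and [measurable]: "f \<in> borel_measurable P" "g \<in> borel_measurable P" for P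
    proof -
      interpret P: prob_space P by fact
      have ae: "AE x in P. \<bar>f x - g x\<bar> \<le> e" using P(2) by eventually_elim (use g(2) in \<open>auto intro: less_imp_le\<close>)
      have i1: "integrable P f" by (rule P.integrable_const_bound[where B=1]) (use f(2) in auto)
      have i2: "integrable P (\<lambda>x. f x - g x)" by (rule P.integrable_const_bound[where B=e]) (use ae in auto)
      have i3: "integrable P g" using Bochner_Integration.integrable_diff[OF i1 i2] by simp
      have "\<bar>LINT x|P. f x - g x\<bar> \<le> (LINT x|P. \<bar>f x - g x\<bar>)" by (rule integral_abs_bound)
      also have "\<dots> \<le> e"
        using integral_mono_AE[of P "\<lambda>x. \<bar>f x - g x\<bar>" "\<lambda>_. e"] i2 ae by (simp add: P.prob_space)
      finally show ?thesis using i1 i3 by simp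
    qed
    show ?thesis
      using est[OF M K(2) mM(1)[OF f(1)] mM(1)[OF g(1)]] est[OF N K(3) mM(2)[OF f(1)] mM(2)[OF g(1)]] g(3) by linarith
  qed
  note * = this
  show "(LINT x|M. f x) = (LINT x|N. f x)"
  proof (rule ccontr)
    assume "(LINT x|M. f x) \<noteq> (LINT x|N. f x)"
    then have "\<bar>(LINT x|M. f x) - (LINT x|N. f x)\<bar> > 0" by simp
    then show False using *[of "\<bar>(LINT x|M. f x) - (LINT x|N. f x)\<bar> / 3"] by simp
  qed
qed

text \<open>Real polynomials in Re z and Im z, written through z and its conjugate: they form an
  algebra for Stone-Weierstrass, and their integrals reduce to those of
  \<open>z ^ a * cnj z ^ b\<close>.\<close>

inductive trig_poly :: "(complex \<Rightarrow> real) \<Rightarrow> bool" where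
  monom: "trig_poly (\<lambda>z. Re (c * z ^ a * cnj z ^ b))"
| add: "trig_poly f \<Longrightarrow> trig_poly g \<Longrightarrow> trig_poly (\<lambda>z. f z + g z)"

lemma trig_poly_mult:
  assumes "trig_poly f" "trig_poly g"
  shows "trig_poly (\<lambda>z. f z * g z)"
  using assms(1)
proof induction
  case (monom c a b)
  show ?case using assms(2)
  proof induction
    case (monom d a' b')
    have "(\<lambda>z. Re (c * z ^ a * cnj z ^ b) * Re (d * z ^ a' * cnj z ^ b')) =
      (\<lambda>z. Re ((c*d/2) * z ^ (a+a') * cnj z ^ (b+b')) + Re ((c * cnj d/2) * z ^ (a+b') * cnj z ^ (b+a')))"
    proof
      fix z
      \<comment> \<open>Product to sum, from \<open>Re v = (v + cnj v) / 2\<close>: a product of two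
        generators is a sum of two generators.\<close>
      have r: "Re u * Re v = Re (u * v / 2) + Re (u * cnj v / 2)" for u v by (simp add: field_simps)
      show "Re (c * z ^ a * cnj z ^ b) * Re (d * z ^ a' * cnj z ^ b') =
         Re ((c*d/2) * z ^ (a+a') * cnj z ^ (b+b')) + Re ((c * cnj d/2) * z ^ (a+b') * cnj z ^ (b+a'))"
        by (subst r) (simp add: complex_cnj_mult complex_cnj_power power_add ac_simps del: Re_divide_numeral times_complex.sel)
    qed
    then show ?case by (simp only: trig_poly.intros)
  next
    case (add f g) then show ?case by (simp add: distrib_left trig_poly.add)
  qed
next
  case (add f g) then show ?case by (simp add: distrib_right trig_poly.add)
qed

lemma trig_poly_continuous: "trig_poly f \<Longrightarrow> continuous_on S f"
  by (induction rule: trig_poly.induct) (auto intro!: continuous_intros)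

lemma trig_poly_dense:
  fixes f :: "complex \<Rightarrow> real"
  assumes "compact K" "continuous_on K f" "e > 0"
  shows "\<exists>g. trig_poly g \<and> (\<forall>x\<in>K. \<bar>f x - g x\<bar> < e)"
proof (rule Stone_Weierstrass_HOL[OF assms(1), where P=trig_poly])
  show "trig_poly (\<lambda>x. c)" for c using trig_poly.monom[of "of_real c" 0 0] by simp
  show "\<exists>f. trig_poly f \<and> f x \<noteq> f y" if "x \<in> K \<and> y \<in> K \<and> x \<noteq> y" for x y
  proof (cases "Re x = Re y")
    case True
    then have "Im x \<noteq> Im y" using that by (simp add: complex_eq_iff)
    then show ?thesis using trig_poly.monom[of "-\<i>" 1 0] by (intro exI[of _ Im]) simp
  next
    case False then show ?thesis using trig_poly.monom[of 1 1 0] by (intro exI[of _ Re]) simp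
  qed
qed (use assms in \<open>auto intro: trig_poly_continuous trig_poly.add trig_poly_mult\<close>)

lemma probT_D:
  assumes "M \<in> probT"
  shows "prob_space M" "sets M = sets borel" "space M = UNIV" "AE z in M. cmod z = 1"
  using assms sets_eq_imp_space_eq[of M borel] by (auto simp: probT_def)

text \<open>On the circle \<open>cnj z\<close> is the inverse of z, so every mixed moment is a
  moment or the conjugate of one, and trigonometric polynomials are dense.\<close>

lemma probT_eqI_moments:
  assumes M: "M \<in> probT" and N: "N \<in> probT"
    and eq: "\<And>k. (LINT x|M. x ^ k) = (LINT x|N. x ^ k)"
  shows "M = N"
proof (rule measure_eqI_dense[of M N "sphere 0 1"])
  note m = probT_D[OF M] and n = probT_D[OF N]
  interpret M: prob_space M by (rule m)
  interpret N: prob_space N by (rule n)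
  show "AE x in M. x \<in> sphere 0 1" "AE x in N. x \<in> sphere 0 1" using m(4) n(4) by (auto simp: dist_norm)
  have [measurable]: "f \<in> borel_measurable M" "f \<in> borel_measurable N" if "continuous_on UNIV f" for f :: "complex \<Rightarrow> complex"
    using borel_measurable_continuous_onI[OF that] measurable_cong_sets[OF m(2) refl] measurable_cong_sets[OF n(2) refl] by auto
  have mono: "(LINT z|M. z ^ a * cnj z ^ b) = (LINT z|N. z ^ a * cnj z ^ b)" for a b
  proof -
    have r1: "(LINT z|P. z ^ a * cnj z ^ b) = (if a \<ge> b then (LINT z|P. z ^ (a-b)) else cnj (LINT z|P. z ^ (b-a)))"
      if P: "P \<in> probT" for P
    proof -
      note p = probT_D[OF P]
      have pm: "f \<in> borel_measurable P" if "continuous_on UNIV f" for f :: "complex \<Rightarrow> complex"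
        using borel_measurable_continuous_onI[OF that] measurable_cong_sets[OF p(2) refl] by auto
      have "z ^ a * cnj z ^ b = (if a \<ge> b then z ^ (a-b) else cnj (z ^ (b-a)))" if z: "cmod z = 1" for z
      proof -
        have o: "z * cnj z = 1" using complex_norm_square[of z] z by simp
        show ?thesis
        proof (cases "a \<ge> b")
          case True
          then have "z ^ a * cnj z ^ b = z ^ (a-b) * (z * cnj z) ^ b" by (simp add: power_mult_distrib flip: power_add)
          then show ?thesis using True o by simp
        next
          case False
          have "cnj z ^ b = cnj z ^ (b-a) * cnj z ^ a" using False by (simp flip: power_add)
          then have "z ^ a * cnj z ^ b = cnj z ^ (b-a) * (z * cnj z) ^ a" by (simp add: power_mult_distrib)
          then show ?thesis using False o by simp
        qed
      qed
      then have "(LINT z|P. z ^ a * cnj z ^ b) = (LINT z|P. (if a \<ge> b then z ^ (a-b) else cnj (z ^ (b-a))))"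
        by (intro integral_cong_AE pm eventually_mono[OF p(4)]) (cases "b \<le> a"; auto intro!: continuous_intros)+
      also have "\<dots> = (if a \<ge> b then (LINT z|P. z ^ (a-b)) else cnj (LINT z|P. z ^ (b-a)))"
        by (auto simp del: complex_cnj_power)
      finally show ?thesis .
    qed
    show ?thesis by (simp add: r1[OF M] r1[OF N] eq)
  qed
  have intc: "integrable P f" if P: "P \<in> probT" and f: "continuous_on UNIV f" for P and f :: "complex \<Rightarrow> 'c::euclidean_space"
  proof -
    note p = probT_D[OF P]
    interpret P: prob_space P by (rule p)
    have "compact (f ` sphere 0 1)"
      by (intro compact_continuous_image continuous_on_subset[OF f]) auto
    then obtain B where B: "\<And>z. z \<in> sphere 0 1 \<Longrightarrow> norm (f z) \<le> B" 
      by (metis bounded_iff compact_imp_bounded imageI)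
    show ?thesis
    proof (rule P.integrable_const_bound[where B=B])
      show "AE x in P. norm (f x) \<le> B" using p(4) by eventually_elim (use B in \<open>auto simp: dist_norm\<close>)
      show "f \<in> borel_measurable P"
        using borel_measurable_continuous_onI[OF f] measurable_cong_sets[OF p(2) refl] by auto
    qed
  qed
  have tp: "(LINT x|M. g x) = (LINT x|N. g x)" if "trig_poly g" for g using that
  proof induction
    case (monom c a b)
    have "(LINT z|P. Re (c * z ^ a * cnj z ^ b)) = Re (c * (LINT z|P. z ^ a * cnj z ^ b))" if P: "P \<in> probT" for P
    proof -
      have "integrable P (\<lambda>z. c * (z ^ a * cnj z ^ b))"
        by (rule intc[OF P]) (intro continuous_intros)
      from integral_Re[OF this] show ?thesis by (simp add: mult.assoc)
    qed
    then show ?case using M N mono by simp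
  next
    case (add f g)
    have "(LINT x|P. f x + g x) = (LINT x|P. f x) + (LINT x|P. g x)" if P: "P \<in> probT" for P
      by (intro Bochner_Integration.integral_add intc P trig_poly_continuous add)
    then show ?case using add M N by simp
  qed
  show "\<exists>g. continuous_on UNIV g \<and> (\<forall>x\<in>sphere 0 1. \<bar>f x - g x\<bar> < e) \<and> (LINT x|M. g x) = (LINT x|N. g x)"
    if "continuous_on (sphere 0 1) f" "e > 0" for f :: "complex \<Rightarrow> real" and e
    using trig_poly_dense[OF compact_sphere that] tp trig_poly_continuous by blast
qed (use probT_D[OF M] probT_D[OF N] in auto)

section \<open>Herglotz representation on the disc\<close>

text \<open>Supplies a dominating constant for difference quotients that depends on f only through
  \<open>B\<close>. Cauchy's inequality on discs of radius r/4 about the points of the ball of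
  radius r/2 bounds the derivative by B / (r/4).\<close>

lemma difference_quotient_bound:
  assumes hol: "f holomorphic_on ball z0 r" and r: "0 < r"
    and B: "\<And>\<zeta>. \<zeta> \<in> ball z0 r \<Longrightarrow> norm (f \<zeta>) \<le> B" and z: "z \<in> ball z0 (r/2)"
  shows "norm ((f z - f z0) / (z - z0)) \<le> 4 * B / r"
proof -
  have sub: "cball \<xi> (r/4) \<subseteq> ball z0 r" if "\<xi> \<in> ball z0 (r/2)" for \<xi>
  proof
    fix x assume "x \<in> cball \<xi> (r/4)"
    then show "x \<in> ball z0 r" using that dist_triangle[of z0 x \<xi>] r by (auto simp: dist_commute)
  qed
  have "norm (f z - f z0) \<le> (4 * B / r) * norm (z - z0)"
  proof (rule field_differentiable_bound[where S="ball z0 (r/2)" and f'="deriv f"])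
    fix \<xi> assume x: "\<xi> \<in> ball z0 (r/2)"
    then have "\<xi> \<in> ball z0 r" using r by auto
    then show "(f has_field_derivative deriv f \<xi>) (at \<xi> within ball z0 (r/2))"
      using hol holomorphic_derivI open_ball has_field_derivative_at_within by metis
    have "norm ((deriv ^^ 1) f \<xi>) \<le> fact 1 * B / (r/4) ^ 1"
    proof (rule Cauchy_inequality)
      show "f holomorphic_on ball \<xi> (r/4)"
        by (rule holomorphic_on_subset[OF hol]) (use sub[OF x] ball_subset_cball in blast)
      show "continuous_on (cball \<xi> (r/4)) f"
        by (rule continuous_on_subset[OF holomorphic_on_imp_continuous_on[OF hol] sub[OF x]])
      show "norm (f y) \<le> B" if "norm (\<xi> - y) = r/4" for y
        using B sub[OF x] that by (auto simp: dist_norm subset_iff)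
    qed (use r in auto)
    then show "norm (deriv f \<xi>) \<le> 4 * B / r" by (simp add: mult.commute)
  qed (use r z in auto)
  moreover have "0 \<le> B" using B[of z0] r by (smt (verit) centre_in_ball norm_ge_zero)
  ultimately show ?thesis
    using r by (cases "z = z0") (auto simp: norm_divide divide_le_eq)
qed

lemma holomorphic_on_integral:
  fixes F :: "complex \<Rightarrow> 'a \<Rightarrow> complex"
  assumes S: "open S" and M: "finite_measure M"
    and meas: "\<And>z. z \<in> S \<Longrightarrow> F z \<in> borel_measurable M"
    and hol: "AE t in M. (\<lambda>z. F z t) holomorphic_on S"
    and bnd: "\<And>z. z \<in> S \<Longrightarrow> \<exists>r>0. \<exists>B. ball z r \<subseteq> S \<and> (AE t in M. \<forall>\<zeta>\<in>ball z r. norm (F \<zeta> t) \<le> B)"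
  shows "(\<lambda>z. LINT t|M. F z t) holomorphic_on S"
  unfolding holomorphic_on_open[OF S]
proof
  interpret finite_measure M by fact
  fix z0 assume z0: "z0 \<in> S"
  obtain r B where r: "r > 0" and sub: "ball z0 r \<subseteq> S"
    and B: "AE t in M. \<forall>\<zeta>\<in>ball z0 r. norm (F \<zeta> t) \<le> B" using bnd[OF z0] by blast
  define h where "h = (\<lambda>n. of_real (r / (real n + 3)) :: complex)"
  have "norm (h n) = r / (real n + 3)" for n unfolding h_def norm_of_real using r by simp
  moreover have "0 < r / (real n + 3)" "r / (real n + 3) < r / 1" for n
    using r by (simp, intro divide_strict_left_mono) auto
  ultimately have h0: "h n \<noteq> 0" "norm (h n) < r" for n
    by (metis norm_zero less_irrefl, metis div_by_1)
  have "h \<longlonglongrightarrow> of_real 0" unfolding h_def by (intro tendsto_of_real) real_asymp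
  then have hl: "h \<longlonglongrightarrow> 0" by simp
  \<comment> \<open>A limit along one fixed sequence of increments, so that measurability in t is
    automatic; where \<open>F z t\<close> is holomorphic in z it is the derivative at
    \<open>z0\<close>.\<close>
  define D where "D t = lim (\<lambda>n. (F (z0 + h n) t - F z0 t) / h n)" for t
  have hS: "z0 + h n \<in> S" for n using sub h0(2)[of n] by (auto simp: dist_norm subset_iff)
  have [measurable]: "F z0 \<in> borel_measurable M" "F (z0 + h n) \<in> borel_measurable M" for n
    using meas z0 hS by auto
  have mD: "D \<in> borel_measurable M" unfolding D_def by measurable
  have der: "((\<lambda>z. F z t) has_field_derivative D t) (at z0)"
    if ht: "(\<lambda>z. F z t) holomorphic_on S" for t
  proof -
    obtain d where d: "((\<lambda>z. F z t) has_field_derivative d) (at z0)"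
      using ht z0 unfolding holomorphic_on_open[OF S] by auto
    then have *: "(\<lambda>n. (F (X n) t - F z0 t) / (X n - z0)) \<longlonglongrightarrow> d"
      if "\<forall>n. X n \<in> UNIV - {z0}" "X \<longlonglongrightarrow> z0" for X
      using that unfolding has_field_derivative_iff tendsto_at_iff_sequentially o_def by blast
    have "(\<lambda>n. z0 + h n) \<longlonglongrightarrow> z0" using tendsto_add[OF tendsto_const hl, of z0] by simp
    then have "(\<lambda>n. (F (z0 + h n) t - F z0 t) / h n) \<longlonglongrightarrow> d"
      using *[of "\<lambda>n. z0 + h n"] h0(1) by simp
    then have "D t = d" unfolding D_def by (rule limI)
    then show ?thesis using d by simp
  qed
  have intF: "integrable M (F z)" if "z \<in> ball z0 r" for z
    by (rule integrable_const_bound[where B=B]) (use B that sub meas in auto)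
  have "((\<lambda>z. ((LINT t|M. F z t) - (LINT t|M. F z0 t)) / (z - z0)) \<longlongrightarrow> (LINT t|M. D t)) (at z0)"
    unfolding tendsto_at_iff_sequentially
  proof (intro allI impI)
    fix X assume X0: "\<forall>i. X i \<in> UNIV - {z0}" and Xl: "X \<longlonglongrightarrow> z0"
    have "eventually (\<lambda>i. X i \<in> ball z0 (r/2)) sequentially"
      using r by (intro topological_tendstoD[OF Xl]) auto
    \<comment> \<open>Dropping k terms puts the whole sequence into the half ball, where the
      difference quotients are dominated.\<close>
    then obtain k where k: "\<And>i. X (i + k) \<in> ball z0 (r/2)"
      unfolding eventually_sequentially by (metis le_add2)
    define Y where "Y i = X (i + k)" for i
    have Yb: "Y i \<in> ball z0 (r/2)" "Y i \<noteq> z0" for i using k X0 by (auto simp: Y_def)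
    have Yr: "Y i \<in> ball z0 r" for i using Yb(1)[of i] r by auto
    have Yl: "Y \<longlonglongrightarrow> z0" unfolding Y_def by (rule LIMSEQ_ignore_initial_segment[OF Xl])
    have [measurable]: "F (Y i) \<in> borel_measurable M" for i using meas Yr sub by blast
    have "(\<lambda>i. LINT t|M. (F (Y i) t - F z0 t) / (Y i - z0)) \<longlonglongrightarrow> (LINT t|M. D t)"
    proof (rule integral_dominated_convergence[where w="\<lambda>_. 4 * B / r"])
      show "AE t in M. (\<lambda>i. (F (Y i) t - F z0 t) / (Y i - z0)) \<longlonglongrightarrow> D t"
        using hol
      proof eventually_elim
        fix t assume "(\<lambda>z. F z t) holomorphic_on S"
        from der[OF this] have "((\<lambda>z. (F z t - F z0 t) / (z - z0)) \<longlongrightarrow> D t) (at z0)" by (simp add: has_field_derivative_iff)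
        then show "(\<lambda>i. (F (Y i) t - F z0 t) / (Y i - z0)) \<longlonglongrightarrow> D t"
          using Yl Yb(2) unfolding tendsto_at_iff_sequentially o_def by blast
      qed
      show "AE t in M. norm ((F (Y i) t - F z0 t) / (Y i - z0)) \<le> 4 * B / r" for i
        using hol B
      proof eventually_elim
        fix t assume t: "(\<lambda>z. F z t) holomorphic_on S" "\<forall>\<zeta>\<in>ball z0 r. norm (F \<zeta> t) \<le> B"
        show "norm ((F (Y i) t - F z0 t) / (Y i - z0)) \<le> 4 * B / r"
          by (rule difference_quotient_bound[OF holomorphic_on_subset[OF t(1) sub] r _ Yb(1)]) (use t in auto)
      qed
    qed (use mD in auto)
    moreover have "(LINT t|M. (F (Y i) t - F z0 t) / (Y i - z0)) = ((LINT t|M. F (Y i) t) - (LINT t|M. F z0 t)) / (Y i - z0)" for i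
      using intF[OF Yr] intF[of z0] r by simp
    ultimately have "(\<lambda>i. ((LINT t|M. F (Y i) t) - (LINT t|M. F z0 t)) / (Y i - z0)) \<longlonglongrightarrow> (LINT t|M. D t)" by (simp only:)
    then show "((\<lambda>z. ((LINT t|M. F z t) - (LINT t|M. F z0 t)) / (z - z0)) \<circ> X) \<longlonglongrightarrow> (LINT t|M. D t)"
      unfolding o_def Y_def by (rule LIMSEQ_offset)
  qed
  then show "\<exists>f'. ((\<lambda>z. LINT t|M. F z t) has_field_derivative f') (at z0)"
    by (auto simp: has_field_derivative_iff)
qed

section \<open>Poisson integrals and weak limits\<close>

abbreviation circ :: "real \<Rightarrow> complex" where "circ t \<equiv> cis (2 * pi * t)"

text \<open>Cauchy's integral formula over the unit circle parametrised by [0,1]: the derivative of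
  \<open>circ\<close> is 2 pi i times \<open>circ\<close>, which produces the factor
  \<open>circ t\<close>.\<close>

lemma circle_mean:
  assumes contf: "continuous_on (cball 0 1) F" and holf: "F holomorphic_on ball 0 1" and z: "norm z < 1"
  shows "set_integrable lborel {0..1} (\<lambda>t. F (circ t) * circ t / (circ t - z))"
    and "(LINT t:{0..1}|lborel. F (circ t) * circ t / (circ t - z)) = F z"
proof -
  have nz: "circ t - z \<noteq> 0" for t using z by (metis eq_iff_diff_eq_0 norm_cis order_less_irrefl)
  show i: "set_integrable lborel {0..1} (\<lambda>t. F (circ t) * circ t / (circ t - z))"
    by (rule borel_integrable_atLeastAtMost')
       (use nz in \<open>auto intro!: continuous_intros continuous_on_compose2[OF contf]\<close>)
  have "((\<lambda>u. F u / (u - z)) has_contour_integral (2 * of_real pi * \<i> * F z)) (circlepath 0 1)"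
    by (rule Cauchy_integral_circlepath[OF contf holf]) (use z in simp)
  then have "((\<lambda>t. F (circ t) / (circ t - z) * vector_derivative (circlepath 0 1) (at t within {0..1}))
      has_integral (2 * of_real pi * \<i> * F z)) {0..1}"
    unfolding has_contour_integral_def by (simp add: circlepath cis_conv_exp mult_ac)
  then have "((\<lambda>t. (2 * of_real pi * \<i>) * (F (circ t) * circ t / (circ t - z))) has_integral (2 * of_real pi * \<i> * F z)) {0..1}"
    by (rule has_integral_eq[rotated])
       (simp add: vector_derivative_circlepath01 cis_conv_exp mult_ac)
  then have "((\<lambda>t. F (circ t) * circ t / (circ t - z)) has_integral F z) {0..1}"
    by (subst (asm) has_integral_mult_right_iff) (auto)
  then show "(LINT t:{0..1}|lborel. F (circ t) * circ t / (circ t - z)) = F z"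
    using set_borel_integral_eq_integral(2)[OF i] by (simp add: integral_unique)
qed

lemma poisson_kernel_cis:
  assumes "norm z < 1"
  shows "1 / (1 - z * cnj (cis s)) = cis s / (cis s - z)"
proof -
  have 1: "cis s * cnj (cis s) = 1" using complex_norm_square[of "cis s"] by simp
  have "cis s * (1 - z * cnj (cis s)) = cis s - z * (cis s * cnj (cis s))" by (simp add: algebra_simps del: cis_cnj)
  then have "cis s * (1 - z * cnj (cis s)) = cis s - z" using 1 by simp
  then have "cis s / (cis s - z) = cis s / (cis s * (1 - z * cnj (cis s)))" by simp
  also have "\<dots> = 1 / (1 - z * cnj (cis s))" by simp
  finally show ?thesis ..
qed

text \<open>The measure has density 2 Re g - 1 = g + cnj g - 1 on [0,1]. Against the kernel the
  first term gives g z by Cauchy's formula, the conjugate term gives 1 by the mean value property,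
  and the constant takes 1 away. The fixed half-open interval carrying the mass prepares a tightness
  argument.\<close>

lemma herglotz_smooth:
  assumes hol: "g holomorphic_on ball 0 R" and R: "R > 1" and g0: "g 0 = 1"
    and Re: "\<And>z. z \<in> ball 0 R \<Longrightarrow> Re (g z) \<ge> 1/2"
  shows "\<exists>\<mu>. real_distribution \<mu> \<and> measure \<mu> {-1<..1} = 1 \<and>
      (\<forall>z. norm z < 1 \<longrightarrow> (LINT t|\<mu>. 1 / (1 - z * cnj (circ t))) = g z)"
proof -
  have sub: "cball 0 1 \<subseteq> ball (0::complex) R" using R by auto
  have cg: "continuous_on (cball 0 1) g"
    by (rule continuous_on_subset[OF holomorphic_on_imp_continuous_on[OF hol] sub])
  have hg: "g holomorphic_on ball 0 1" by (rule holomorphic_on_subset[OF hol]) (use R in auto)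
  define d where "d t = 2 * Re (g (circ t)) - 1" for t
  have cgc: "continuous_on UNIV (\<lambda>t. g (circ t))"
    by (rule continuous_on_compose2[OF cg]) (auto intro!: continuous_intros)
  have d0: "d t \<ge> 0" for t using Re[of "circ t"] R by (simp add: d_def)
  have cd: "continuous_on A d" for A unfolding d_def using continuous_on_subset[OF cgc] by (auto intro!: continuous_intros)
  have I: "(LINT t:{0..1}|lborel. of_real (d t) * (circ t / (circ t - z))) = g z" if z: "norm z < 1" for z
  proof -
    note A = circle_mean[OF cg hg z]
    have nz: "1 - cnj z * u \<noteq> 0" if "norm u \<le> 1" for u
    proof
      assume "1 - cnj z * u = 0"
      then have "norm (cnj z * u) = 1" by (metis eq_iff_diff_eq_0 norm_one)
      moreover have "norm (cnj z * u) \<le> norm z * 1" unfolding norm_mult using that by (intro mult_mono) auto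
      ultimately show False using z by simp
    qed
    \<comment> \<open>The conjugate of \<open>F (circ t)\<close> is \<open>cnj (g (circ t))\<close>
      times the kernel, so this term is the conjugate of a mean value of a holomorphic function,
      with \<open>F 0 = 1\<close>.\<close>
    define F where "F u = g u / (1 - cnj z * u)" for u
    have cF: "continuous_on (cball 0 1) F" unfolding F_def using nz by (auto intro!: continuous_intros cg)
    have hF: "F holomorphic_on ball 0 1" unfolding F_def using nz by (auto intro!: holomorphic_intros hg)
    have "set_integrable lborel {0..1} (\<lambda>t. F (circ t) * circ t / (circ t - 0))"
         "(LINT t:{0..1}|lborel. F (circ t) * circ t / (circ t - 0)) = F 0"
      using circle_mean[OF cF hF, of 0] by auto
    then have A2: "set_integrable lborel {0..1} (\<lambda>t. F (circ t))" "(LINT t:{0..1}|lborel. F (circ t)) = 1"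
      by (simp_all add: F_def g0)
    have A2': "set_integrable lborel {0..1} (\<lambda>t. cnj (F (circ t)))" "(LINT t:{0..1}|lborel. cnj (F (circ t))) = 1"
    proof -
      have *: "cnj (indicator {0..1} t *\<^sub>R F (circ t)) = indicator {0..1} t *\<^sub>R cnj (F (circ t))" for t :: real
        by (simp add: scaleR_conv_of_real)
      show "set_integrable lborel {0..1} (\<lambda>t. cnj (F (circ t)))"
        using integrable_cnj[OF A2(1)[unfolded set_integrable_def]] unfolding set_integrable_def * .
      show "(LINT t:{0..1}|lborel. cnj (F (circ t))) = 1"
        using Bochner_Integration.integral_cnj[of lborel "\<lambda>t. indicator {0..1} t *\<^sub>R F (circ t)"] A2(2)
        unfolding set_lebesgue_integral_def * by (metis complex_cnj_one)
    qed
    have eq: "of_real (d t) * (circ t / (circ t - z)) =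
        g (circ t) * circ t / (circ t - z) + cnj (F (circ t)) - 1 * circ t / (circ t - z)" for t
    proof -
      have "cnj (F (circ t)) = cnj (g (circ t)) * (circ t / (circ t - z))"
        unfolding poisson_kernel_cis[OF z, symmetric] by (simp add: F_def)
      moreover have "complex_of_real (d t) = g (circ t) + cnj (g (circ t)) - 1"
        unfolding complex_add_cnj d_def by simp
      ultimately show ?thesis
        unfolding times_divide_eq_right[symmetric] by (simp only: ring_distribs)
    qed
    have A3: "set_integrable lborel {0..1} (\<lambda>t. 1 * circ t / (circ t - z))"
       "(LINT t:{0..1}|lborel. 1 * circ t / (circ t - z)) = 1"
      using circle_mean[where F="\<lambda>_. 1", OF _ _ z] by auto
    show ?thesis
      unfolding eq using set_integral_diff(2)[OF set_integral_add(1)[OF A(1) A2'(1)] A3(1)]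
        set_integral_add(2)[OF A(1) A2'(1)] A(2) A2'(2) A3(2) by simp
  qed
  define w where "w t = indicator {0..1} t * d t" for t :: real
  have w0: "w t \<ge> 0" for t using d0 by (simp add: w_def)
  have iw: "integrable lborel w"
    using borel_integrable_atLeastAtMost'[OF cd, of 0 1] unfolding w_def set_integrable_def by simp
  have [measurable]: "w \<in> borel_measurable borel" using iw by auto
  have [measurable]: "circ \<in> borel_measurable borel"
    by (intro borel_measurable_continuous_onI continuous_intros)
  define \<mu> where "\<mu> = density lborel (\<lambda>t. ennreal (w t))"
  have "complex_of_real (LINT t|lborel. w t) = (LINT t:{0..1}|lborel. of_real (d t) * (circ t / (circ t - 0)))"
    unfolding set_lebesgue_integral_def integral_complex_of_real[symmetric]
    by (intro Bochner_Integration.integral_cong) (auto simp: w_def scaleR_conv_of_real)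
  then have w1: "(LINT t|lborel. w t) = 1" using I[of 0] g0 by simp
  have em: "emeasure \<mu> A = 1" if A: "A \<in> sets borel" "{0..1} \<subseteq> A" for A
  proof -
    have "emeasure \<mu> A = (\<integral>\<^sup>+ t. ennreal (w t) * indicator A t \<partial>lborel)"
      unfolding \<mu>_def using A by (subst emeasure_density) auto
    also have "\<dots> = (\<integral>\<^sup>+ t. ennreal (w t) \<partial>lborel)"
      using A(2) by (intro nn_integral_cong) (auto simp: w_def indicator_def)
    also have "\<dots> = ennreal 1" by (subst nn_integral_eq_integral[OF iw]) (use w0 w1 in auto)
    finally show ?thesis by simp
  qed
  have pr: "prob_space \<mu>" by (rule prob_spaceI) (use em[of UNIV] in \<open>simp add: \<mu>_def\<close>)
  then interpret prob_space \<mu> .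
  have "real_distribution \<mu>" unfolding real_distribution_def real_distribution_axioms_def
    using pr by (simp add: \<mu>_def)
  moreover have "measure \<mu> {-1<..1} = 1" using em[of "{-1<..1}"]
    unfolding measure_def by (simp add: subset_iff)
  moreover have "(LINT t|\<mu>. 1 / (1 - z * cnj (circ t))) = g z" if z: "norm z < 1" for z
  proof -
    have "(LINT t|\<mu>. 1 / (1 - z * cnj (circ t))) = (LINT t|\<mu>. circ t / (circ t - z))"
      by (simp only: poisson_kernel_cis[OF z])
    also have "\<dots> = (LINT t|lborel. w t *\<^sub>R (circ t / (circ t - z)))"
      unfolding \<mu>_def by (rule integral_density) (use w0 in auto)
    also have "\<dots> = (LINT t:{0..1}|lborel. of_real (d t) * (circ t / (circ t - z)))"
      unfolding set_lebesgue_integral_def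
      by (intro Bochner_Integration.integral_cong) (auto simp: w_def scaleR_conv_of_real)
    also have "\<dots> = g z" by (rule I[OF z])
    finally show ?thesis .
  qed
  ultimately show ?thesis by blast
qed

text \<open>Dilations g(r z) with r < 1 extend past the circle, so the smooth case applies; the
  resulting measures sit on one bounded interval, hence are tight, and a weak limit represents g.
  The bound 1/2 in place of the customary 0 belongs to the kernel 1 / (1 - z x), whose real part
  exceeds 1/2.\<close>

theorem herglotz:
  assumes hol: "g holomorphic_on ball 0 1" and g0: "g 0 = 1"
    and Re: "\<And>z. norm z < 1 \<Longrightarrow> Re (g z) \<ge> 1/2"
  shows "\<exists>M\<in>probT. \<forall>z. norm z < 1 \<longrightarrow> (LINT x|M. 1 / (1 - z * x)) = g z"
proof -
  define r where "r n = 1 - 1 / (real n + 2)" for n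
  have r: "0 < r n" "r n < 1" for n by (auto simp: r_def field_simps)
  have rl: "r \<longlonglongrightarrow> 1" unfolding r_def by real_asymp
  have "\<exists>\<mu>. real_distribution \<mu> \<and> measure \<mu> {-1<..1} = 1 \<and>
      (\<forall>z. norm z < 1 \<longrightarrow> (LINT t|\<mu>. 1 / (1 - z * cnj (circ t))) = g (of_real (r n) * z))" for n
  proof (rule herglotz_smooth[where R="1 / r n"])
    have im: "of_real (r n) * z \<in> ball 0 1" if "z \<in> ball 0 (1 / r n)" for z :: complex
      using that r[of n] by (simp add: norm_mult field_simps)
    show "(\<lambda>z. g (of_real (r n) * z)) holomorphic_on ball 0 (1 / r n)"
      by (rule holomorphic_on_compose_gen[where g=g and t="ball 0 1", unfolded o_def, OF _ hol])
         (use im in \<open>auto intro!: holomorphic_intros\<close>)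
    show "1 / 2 \<le> Re (g (of_real (r n) * z))" if "z \<in> ball 0 (1 / r n)" for z
      using Re im[OF that] by simp
  qed (use r[of n] g0 in \<open>auto simp: field_simps\<close>)
  then obtain \<mu> where \<mu>: "\<And>n. real_distribution (\<mu> n)" "\<And>n. measure (\<mu> n) {-1<..1} = 1"
      "\<And>n z. norm z < 1 \<Longrightarrow> (LINT t|\<mu> n. 1 / (1 - z * cnj (circ t))) = g (of_real (r n) * z)"
    by metis
  have "tight \<mu>" unfolding tight_def
  proof (intro conjI allI impI)
    show "\<exists>a b. a < b \<and> (\<forall>n. 1 - \<epsilon> < measure (\<mu> n) {a<..b})" if "0 < \<epsilon>" for \<epsilon>
      by (rule exI[of _ "-1"], rule exI[of _ 1]) (use that \<mu>(2) in auto)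
  qed (use \<mu>(1) in auto)
  from tight_imp_convergent_subsubsequence[OF this strict_mono_id]
  obtain k M where k: "strict_mono k" and M: "real_distribution M" and wc: "weak_conv_m (\<mu> \<circ> id \<circ> k) M"
    by blast
  interpret M: real_distribution M by fact
  \<comment> \<open>The conjugate turns the kernel \<open>1 / (1 - z * cnj (circ t))\<close> into
    \<open>1 / (1 - z * x)\<close>.\<close>
  define N where "N = distr M borel (\<lambda>t. cnj (circ t))"
  have cc: "continuous_on UNIV (\<lambda>t. cnj (circ t))" by (intro continuous_intros)
  have [measurable]: "(\<lambda>t. cnj (circ t)) \<in> borel_measurable borel"
    by (rule borel_measurable_continuous_onI[OF cc])
  have [measurable]: "(\<lambda>t. cnj (circ t)) \<in> M \<rightarrow>\<^sub>M borel" using borel_measurable_continuous_onI[OF cc] by simp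
  have "N \<in> probT"
    unfolding probT_def N_def using M.prob_space_distr[of "\<lambda>t. cnj (circ t)"]
    by (auto simp: AE_distr_iff)
  moreover have "(LINT x|N. 1 / (1 - z * x)) = g z" if z: "norm z < 1" for z
  proof -
    have low: "1 - norm z \<le> norm (1 - z * cnj (circ t))" for t
      using norm_triangle_ineq2[of 1 "z * cnj (circ t)"] by (simp add: norm_mult)
    then have nz: "1 - z * cnj (circ t) \<noteq> 0" for t using z by (smt (verit) norm_zero)
    have "(\<lambda>n. LINT t|(\<mu> \<circ> id \<circ> k) n. 1 / (1 - z * cnj (circ t))) \<longlonglongrightarrow> (LINT t|M. 1 / (1 - z * cnj (circ t)))"
    proof (rule weak_conv_imp_integral_bdd_continuous_conv[OF _ _ wc, where B="1 / (1 - norm z)"])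
      show "isCont (\<lambda>t. 1 / (1 - z * cnj (circ t))) t" for t
      proof -
        have "continuous_on UNIV (\<lambda>t. 1 / (1 - z * cnj (circ t)))"
          using nz by (intro continuous_intros) auto
        then show ?thesis by (simp add: continuous_on_eq_continuous_at)
      qed
      show "norm (1 / (1 - z * cnj (circ t))) \<le> 1 / (1 - norm z)" for t
        unfolding norm_divide norm_one using low[of t] z by (intro divide_left_mono) (auto intro!: mult_pos_pos simp: nz)
    qed (use \<mu>(1) M in auto)
    then have 1: "(\<lambda>n. g (of_real (r (k n)) * z)) \<longlonglongrightarrow> (LINT t|M. 1 / (1 - z * cnj (circ t)))"
      using \<mu>(3)[OF z] by simp
    have "isCont g z" using holomorphic_on_imp_continuous_on[OF hol] z
      by (simp add: continuous_on_eq_continuous_at)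
    moreover have "(\<lambda>n. complex_of_real (r (k n)) * z) \<longlonglongrightarrow> of_real 1 * z"
      by (intro tendsto_intros) (use LIMSEQ_subseq_LIMSEQ[OF rl k] in \<open>simp add: o_def\<close>)
    ultimately have "(\<lambda>n. g (of_real (r (k n)) * z)) \<longlonglongrightarrow> g z"
      using isCont_tendsto_compose[of z g] by simp
    with 1 have "(LINT t|M. 1 / (1 - z * cnj (circ t))) = g z" using LIMSEQ_unique by blast
    moreover have "(LINT x|N. 1 / (1 - z * x)) = (LINT t|M. 1 / (1 - z * cnj (circ t)))"
      unfolding N_def by (subst integral_distr) auto
    ultimately show ?thesis by simp
  qed
  ultimately show ?thesis by blast
qed

section \<open>Probability measures on the circle\<close>

text \<open>Generating function of the moments, that is, G(1/z)/z continued to 0.\<close>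

definition gT :: "complex measure \<Rightarrow> complex \<Rightarrow> complex" where
  "gT M z = (LINT x|M. 1 / (1 - z * x))"

text \<open>The quotient (\<open>gT\<close> - 1)/z with its singularity at 0 removed, so that
  \<open>hT\<close> = \<open>pT\<close> / \<open>gT\<close> is holomorphic at 0 as well.\<close>

definition pT :: "complex measure \<Rightarrow> complex \<Rightarrow> complex" where
  "pT M z = (LINT x|M. x / (1 - z * x))"

lemma one_minus_mult_lower:
  fixes z x :: complex
  assumes "cmod z < 1" "cmod x \<le> 1"
  shows "1 - cmod z \<le> cmod (1 - z * x)" "1 - z * x \<noteq> 0"
proof -
  have "cmod (z * x) \<le> cmod z * 1" unfolding norm_mult using assms by (intro mult_mono) auto
  then show *: "1 - cmod z \<le> cmod (1 - z * x)" using norm_triangle_ineq2[of 1 "z * x"] by simp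
  show "1 - z * x \<noteq> 0" using * assms(1) by (metis diff_gt_0_iff_gt norm_zero not_le)
qed

text \<open>The circle of radius |u| about 0 is mapped by 1 / (1 - u) to a circle whose leftmost
  point, the image of -|u|, is 1 / (1 + |u|). Cleared of denominators the bound reads
  \<open>0 \<le> (1 - r) * (r + a)\<close>.\<close>

lemma Re_inverse_one_minus:
  assumes "cmod u < 1"
  shows "Re (1 / (1 - u)) \<ge> 1 / (1 + cmod u)"
proof -
  define r a where "r = cmod u" and "a = Re u"
  have r: "0 \<le> r" "r < 1" "-r \<le> a" using assms abs_Re_le_cmod[of u] by (auto simp: r_def a_def)
  have "r\<^sup>2 = (Re u)\<^sup>2 + (Im u)\<^sup>2" by (simp add: r_def cmod_power2)
  moreover have "(cmod (1 - u))\<^sup>2 = (1 - Re u)\<^sup>2 + (Im u)\<^sup>2" by (simp add: cmod_power2)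
  ultimately have n2: "(cmod (1 - u))\<^sup>2 = 1 - 2 * a + r\<^sup>2"
    unfolding a_def power2_eq_square by algebra
  have "1 - u \<noteq> 0" using assms by (metis eq_iff_diff_eq_0 less_irrefl norm_one)
  then have pos: "1 - 2 * a + r\<^sup>2 > 0" using n2 by (metis norm_eq_zero zero_less_power2)
  have "Re (1 / (1 - u)) = (1 - a) / (1 - 2 * a + r\<^sup>2)"
    unfolding n2[symmetric] by (simp add: Re_divide cmod_power2 a_def)
  moreover have "0 \<le> (1 - r) * (r + a)" using r by auto
  then have "1 * (1 - 2 * a + r\<^sup>2) \<le> (1 - a) * (1 + r)" by (simp add: power2_eq_square algebra_simps)
  then have "1 / (1 + r) \<le> (1 - a) / (1 - 2 * a + r\<^sup>2)" using pos r by (simp add: divide_le_eq le_divide_eq field_simps)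
  ultimately show ?thesis by (simp add: r_def)
qed

context
  fixes M :: "complex measure"
  assumes M: "M \<in> probT"
begin

interpretation prob_space M by (rule probT_D[OF M])

lemma borel_measurable_probT: "f \<in> borel_measurable borel \<Longrightarrow> f \<in> borel_measurable M"
  by (simp add: measurable_cong_sets[OF probT_D(2)[OF M] refl])

lemma integrable_probT:
  assumes "cmod z < 1"
  shows "integrable M (\<lambda>x. 1 / (1 - z * x))" "integrable M (\<lambda>x. x / (1 - z * x))"
proof -
  note [measurable_cong] = probT_D(2)[OF M]
  have "AE x in M. cmod (1 / (1 - z * x)) \<le> 1 / (1 - cmod z) \<and> cmod (x / (1 - z * x)) \<le> 1 / (1 - cmod z)"
    using probT_D(4)[OF M]
  proof eventually_elim
    fix x :: complex assume "cmod x = 1"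
    then show "cmod (1 / (1 - z * x)) \<le> 1 / (1 - cmod z) \<and> cmod (x / (1 - z * x)) \<le> 1 / (1 - cmod z)"
      using one_minus_mult_lower[of z x] assms by (auto simp: norm_divide intro!: divide_left_mono mult_pos_pos)
  qed
  then show "integrable M (\<lambda>x. 1 / (1 - z * x))" "integrable M (\<lambda>x. x / (1 - z * x))"
    by (auto intro!: integrable_const_bound[where B="1 / (1 - cmod z)"] elim: eventually_mono)
qed

lemma holomorphic_kernel_probT:
  assumes [measurable]: "W \<in> borel_measurable borel" and W: "AE x in M. cmod (W x) \<le> 1"
  shows "(\<lambda>z. LINT x|M. W x / (1 - z * x)) holomorphic_on ball 0 1"
proof (rule holomorphic_on_integral)
  note [measurable_cong] = probT_D(2)[OF M]
  show "AE x in M. (\<lambda>z. W x / (1 - z * x)) holomorphic_on ball 0 1"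
    using probT_D(4)[OF M]
    by eventually_elim (use one_minus_mult_lower in \<open>auto intro!: holomorphic_intros\<close>)
  show "\<exists>r>0. \<exists>B. ball z r \<subseteq> ball 0 1 \<and> (AE x in M. \<forall>\<zeta>\<in>ball z r. cmod (W x / (1 - \<zeta> * x)) \<le> B)"
    if z: "z \<in> ball 0 1" for z :: complex
  proof (intro exI conjI)
    \<comment> \<open>Half the distance to the circle: points of \<open>ball z r\<close> have
      modulus at most 1 - r, which bounds the denominator below by r.\<close>
    define r where "r = (1 - cmod z) / 2"
    show "0 < r" using z by (simp add: r_def)
    have n: "cmod \<zeta> \<le> 1 - r \<and> cmod \<zeta> < 1" if "\<zeta> \<in> ball z r" for \<zeta>
    proof -
      have "cmod \<zeta> \<le> cmod z + dist z \<zeta>" by (metis dist_norm norm_minus_commute norm_triangle_sub)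
      moreover have "dist z \<zeta> < (1 - cmod z) / 2" using that by (simp add: r_def)
      moreover have "cmod z < 1" using z by simp
      ultimately show ?thesis unfolding r_def by (simp add: field_simps)
    qed
    show "ball z r \<subseteq> ball 0 1" using n by auto
    show "AE x in M. \<forall>\<zeta>\<in>ball z r. cmod (W x / (1 - \<zeta> * x)) \<le> 1 / r"
      using W probT_D(4)[OF M]
    proof eventually_elim
      fix x assume x: "cmod (W x) \<le> 1" "cmod x = 1"
      show "\<forall>\<zeta>\<in>ball z r. cmod (W x / (1 - \<zeta> * x)) \<le> 1 / r"
      proof
        fix \<zeta> assume \<zeta>: "\<zeta> \<in> ball z r"
        have "r \<le> cmod (1 - \<zeta> * x)" using one_minus_mult_lower(1)[of \<zeta> x] n[OF \<zeta>] x by simp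
        then show "cmod (W x / (1 - \<zeta> * x)) \<le> 1 / r"
          unfolding norm_divide using x \<open>0 < r\<close> by (intro frac_le) auto
      qed
    qed
  qed
  show "finite_measure M" by (rule finite_measure_axioms)
  show "(\<lambda>x. W x / (1 - z * x)) \<in> borel_measurable M" for z by measurable
qed simp

lemma gT_holomorphic: "gT M holomorphic_on ball 0 1"
  using holomorphic_kernel_probT[of "\<lambda>_. 1"] by (simp add: gT_def[abs_def])

lemma pT_holomorphic: "pT M holomorphic_on ball 0 1"
  unfolding pT_def[abs_def] by (rule holomorphic_kernel_probT) (use probT_D(4)[OF M] in \<open>auto elim: eventually_mono\<close>)

lemma gT_0: "gT M 0 = 1" by (simp add: gT_def prob_space)

lemma Re_gT: assumes "cmod z < 1" shows "Re (gT M z) \<ge> 1 / (1 + cmod z)"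
proof -
  note [measurable_cong] = probT_D(2)[OF M]
  have "1 / (1 + cmod z) = (LINT x|M. 1 / (1 + cmod z))" by (simp add: prob_space)
  also have "\<dots> \<le> (LINT x|M. Re (1 / (1 - z * x)))"
  proof (rule integral_mono_AE)
    show "AE x in M. 1 / (1 + cmod z) \<le> Re (1 / (1 - z * x))"
      using probT_D(4)[OF M]
    proof eventually_elim
      fix x :: complex assume "cmod x = 1"
      then have "cmod (z * x) = cmod z" by (simp add: norm_mult)
      then show "1 / (1 + cmod z) \<le> Re (1 / (1 - z * x))" using Re_inverse_one_minus[of "z * x"] assms by simp
    qed
  qed (use integrable_Re[OF integrable_probT(1)[OF assms]] in auto)
  also have "\<dots> = Re (gT M z)" unfolding gT_def by (rule integral_Re[OF integrable_probT(1)[OF assms]])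
  finally show ?thesis .
qed

lemma gT_gt_half: assumes "cmod z < 1" shows "Re (gT M z) > 1/2" "gT M z \<noteq> 0"
proof -
  have "1/2 < 1 / (1 + cmod z)" using assms by (intro divide_strict_left_mono) (auto intro: add_pos_nonneg)
  then show "Re (gT M z) > 1/2" using Re_gT[OF assms] by linarith
  then show "gT M z \<noteq> 0" by auto
qed

lemma gT_eq_pT: assumes "cmod z < 1" shows "gT M z = 1 + z * pT M z"
proof -
  note [measurable_cong] = probT_D(2)[OF M]
  have "gT M z = (LINT x|M. 1 + z * (x / (1 - z * x)))"
    unfolding gT_def
  proof (rule integral_cong_AE)
    show "AE x in M. 1 / (1 - z * x) = 1 + z * (x / (1 - z * x))"
      using probT_D(4)[OF M]
    proof eventually_elim
      fix x :: complex assume "cmod x = 1"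
      then have "1 - z * x \<noteq> 0" using one_minus_mult_lower(2)[of z x] assms by simp
      then show "1 / (1 - z * x) = 1 + z * (x / (1 - z * x))" by (simp add: field_simps)
    qed
  qed auto
  also have "\<dots> = 1 + z * pT M z"
    by (subst Bochner_Integration.integral_add[OF _ integrable_mult_right[OF integrable_probT(2)[OF assms]]])
       (simp_all only: integral_mult_right_zero pT_def integrable_const, simp add: prob_space)
  finally show ?thesis .
qed

lemma etaT_gT: assumes "cmod z < 1" shows "etaT M z = 1 - 1 / gT M z"
proof (cases "z = 0")
  case True then show ?thesis by (simp add: etaT_def gT_0)
next
  case False
  have "GT M (1 / z) = (LINT x|M. z * (1 / (1 - z * x)))"
    unfolding GT_def using False by (intro Bochner_Integration.integral_cong) (auto simp: field_simps)
  then have "GT M (1 / z) = z * gT M z" by (simp only: integral_mult_right_zero gT_def)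
  then show ?thesis using False by (simp add: etaT_def)
qed

lemma hT_eq: assumes "cmod z < 1" shows "hT M z = pT M z / gT M z"
proof (cases "z = 0")
  case True then show ?thesis by (simp add: hT_def gT_0) (simp add: pT_def)
next
  case False
  have "etaT M z = (gT M z - 1) / gT M z" using etaT_gT gT_gt_half[OF assms] assms by (simp add: diff_divide_distrib)
  then show ?thesis using False gT_eq_pT[OF assms] by (simp add: hT_def)
qed

lemma hT_holomorphic: "hT M holomorphic_on ball 0 1"
proof -
  have "(\<lambda>z. pT M z / gT M z) holomorphic_on ball 0 1"
    by (intro holomorphic_intros pT_holomorphic gT_holomorphic) (use gT_gt_half in auto)
  then show ?thesis by (rule holomorphic_transform) (simp add: hT_eq)
qed

lemma etaT_hT: assumes "cmod z < 1" shows "etaT M z = z * hT M z"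
  by (simp add: hT_def etaT_def)

lemma etaT_holomorphic: "etaT M holomorphic_on ball 0 1"
proof -
  have "(\<lambda>z. z * hT M z) holomorphic_on ball 0 1" by (intro holomorphic_intros hT_holomorphic)
  then show ?thesis by (rule holomorphic_transform) (simp add: etaT_hT)
qed

text \<open>\<open>etaT\<close> is (g - 1)/g, and |g - 1| < |g| says exactly that Re g >
  1/2.\<close>

lemma norm_etaT_less_1: assumes "cmod z < 1" shows "cmod (etaT M z) < 1"
proof -
  define g where "g = gT M z"
  have g: "Re g > 1/2" "g \<noteq> 0" using gT_gt_half[OF assms] by (auto simp: g_def)
  have "(cmod (g - 1))\<^sup>2 < (cmod g)\<^sup>2" unfolding cmod_power2 using g(1) by (simp add: power2_eq_square algebra_simps)
  then have "cmod (g - 1) < cmod g" by (simp add: power2_less_imp_less)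
  moreover have "etaT M z = (g - 1) / g" using etaT_gT[OF assms] g by (simp add: g_def diff_divide_distrib)
  ultimately show ?thesis using g by (simp add: norm_divide)
qed

text \<open>Schwarz's lemma away from 0; at 0 the value is the first moment of a measure on the
  circle.\<close>

lemma norm_hT_le_1: assumes "cmod z < 1" shows "cmod (hT M z) \<le> 1"
proof (cases "z = 0")
  note [measurable_cong] = probT_D(2)[OF M]
  case True
  have "integrable M (\<lambda>x. x)" using integrable_probT(2)[of 0] by simp
  then have "cmod (LINT x|M. x) \<le> (LINT x|M. cmod x)" by (intro integral_norm_bound)
  also have "\<dots> = (LINT x|M. 1)" by (intro integral_cong_AE) (use probT_D(4)[OF M] in auto)
  finally show ?thesis using True by (simp add: hT_def prob_space)
next
  case False
  have "cmod (etaT M z) \<le> cmod z"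
    by (rule Schwarz_Lemma(1)[OF etaT_holomorphic]) (use norm_etaT_less_1 assms in \<open>auto simp: etaT_def\<close>)
  then show ?thesis using False by (simp add: hT_def norm_divide)
qed

end

lemma etaT_0: "etaT M 0 = 0" by (simp add: etaT_def)

text \<open>\<open>etaT\<close> determines the moment generating function, whose values at the
  points 1 / (n + 2) determine the moments.\<close>

lemma probT_eqI_eta:
  assumes M: "M \<in> probT" and N: "N \<in> probT" and eq: "\<And>z. cmod z < 1 \<Longrightarrow> etaT M z = etaT N z"
  shows "M = N"
proof (rule probT_eqI_moments[OF M N])
  fix k
  define s where "s n = complex_of_real (1 / (real n + 2))" for n
  have sl: "s \<longlonglongrightarrow> of_real 0" unfolding s_def by (intro tendsto_of_real) real_asymp
  have ns: "cmod (s n) = 1 / (real n + 2)" for n unfolding s_def norm_of_real by simp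
  have sh: "cmod (s n) \<le> 1/2" for n unfolding ns by (simp add: field_simps)
  have s0: "s n \<noteq> 0" for n unfolding s_def of_real_eq_0_iff by simp
  have g: "gT M z = gT N z" if "cmod z < 1" for z
    using eq[OF that] etaT_gT[OF M that] etaT_gT[OF N that] gT_gt_half[OF M that] gT_gt_half[OF N that] by simp
  have "(LINT x|M. 1 * x ^ k) = (LINT x|N. 1 * x ^ k)"
  proof (rule moments_eq[where s=s])
    show "(LINT x|M. 1 / (1 - s n * x)) = (LINT x|N. 1 / (1 - s n * x))" for n
      using g[of "s n"] sh[of n] by (simp add: gT_def)
  qed (use sl sh s0 probT_D[OF M] probT_D[OF N] borel_measurable_probT[OF M] borel_measurable_probT[OF N] in \<open>auto elim: eventually_mono\<close>)
  then show "(LINT x|M. x ^ k) = (LINT x|N. x ^ k)" by simp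
qed

text \<open>The map 1 / (1 - w) carries the disc into the half-plane Re > 1/2, so Herglotz's theorem
  applies to 1 / (1 - \<eta>).\<close>

lemma probT_exists:
  assumes hol: "\<eta> holomorphic_on ball 0 1" and "\<eta> 0 = 0" and lt: "\<And>z. cmod z < 1 \<Longrightarrow> cmod (\<eta> z) < 1"
  shows "\<exists>M\<in>probT. \<forall>z. cmod z < 1 \<longrightarrow> etaT M z = \<eta> z"
proof -
  have nz: "1 - \<eta> z \<noteq> 0" if "cmod z < 1" for z using lt[OF that] by auto
  have "\<exists>M\<in>probT. \<forall>z. norm z < 1 \<longrightarrow> (LINT x|M. 1 / (1 - z * x)) = 1 / (1 - \<eta> z)"
  proof (rule herglotz)
    show "1/2 \<le> Re (1 / (1 - \<eta> z))" if "cmod z < 1" for z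
    proof -
      have "1/2 \<le> 1 / (1 + cmod (\<eta> z))" using lt[OF that] by (intro divide_left_mono) (auto intro: add_pos_nonneg)
      then show ?thesis using Re_inverse_one_minus[OF lt[OF that]] by linarith
    qed
  qed (use assms nz in \<open>auto intro!: holomorphic_intros\<close>)
  then obtain M where M: "M \<in> probT" "\<And>z. norm z < 1 \<Longrightarrow> gT M z = 1 / (1 - \<eta> z)" by (auto simp: gT_def)
  then show ?thesis using etaT_gT[OF M(1)] by (intro bexI[of _ M]) auto
qed

section \<open>Subordination on the circle\<close>

text \<open>In the coordinate that moves p to 0, the values of \<phi> stay in a compact part of the
  disc, so the map can be divided by some s < 1 and still sends the disc into itself; Schwarz's
  lemma then yields the factor s.\<close>

lemma Moebius_contraction:
  assumes hol: "\<phi> holomorphic_on ball 0 1" and r: "r < 1"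
    and le: "\<And>w. cmod w < 1 \<Longrightarrow> cmod (\<phi> w) \<le> r" and p: "cmod p < 1" "\<phi> p = p"
  shows "\<exists>s<1. 0 < s \<and> (\<forall>w. cmod w < 1 \<longrightarrow>
    cmod (Moebius_function 0 p (\<phi> w)) \<le> s * cmod (Moebius_function 0 p w))"
proof -
  let ?m = "Moebius_function 0 p" and ?n = "Moebius_function 0 (-p)"
  have r0: "0 \<le> r" using order_trans[OF norm_ge_zero le[of 0]] by simp
  have hm: "?m holomorphic_on ball 0 1" "?n holomorphic_on ball 0 1"
    using Moebius_function_holomorphic p by auto
  have m1: "cmod (?m w) < 1" "cmod (?n w) < 1" if "cmod w < 1" for w
    using Moebius_function_norm_lt_1 that p by auto
  have "continuous_on (cball 0 r) (\<lambda>w. cmod (?m w))"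
    by (intro continuous_intros holomorphic_on_imp_continuous_on holomorphic_on_subset[OF hm(1)]) (use r in auto)
  then obtain q where q: "q \<in> cball 0 r" "\<And>w. w \<in> cball 0 r \<Longrightarrow> cmod (?m w) \<le> cmod (?m q)"
    using continuous_attains_sup[of "cball 0 r" "\<lambda>w. cmod (?m w)"] r0 by auto
  \<comment> \<open>The midpoint between the attained maximum and 1: positive even if the maximum is
    0, and strictly above it, so that the divided map has values of modulus below 1.\<close>
  define s where "s = (1 + cmod (?m q)) / 2"
  have "cmod (?m q) < 1" using m1(1)[of q] q(1) r by auto
  then have s: "cmod (?m q) < s" "s < 1" "0 < s" by (auto simp: s_def intro: add_pos_nonneg)
  define \<psi> where "\<psi> u = ?m (\<phi> (?n u)) / s" for u
  have \<phi>1: "cmod (\<phi> w) < 1" if "cmod w < 1" for w using le[OF that] r by simp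
  have "\<psi> holomorphic_on ball 0 1"
  proof -
    have "(\<phi> \<circ> ?n) holomorphic_on ball 0 1"
      by (rule holomorphic_on_compose_gen[OF hm(2) hol]) (use m1 in auto)
    then have "(?m \<circ> (\<phi> \<circ> ?n)) holomorphic_on ball 0 1"
      by (rule holomorphic_on_compose_gen[OF _ hm(1)]) (use m1 \<phi>1 in auto)
    then show ?thesis unfolding \<psi>_def[abs_def] by (intro holomorphic_intros) (use s in \<open>auto simp: o_def\<close>)
  qed
  moreover have "\<psi> 0 = 0" by (simp add: \<psi>_def Moebius_function_of_zero p Moebius_function_eq_zero)
  moreover have "cmod (\<psi> u) < 1" if "cmod u < 1" for u
  proof -
    have "cmod (?m (\<phi> (?n u))) \<le> cmod (?m q)" using q(2) le[OF m1(2)[OF that]] by simp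
    then show ?thesis using s by (simp add: \<psi>_def norm_divide)
  qed
  ultimately have S: "cmod (\<psi> u) \<le> cmod u" if "cmod u < 1" for u
    using Schwarz_Lemma(1) that by blast
  have "cmod (?m (\<phi> w)) \<le> s * cmod (?m w)" if "cmod w < 1" for w
  proof -
    have "?n (?m w) = w" using p that by (intro Moebius_function_compose) auto
    then have "cmod (?m (\<phi> w) / s) \<le> cmod (?m w)" using S[OF m1(1)[OF that]] by (simp add: \<psi>_def)
    then show ?thesis using s by (simp add: norm_divide field_simps)
  qed
  then show ?thesis using s by blast
qed

lemma Moebius_dist: 
  assumes "cmod p < 1" "cmod w < 1"
  shows "cmod (w - p) \<le> 2 * cmod (Moebius_function 0 p w)"
proof -
  have *: "1 - w * cnj p \<noteq> 0" using one_minus_mult_lower(2)[of w "cnj p"] assms by simp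
  have "cmod (w * cnj p) \<le> 1 * 1" unfolding norm_mult using assms by (intro mult_mono) auto
  then have "cmod (1 - w * cnj p) \<le> 2" using norm_triangle_ineq4[of 1 "w * cnj p"] by simp
  then have "cmod (Moebius_function 0 p w) * cmod (1 - w * cnj p) \<le> cmod (Moebius_function 0 p w) * 2"
    by (intro mult_left_mono) auto
  moreover have "cmod (Moebius_function 0 p w) * cmod (1 - w * cnj p) = cmod (w - p)"
    using * by (simp add: Moebius_function_simple norm_divide mult.commute)
  ultimately show ?thesis by simp
qed

lemma disc_fixpoint_unique:
  assumes "\<phi> holomorphic_on ball 0 1" "r < 1" "\<And>w. cmod w < 1 \<Longrightarrow> cmod (\<phi> w) \<le> r"
    and p: "cmod p < 1" "\<phi> p = p" and q: "cmod q < 1" "\<phi> q = q"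
  shows "p = q"
proof -
  obtain s where s: "s < 1" "cmod (Moebius_function 0 p (\<phi> q)) \<le> s * cmod (Moebius_function 0 p q)"
    using Moebius_contraction[OF assms(1-3) p] q(1) by blast
  then have "(1 - s) * cmod (Moebius_function 0 p q) \<le> 0" using q by (simp add: algebra_simps)
  then have "cmod (Moebius_function 0 p q) \<le> 0" using s(1) by (simp add: mult_le_0_iff)
  then show ?thesis using Moebius_dist[OF p(1) q(1)] by simp
qed

text \<open>The contraction rate depends on the fixed point, so existence comes first, from
  Brouwer's theorem on the smaller closed disc; the iterates then approach the fixed point
  geometrically in its Moebius coordinate.\<close>

lemma disc_fixpoint_iterates:
  assumes hol: "\<phi> holomorphic_on ball 0 1" and r: "0 \<le> r" "r < 1" and le: "\<And>w. cmod w < 1 \<Longrightarrow> cmod (\<phi> w) \<le> r"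
  shows "\<exists>p. cmod p < 1 \<and> \<phi> p = p \<and> (\<lambda>n. (\<phi> ^^ n) 0) \<longlonglongrightarrow> p"
proof -
  have "continuous_on (cball 0 r) \<phi>"
    by (intro holomorphic_on_imp_continuous_on holomorphic_on_subset[OF hol]) (use r in auto)
  moreover have "\<phi> \<in> cball 0 r \<rightarrow> cball 0 r" using le r by auto
  ultimately obtain p where p: "p \<in> cball 0 r" "\<phi> p = p"
    using brouwer[of "cball 0 r" \<phi>] r by auto
  have p1: "cmod p < 1" using p r by simp
  obtain s where s: "s < 1" "0 < s"
    "\<And>w. cmod w < 1 \<Longrightarrow> cmod (Moebius_function 0 p (\<phi> w)) \<le> s * cmod (Moebius_function 0 p w)"
    using Moebius_contraction[OF hol r(2) le p1 p(2)] by blast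
  define w where "w n = (\<phi> ^^ n) 0" for n
  have w1: "cmod (w n) < 1" for n
  proof (induction n)
    case (Suc n) then show ?case using le[OF Suc] r by (simp add: w_def)
  qed (simp add: w_def)
  have b: "cmod (Moebius_function 0 p (w n)) \<le> s ^ n" for n
  proof (induction n)
    case 0 show ?case using p1 by (simp add: w_def Moebius_function_of_zero)
  next
    case (Suc n)
    have "cmod (Moebius_function 0 p (w (Suc n))) \<le> s * cmod (Moebius_function 0 p (w n))"
      using s(3)[OF w1[of n]] by (simp add: w_def)
    also have "\<dots> \<le> s * s ^ n" using Suc s(2) by (intro mult_left_mono) auto
    finally show ?case by simp
  qed
  have "(\<lambda>n. 2 * s ^ n) \<longlonglongrightarrow> 2 * 0" using s by (intro tendsto_intros LIMSEQ_realpow_zero) auto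
  then have "(\<lambda>n. w n - p) \<longlonglongrightarrow> 0"
  proof (rule Lim_null_comparison[rotated, OF tendsto_eq_rhs])
    show "\<forall>\<^sub>F n in sequentially. cmod (w n - p) \<le> 2 * s ^ n"
      using Moebius_dist[OF p1 w1] b by (intro always_eventually) (smt (verit))
  qed simp
  then have "w \<longlonglongrightarrow> p" by (simp add: LIM_zero_iff)
  then show ?thesis using p p1 unfolding w_def by blast
qed

lemma subordination_map:
  assumes S: "\<sigma> \<in> probT" and M: "\<mu> \<in> probT" and z: "cmod z < 1"
  shows "(\<lambda>w. z * hT \<mu> (z * hT \<sigma> w)) holomorphic_on ball 0 1"
    and "\<And>w. cmod w < 1 \<Longrightarrow> cmod (z * hT \<sigma> w) < 1"
    and "\<And>w. cmod w < 1 \<Longrightarrow> cmod (z * hT \<mu> (z * hT \<sigma> w)) \<le> cmod z"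
proof -
  have le: "cmod (z * hT \<nu> w) \<le> cmod z" if "\<nu> \<in> probT" "cmod w < 1" for \<nu> w
    using norm_hT_le_1[OF that] by (simp add: norm_mult mult_left_le)
  show 1: "cmod (z * hT \<sigma> w) < 1" if "cmod w < 1" for w using le[OF S that] z by linarith
  show "cmod (z * hT \<mu> (z * hT \<sigma> w)) \<le> cmod z" if "cmod w < 1" for w using le[OF M 1[OF that]] .
  have "(hT \<mu> \<circ> (\<lambda>w. z * hT \<sigma> w)) holomorphic_on ball 0 1"
    by (rule holomorphic_on_compose_gen[OF _ hT_holomorphic[OF M]])
       (use 1 in \<open>auto intro!: holomorphic_intros hT_holomorphic[OF S]\<close>)
  then show "(\<lambda>w. z * hT \<mu> (z * hT \<sigma> w)) holomorphic_on ball 0 1"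
    by (intro holomorphic_intros) (simp add: o_def)
qed

text \<open>Both first coordinates are fixed points of the same contraction. The equations concern
  values at one z, not functions, so that candidate values can be recognised point by point.\<close>

lemma subordination_unique:
  assumes S: "\<sigma> \<in> probT" and M: "\<mu> \<in> probT" and z: "cmod z < 1"
    and a: "cmod a1 < 1" "a1 = z * hT \<mu> a2" "a2 = z * hT \<sigma> a1"
    and b: "cmod b1 < 1" "b1 = z * hT \<mu> b2" "b2 = z * hT \<sigma> b1"
  shows "a1 = b1" "a2 = b2"
proof -
  show "a1 = b1"
    by (rule disc_fixpoint_unique[OF subordination_map(1)[OF S M z] z subordination_map(3)[OF S M z]])
       (use a(1) b(1) a(2)[symmetric] b(2)[symmetric] in \<open>simp_all only: a(3)[symmetric] b(3)[symmetric]\<close>)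
  then show "a2 = b2" by (simp only: a(3) b(3))
qed

lemma holomorphic_mult_hT:
  assumes N: "\<nu> \<in> probT" and f: "f holomorphic_on ball 0 1" "\<And>z. cmod z < 1 \<Longrightarrow> cmod (f z) < 1"
  shows "(\<lambda>z. z * hT \<nu> (f z)) holomorphic_on ball 0 1" "\<And>z. cmod z < 1 \<Longrightarrow> cmod (z * hT \<nu> (f z)) < 1"
proof -
  have "(hT \<nu> \<circ> f) holomorphic_on ball 0 1"
    by (rule holomorphic_on_compose_gen[OF f(1) hT_holomorphic[OF N]]) (use f in auto)
  then show "(\<lambda>z. z * hT \<nu> (f z)) holomorphic_on ball 0 1"
    by (intro holomorphic_intros) (simp add: o_def)
  show "cmod (z * hT \<nu> (f z)) < 1" if "cmod z < 1" for z
  proof -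
    have "cmod (z * hT \<nu> (f z)) \<le> cmod z" using norm_hT_le_1[OF N f(2)[OF that]] by (simp add: norm_mult mult_left_le)
    then show ?thesis using that by simp
  qed
qed

lemma subordT_exists:
  assumes S: "\<sigma> \<in> probT" and M: "\<mu> \<in> probT"
  shows "\<exists>\<omega>1 \<omega>2. subordT \<sigma> \<mu> \<omega>1 \<omega>2"
proof -
  define \<phi> where "\<phi> z w = z * hT \<mu> (z * hT \<sigma> w)" for z w
  define W where "W n z = (\<phi> z ^^ n) 0" for n z
  have "\<exists>p. cmod p < 1 \<and> \<phi> z p = p \<and> (\<lambda>n. W n z) \<longlonglongrightarrow> p" if "cmod z < 1" for z
    unfolding \<phi>_def W_def
    by (rule disc_fixpoint_iterates[OF subordination_map(1)[OF S M that] _ that subordination_map(3)[OF S M that]]) auto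
  then obtain p where p: "\<And>z. cmod z < 1 \<Longrightarrow> cmod (p z) < 1" "\<And>z. cmod z < 1 \<Longrightarrow> \<phi> z (p z) = p z"
      "\<And>z. cmod z < 1 \<Longrightarrow> (\<lambda>n. W n z) \<longlonglongrightarrow> p z" by metis
  have W: "W n holomorphic_on ball 0 1 \<and> (\<forall>z. cmod z < 1 \<longrightarrow> cmod (W n z) < 1)" for n
  proof (induction n)
    case 0 then show ?case by (simp add: W_def[abs_def])
  next
    case (Suc n)
    have "W (Suc n) = (\<lambda>z. z * hT \<mu> (z * hT \<sigma> (W n z)))" by (simp add: W_def[abs_def] \<phi>_def)
    then show ?case using holomorphic_mult_hT[OF M, of "\<lambda>z. z * hT \<sigma> (W n z)"] holomorphic_mult_hT[OF S, of "W n"] Suc by simp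
  qed
  obtain g k where g: "g holomorphic_on ball 0 1" "strict_mono (k :: nat \<Rightarrow> nat)"
      "\<And>z. z \<in> ball 0 1 \<Longrightarrow> (\<lambda>n. W (k n) z) \<longlonglongrightarrow> g z"
    by (rule Montel[of "ball 0 1" "range W" W]) (use W in \<open>auto intro!: exI[of _ 1] less_imp_le dest!: subsetD\<close>)
  have "g z = p z" if "cmod z < 1" for z
    using LIMSEQ_unique[OF g(3)] LIMSEQ_subseq_LIMSEQ[OF p(3)[OF that] g(2)] that by (simp add: o_def)
  then have hp: "p holomorphic_on ball 0 1" using holomorphic_transform[OF g(1), of p] by simp
  note h2 = holomorphic_mult_hT[OF S hp p(1)]
  have "subordT \<sigma> \<mu> p (\<lambda>z. z * hT \<sigma> (p z))"
    unfolding subordT_def using hp h2 p(1,2) p(2)[of 0] by (auto simp: \<phi>_def)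
  then show ?thesis by blast
qed

lemma subordT_D:
  assumes "subordT \<sigma> \<mu> \<omega>1 \<omega>2" "cmod z < 1"
  shows "\<omega>1 z = z * hT \<mu> (\<omega>2 z)" "\<omega>2 z = z * hT \<sigma> (\<omega>1 z)" "cmod (\<omega>1 z) < 1" "cmod (\<omega>2 z) < 1"
  using assms(2) assms(1)[unfolded subordT_def] by (metis image_subset_iff mem_ball_0)+

lemma subordT_holomorphic:
  assumes "subordT \<sigma> \<mu> \<omega>1 \<omega>2"
  shows "\<omega>1 holomorphic_on ball 0 1" "\<omega>2 holomorphic_on ball 0 1" "\<omega>1 0 = 0" "\<omega>2 0 = 0"
  using assms unfolding subordT_def by blast+

text \<open>Lets \<open>etaT\<close> of a measure take the place of \<omega>1, with which it is
  known to agree only on the disc.\<close>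

lemma subordT_cong:
  assumes "subordT \<sigma> \<mu> \<omega>1 \<omega>2" "\<And>z. cmod z < 1 \<Longrightarrow> f z = \<omega>1 z"
  shows "subordT \<sigma> \<mu> f \<omega>2"
proof -
  have "f holomorphic_on ball 0 1"
    by (rule holomorphic_transform[OF subordT_holomorphic(1)[OF assms(1)]]) (simp add: assms(2))
  moreover have "f ` ball 0 1 \<subseteq> ball 0 1" using assms(2) subordT_D(3)[OF assms(1)] by auto
  moreover have "f z = z * hT \<mu> (\<omega>2 z)" "\<omega>2 z = z * hT \<sigma> (f z)" if "z \<in> ball 0 1" for z
    using that subordT_D(1,2)[OF assms(1), of z] assms(2)[of z] by (simp_all only: mem_ball_0)
  moreover have "f 0 = 0" using assms(2)[of 0] subordT_holomorphic(3)[OF assms(1)] by simp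
  ultimately show ?thesis
    using assms(1) unfolding subordT_def by blast
qed

lemma subordT_unique:
  assumes S: "\<sigma> \<in> probT" and M: "\<mu> \<in> probT" and a: "subordT \<sigma> \<mu> a1 a2" and b: "subordT \<sigma> \<mu> b1 b2"
    and z: "cmod z < 1"
  shows "a1 z = b1 z" "a2 z = b2 z"
  by (rule subordination_unique[OF S M z subordT_D(3,1,2)[OF a z] subordT_D(3,1,2)[OF b z]])+

text \<open>Any two choices of subordination functions agree on the disc, so the definite
  description has at most one solution; \<open>probT_exists\<close> provides one.\<close>

lemma mfcT_char:
  assumes S: "\<sigma> \<in> probT" and M: "\<mu> \<in> probT"
  shows "mfcT \<sigma> \<mu> \<in> probT \<and> (\<exists>\<omega>1 \<omega>2. subordT \<sigma> \<mu> \<omega>1 \<omega>2 \<and>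
    (\<forall>z\<in>ball 0 1. etaT (mfcT \<sigma> \<mu>) z = etaT \<sigma> (\<omega>1 z)))"
proof -
  obtain \<omega>1 \<omega>2 where w: "subordT \<sigma> \<mu> \<omega>1 \<omega>2" using subordT_exists[OF S M] by blast
  note h = subordT_holomorphic(1,3)[OF w]
  have "\<exists>R\<in>probT. \<forall>z. cmod z < 1 \<longrightarrow> etaT R z = (etaT \<sigma> \<circ> \<omega>1) z"
  proof (rule probT_exists)
    show "(etaT \<sigma> \<circ> \<omega>1) holomorphic_on ball 0 1"
      by (rule holomorphic_on_compose_gen[OF h(1) etaT_holomorphic[OF S]]) (use subordT_D(3)[OF w] in auto)
  qed (use h norm_etaT_less_1[OF S] subordT_D(3)[OF w] in \<open>auto simp: etaT_0\<close>)
  then obtain R where R: "R \<in> probT" "\<And>z. cmod z < 1 \<Longrightarrow> etaT R z = etaT \<sigma> (\<omega>1 z)" by auto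
  show ?thesis
    unfolding mfcT_def
  proof (rule theI[where a=R])
    show "R \<in> probT \<and> (\<exists>\<omega>1 \<omega>2. subordT \<sigma> \<mu> \<omega>1 \<omega>2 \<and> (\<forall>z\<in>ball 0 1. etaT R z = etaT \<sigma> (\<omega>1 z)))"
      using R w by auto
    fix R' assume "R' \<in> probT \<and> (\<exists>\<omega>1 \<omega>2. subordT \<sigma> \<mu> \<omega>1 \<omega>2 \<and> (\<forall>z\<in>ball 0 1. etaT R' z = etaT \<sigma> (\<omega>1 z)))"
    then obtain v1 v2 where v: "R' \<in> probT" "subordT \<sigma> \<mu> v1 v2" "\<And>z. cmod z < 1 \<Longrightarrow> etaT R' z = etaT \<sigma> (v1 z)" by auto
    show "R' = R"
      by (rule probT_eqI_eta[OF v(1) R(1)]) (use R(2) v(3) subordT_unique(1)[OF S M v(2) w] in simp)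
  qed
qed

lemma mconvT_char:
  assumes S: "\<sigma> \<in> probT" and M: "\<mu> \<in> probT"
  shows "mconvT \<sigma> \<mu> \<in> probT \<and> (\<forall>z\<in>ball 0 1. etaT (mconvT \<sigma> \<mu>) z = etaT \<sigma> (etaT \<mu> z))"
proof -
  have "\<exists>R\<in>probT. \<forall>z. cmod z < 1 \<longrightarrow> etaT R z = (etaT \<sigma> \<circ> etaT \<mu>) z"
  proof (rule probT_exists)
    show "(etaT \<sigma> \<circ> etaT \<mu>) holomorphic_on ball 0 1"
      by (rule holomorphic_on_compose_gen[OF etaT_holomorphic[OF M] etaT_holomorphic[OF S]])
        (use norm_etaT_less_1[OF M] in auto)
  qed (use norm_etaT_less_1[OF S] norm_etaT_less_1[OF M] in \<open>auto simp: etaT_0\<close>)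
  then obtain R where R: "R \<in> probT" "\<And>z. cmod z < 1 \<Longrightarrow> etaT R z = etaT \<sigma> (etaT \<mu> z)" by auto
  show ?thesis
    unfolding mconvT_def by (rule theI[where a=R]) (use R in \<open>auto intro!: probT_eqI_eta\<close>)
qed

lemma BT_I:
  assumes S: "\<sigma> \<in> probT" and M: "\<mu> \<in> probT" and b: "\<beta> \<in> probT" "subordT \<sigma> \<mu> (etaT \<beta>) \<omega>2"
  shows "BT \<sigma> \<mu> = \<beta>"
  unfolding BT_def
  by (rule the_equality) (use b subordT_unique(1)[OF S M] in \<open>auto intro!: probT_eqI_eta\<close>)

lemma BT_char:
  assumes S: "\<sigma> \<in> probT" and M: "\<mu> \<in> probT"
  shows "BT \<sigma> \<mu> \<in> probT" "\<exists>\<omega>2. subordT \<sigma> \<mu> (etaT (BT \<sigma> \<mu>)) \<omega>2"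
proof -
  obtain \<omega>1 \<omega>2 where w: "subordT \<sigma> \<mu> \<omega>1 \<omega>2" using subordT_exists[OF S M] by blast
  obtain R where R: "R \<in> probT" "\<And>z. cmod z < 1 \<Longrightarrow> etaT R z = \<omega>1 z"
    using probT_exists[of \<omega>1] subordT_D(3)[OF w] subordT_holomorphic(1,3)[OF w] by metis
  have s: "subordT \<sigma> \<mu> (etaT R) \<omega>2" by (rule subordT_cong[OF w R(2)])
  then show "BT \<sigma> \<mu> \<in> probT" "\<exists>\<omega>2. subordT \<sigma> \<mu> (etaT (BT \<sigma> \<mu>)) \<omega>2"
    using BT_I[OF S M R(1) s] R(1) s by auto
qed

text \<open>Away from 0 this is division by z; at 0, where the equation for \<open>etaT\<close> says
  nothing, both sides are continuous.\<close>

lemma hT_eqI: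
  assumes M: "M \<in> probT" and f: "f holomorphic_on ball 0 1" and eq: "\<And>z. cmod z < 1 \<Longrightarrow> etaT M z = z * f z" and z: "cmod z < 1"
  shows "hT M z = f z"
proof (cases "z = 0")
  case False then show ?thesis using eq[OF z] by (simp add: hT_def)
next
  case True
  define s where "s n = complex_of_real (1 / (real n + 2))" for n
  have sl: "s \<longlonglongrightarrow> of_real 0" unfolding s_def by (intro tendsto_of_real) real_asymp
  have ns: "cmod (s n) = 1 / (real n + 2)" for n unfolding s_def norm_of_real by simp
  have sh: "cmod (s n) < 1" for n unfolding ns by (simp add: field_simps)
  have s0: "s n \<noteq> 0" for n unfolding s_def of_real_eq_0_iff by simp
  have *: "hT M (s n) = f (s n)" for n using eq[OF sh, of n] s0[of n] by (simp add: hT_def)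
  have "(\<lambda>n. u (s n)) \<longlonglongrightarrow> u 0" if "u holomorphic_on ball 0 1" for u
  proof -
    have "isCont u 0" using holomorphic_on_imp_continuous_on[OF that] by (simp add: continuous_on_eq_continuous_at)
    then show ?thesis using isCont_tendsto_compose[OF _ sl[simplified]] by blast
  qed
  from this[OF f] this[OF hT_holomorphic[OF M]] show ?thesis using LIMSEQ_unique True by (simp add: *)
qed

text \<open>Since \<omega>1 is z times h of \<mu> at \<omega>2, multiplying by h of \<sigma> at
  \<omega>1 gives z times the product of the two h. That product is symmetric in the two measures,
  whence the third equation.\<close>

lemma hT_mfcT:
  assumes S: "\<sigma> \<in> probT" and M: "\<mu> \<in> probT" and w: "subordT \<sigma> \<mu> \<omega>1 \<omega>2" and z: "cmod z < 1"
  shows "hT (mfcT \<sigma> \<mu>) z = hT \<sigma> (\<omega>1 z) * hT \<mu> (\<omega>2 z)" "etaT (mfcT \<sigma> \<mu>) z = etaT \<sigma> (\<omega>1 z)"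
    "etaT (mfcT \<sigma> \<mu>) z = etaT \<mu> (\<omega>2 z)"
proof -
  obtain v1 v2 where v: "subordT \<sigma> \<mu> v1 v2" "\<And>z. cmod z < 1 \<Longrightarrow> etaT (mfcT \<sigma> \<mu>) z = etaT \<sigma> (v1 z)"
    using mfcT_char[OF S M] by auto
  have e: "etaT (mfcT \<sigma> \<mu>) z = etaT \<sigma> (\<omega>1 z)" if "cmod z < 1" for z
    using v(2)[OF that] subordT_unique(1)[OF S M v(1) w that] by simp
  show "etaT (mfcT \<sigma> \<mu>) z = etaT \<sigma> (\<omega>1 z)" by (rule e[OF z])
  show "etaT (mfcT \<sigma> \<mu>) z = etaT \<mu> (\<omega>2 z)"
    unfolding e[OF z] etaT_hT[OF S subordT_D(3)[OF w z]] etaT_hT[OF M subordT_D(4)[OF w z]]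
    using subordT_D(1,2)[OF w z] by (metis mult.assoc mult.commute)
  have hol: "(hT \<sigma> \<circ> \<omega>1) holomorphic_on ball 0 1" "(hT \<mu> \<circ> \<omega>2) holomorphic_on ball 0 1"
    using subordT_D(3,4)[OF w]
    by (intro holomorphic_on_compose_gen[OF _ hT_holomorphic[OF S]] holomorphic_on_compose_gen[OF _ hT_holomorphic[OF M]]
        subordT_holomorphic[OF w]; auto)+
  show "hT (mfcT \<sigma> \<mu>) z = hT \<sigma> (\<omega>1 z) * hT \<mu> (\<omega>2 z)"
  proof (rule hT_eqI[OF _ _ _ z])
    show "mfcT \<sigma> \<mu> \<in> probT" using mfcT_char[OF S M] by blast
    show "(\<lambda>z. hT \<sigma> (\<omega>1 z) * hT \<mu> (\<omega>2 z)) holomorphic_on ball 0 1"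
      using hol by (intro holomorphic_intros) (simp_all add: o_def)
    show "etaT (mfcT \<sigma> \<mu>) z = z * (hT \<sigma> (\<omega>1 z) * hT \<mu> (\<omega>2 z))" if "cmod z < 1" for z
      using e[OF that] subordT_D(1)[OF w that] etaT_hT[OF S subordT_D(3)[OF w that]] by (simp add: mult_ac)
  qed
qed

lemma hT_BT:
  assumes S: "\<sigma> \<in> probT" and M: "\<mu> \<in> probT" and w: "subordT \<sigma> \<mu> (etaT (BT \<sigma> \<mu>)) \<omega>2" and z: "cmod z < 1"
  shows "hT (BT \<sigma> \<mu>) z = hT \<mu> (\<omega>2 z)"
proof (rule hT_eqI[OF BT_char(1)[OF S M] _ _ z])
  have "(hT \<mu> \<circ> \<omega>2) holomorphic_on ball 0 1"
    by (rule holomorphic_on_compose_gen[OF subordT_holomorphic(2)[OF w] hT_holomorphic[OF M]])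
       (use subordT_D(4)[OF w] in auto)
  then show "(\<lambda>z. hT \<mu> (\<omega>2 z)) holomorphic_on ball 0 1" by (simp add: o_def)
qed (rule subordT_D(1)[OF w])

text \<open>Eliminating \<omega>2 leaves one scalar equation for each z; holomorphy and the bound by
  1 are already known for \<open>etaT\<close>.\<close>

lemma BT_eqI:
  assumes S: "\<sigma> \<in> probT" and M: "\<mu> \<in> probT" and B: "\<beta> \<in> probT"
    and eq: "\<And>z. cmod z < 1 \<Longrightarrow> etaT \<beta> z = z * hT \<mu> (z * hT \<sigma> (etaT \<beta> z))"
  shows "BT \<sigma> \<mu> = \<beta>"
proof (rule BT_I[OF S M B])
  note b = etaT_holomorphic[OF B] norm_etaT_less_1[OF B]
  note w = holomorphic_mult_hT[OF S b]
  show "subordT \<sigma> \<mu> (etaT \<beta>) (\<lambda>z. z * hT \<sigma> (etaT \<beta> z))"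
    unfolding subordT_def
  proof (intro conjI ballI)
    show "etaT \<beta> z = z * hT \<mu> (z * hT \<sigma> (etaT \<beta> z))" if "z \<in> ball 0 1" for z
      by (rule eq) (use that in simp)
  qed (use b w in \<open>auto simp: etaT_0\<close>)
qed

section \<open>The two identities on the circle\<close>

text \<open>By \<open>BT_eqI\<close> the value \<open>W1\<close> of \<open>etaT \<gamma>\<close> at
  z has to satisfy the equation for \<tau> and the free convolution of \<nu>1 and \<nu>2. The values
  \<open>A1\<close>, \<open>A2\<close> of the second subordination functions at \<open>d1 z\<close>,
  \<open>d2 z\<close> solve the system of \<nu>1 and \<nu>2 at \<open>W2\<close>, so by uniqueness
  they are its subordination values there, and the product of h at \<open>A1\<close> and
  \<open>A2\<close> becomes h of the free convolution at \<open>W2\<close>.\<close>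

theorem BT_mfcT:
  assumes T: "\<tau> \<in> probT" and N1: "\<nu>1 \<in> probT" and N2: "\<nu>2 \<in> probT"
  shows "BT \<tau> (mfcT \<nu>1 \<nu>2) = mfcT (BT \<tau> \<nu>1) (BT \<tau> \<nu>2)"
proof -
  define \<beta>1 \<beta>2 where "\<beta>1 = BT \<tau> \<nu>1" and "\<beta>2 = BT \<tau> \<nu>2"
  define \<gamma> where "\<gamma> = mfcT \<beta>1 \<beta>2"
  have B1: "\<beta>1 \<in> probT" and B2: "\<beta>2 \<in> probT" using BT_char(1) T N1 N2 by (auto simp: \<beta>1_def \<beta>2_def)
  obtain c1 where c1: "subordT \<tau> \<nu>1 (etaT \<beta>1) c1" using BT_char(2)[OF T N1] by (auto simp: \<beta>1_def)
  obtain c2 where c2: "subordT \<tau> \<nu>2 (etaT \<beta>2) c2" using BT_char(2)[OF T N2] by (auto simp: \<beta>2_def)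
  obtain d1 d2 where d: "subordT \<beta>1 \<beta>2 d1 d2" using subordT_exists[OF B1 B2] by blast
  obtain a1 a2 where a: "subordT \<nu>1 \<nu>2 a1 a2" using subordT_exists[OF N1 N2] by blast
  have G: "\<gamma> \<in> probT" using mfcT_char[OF B1 B2] by (simp add: \<gamma>_def)
  have R: "mfcT \<nu>1 \<nu>2 \<in> probT" using mfcT_char[OF N1 N2] by simp
  have "BT \<tau> (mfcT \<nu>1 \<nu>2) = \<gamma>"
  proof (rule BT_eqI[OF T R G])
    fix z :: complex assume z: "cmod z < 1"
    define W1 W2 where "W1 = etaT \<gamma> z" and "W2 = z * hT \<tau> W1"
    define A1 A2 where "A1 = c1 (d1 z)" and "A2 = c2 (d2 z)"
    have W1: "cmod W1 < 1" using norm_etaT_less_1[OF G z] by (simp add: W1_def)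
    have "cmod W2 \<le> cmod z" using norm_hT_le_1[OF T W1] by (simp add: W2_def norm_mult mult_left_le)
    then have W2: "cmod W2 < 1" using z by simp
    note dz = subordT_D[OF d z]
    have e: "etaT \<beta>1 (d1 z) = W1" "etaT \<beta>2 (d2 z) = W1"
      using hT_mfcT(2,3)[OF B1 B2 d z] by (simp_all add: W1_def \<gamma>_def)
    have h: "hT \<beta>1 (d1 z) = hT \<nu>1 A1" "hT \<beta>2 (d2 z) = hT \<nu>2 A2"
      using hT_BT[OF T N1 c1[unfolded \<beta>1_def] dz(3)] hT_BT[OF T N2 c2[unfolded \<beta>2_def] dz(4)]
      by (simp_all add: \<beta>1_def \<beta>2_def A1_def A2_def)
    have A: "A1 = d1 z * hT \<tau> W1" "A2 = d2 z * hT \<tau> W1"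
      using subordT_D(2)[OF c1 dz(3)] subordT_D(2)[OF c2 dz(4)] by (simp_all only: A1_def A2_def e)
    \<comment> \<open>The indices cross: \<open>d1 z\<close> is z times h of \<open>\<beta>2\<close>
      at \<open>d2 z\<close>, which is \<open>hT \<nu>2 A2\<close>; the remaining factor z times
      \<open>hT \<tau> W1\<close> is \<open>W2\<close>.\<close>
    have A1: "A1 = W2 * hT \<nu>2 A2" using A(1) dz(1) unfolding h W2_def by (simp add: mult_ac)
    have A2: "A2 = W2 * hT \<nu>1 A1" using A(2) dz(2) unfolding h W2_def by (simp add: mult_ac)
    have cA1: "cmod A1 < 1" using subordT_D(4)[OF c1 dz(3)] by (simp add: A1_def)
    have s: "a1 W2 = A1" "a2 W2 = A2"
      by (rule subordination_unique[OF N1 N2 W2 subordT_D(3,1,2)[OF a W2] cA1 A1 A2])+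
    have "W1 = z * hT \<gamma> z" using etaT_hT[OF G z] by (simp add: W1_def)
    also have "hT \<gamma> z = hT \<nu>1 A1 * hT \<nu>2 A2" using hT_mfcT(1)[OF B1 B2 d z] by (simp add: \<gamma>_def h)
    also have "\<dots> = hT (mfcT \<nu>1 \<nu>2) W2" using hT_mfcT(1)[OF N1 N2 a W2] by (simp add: s)
    finally show "etaT \<gamma> z = z * hT (mfcT \<nu>1 \<nu>2) (z * hT \<tau> (etaT \<gamma> z))"
      by (simp only: W1_def W2_def)
  qed
  then show ?thesis by (simp add: \<gamma>_def \<beta>1_def \<beta>2_def)
qed

lemma hT_mconvT:
  assumes S: "\<sigma> \<in> probT" and M: "\<mu> \<in> probT" and z: "cmod z < 1"
  shows "hT (mconvT \<sigma> \<mu>) z = hT \<mu> z * hT \<sigma> (etaT \<mu> z)"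
proof (rule hT_eqI[OF _ _ _ z])
  show "mconvT \<sigma> \<mu> \<in> probT" using mconvT_char[OF S M] by blast
  have "(hT \<sigma> \<circ> etaT \<mu>) holomorphic_on ball 0 1"
    by (rule holomorphic_on_compose_gen[OF etaT_holomorphic[OF M] hT_holomorphic[OF S]])
       (use norm_etaT_less_1[OF M] in auto)
  then show "(\<lambda>z. hT \<mu> z * hT \<sigma> (etaT \<mu> z)) holomorphic_on ball 0 1"
    by (intro holomorphic_intros hT_holomorphic[OF M]) (simp add: o_def)
  show "etaT (mconvT \<sigma> \<mu>) z = z * (hT \<mu> z * hT \<sigma> (etaT \<mu> z))" if "cmod z < 1" for z
    using mconvT_char[OF S M] that etaT_hT[OF S norm_etaT_less_1[OF M that]] etaT_hT[OF M that]
    by (metis mem_ball_0 mult.assoc)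
qed

text \<open>With e the value of \<open>etaT \<beta>\<close> at z, \<open>g z\<close> is z times
  \<open>hT \<tau>1 e\<close>, and \<open>etaT \<beta>2\<close> at \<open>g z\<close> equals e times
  \<open>hT \<tau>1 e\<close>, that is \<open>etaT \<tau>1 e\<close>. Hence \<open>c (g z)\<close>
  is z times \<open>hT \<tau>1 e\<close> times \<open>hT \<tau>2 (etaT \<tau>1 e)\<close>, and the
  last two factors form h of the monotone convolution at e.\<close>

theorem BT_BT:
  assumes T1: "\<tau>1 \<in> probT" and T2: "\<tau>2 \<in> probT" and N: "\<nu> \<in> probT"
  shows "BT \<tau>1 (BT \<tau>2 \<nu>) = BT (mconvT \<tau>2 \<tau>1) \<nu>"
proof -
  define \<beta>2 where "\<beta>2 = BT \<tau>2 \<nu>"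
  define \<beta> where "\<beta> = BT \<tau>1 \<beta>2"
  have B2: "\<beta>2 \<in> probT" using BT_char(1)[OF T2 N] by (simp add: \<beta>2_def)
  have B: "\<beta> \<in> probT" using BT_char(1)[OF T1 B2] by (simp add: \<beta>_def)
  have C: "mconvT \<tau>2 \<tau>1 \<in> probT" using mconvT_char[OF T2 T1] by simp
  obtain c where c: "subordT \<tau>2 \<nu> (etaT \<beta>2) c" using BT_char(2)[OF T2 N] by (auto simp: \<beta>2_def)
  obtain g where g: "subordT \<tau>1 \<beta>2 (etaT \<beta>) g" using BT_char(2)[OF T1 B2] by (auto simp: \<beta>_def)
  have "BT (mconvT \<tau>2 \<tau>1) \<nu> = \<beta>"
  proof (rule BT_eqI[OF C N B])
    fix z :: complex assume z: "cmod z < 1"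
    define e where "e = etaT \<beta> z"
    note gz = subordT_D[OF g z, folded e_def]
    have h2: "hT \<beta>2 (g z) = hT \<nu> (c (g z))"
      using hT_BT[OF T2 N c[unfolded \<beta>2_def] gz(4)] by (simp add: \<beta>2_def)
    have "etaT \<beta>2 (g z) = z * hT \<tau>1 e * hT \<beta>2 (g z)"
      using etaT_hT[OF B2 gz(4)] gz(2) by metis
    also have "\<dots> = e * hT \<tau>1 e" using gz(1) by (metis mult.assoc mult.commute)
    finally have b: "etaT \<beta>2 (g z) = etaT \<tau>1 e" using etaT_hT[OF T1 gz(3)] by simp
    have "c (g z) = g z * hT \<tau>2 (etaT \<tau>1 e)" using subordT_D(2)[OF c gz(4)] b by simp
    also have "\<dots> = z * (hT \<tau>1 e * hT \<tau>2 (etaT \<tau>1 e))" using gz(2) by (metis mult.assoc)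
    also have "\<dots> = z * hT (mconvT \<tau>2 \<tau>1) e" by (simp add: hT_mconvT[OF T2 T1 gz(3)])
    finally show "etaT \<beta> z = z * hT \<nu> (z * hT (mconvT \<tau>2 \<tau>1) (etaT \<beta> z))"
      using gz(1) h2 unfolding e_def[symmetric] by metis
  qed
  then show ?thesis by (simp add: \<beta>_def \<beta>2_def)
qed

section \<open>Probability measures on the half-line\<close>

text \<open>The analogue of \<open>gT\<close> at z = -y. For y, t \<ge> 0 the kernel lies in (0,1],
  so it is integrable without any moment assumption.\<close>

definition SR :: "real measure \<Rightarrow> real \<Rightarrow> real" where
  "SR M y = (LINT t|M. 1 / (1 + y * t))"

text \<open>Both signs are flipped so that the functions involved are nonnegative and increasing on
  the half-line.\<close>

definition fR :: "real measure \<Rightarrow> real \<Rightarrow> real" where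
  "fR M y = - etaR M (- y)"

lemma etaR_fR: "etaR M x = - fR M (- x)" by (simp add: fR_def)

lemma fR_0: "fR M 0 = 0" by (simp add: fR_def etaR_def)

lemma probRp_D:
  assumes "M \<in> probRp"
  shows "prob_space M" "sets M = sets borel" "space M = UNIV" "AE t in M. 0 \<le> t"
  using assms sets_eq_imp_space_eq[of M borel] by (auto simp: probRp_def)

lemma deltaR0_probRp: "deltaR0 \<in> probRp"
  by (auto simp: probRp_def deltaR0_def prob_space_return AE_return)

lemma probRp_eq_deltaR0:
  assumes M: "M \<in> probRp" and "AE t in M. t = 0"
  shows "M = deltaR0"
proof (rule measure_eqI)
  note m = probRp_D[OF M]
  interpret prob_space M by (rule m)
  show "sets M = sets deltaR0" using m by (simp add: deltaR0_def)
  fix A assume A: "A \<in> sets M"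
  have "emeasure M A = emeasure M (if 0 \<in> A then space M else {})"
    by (rule emeasure_eq_AE) (use assms(2) A in \<open>auto elim: eventually_mono\<close>)
  then show "emeasure M A = emeasure deltaR0 A"
    using A m(2,3) emeasure_space_1 by (auto simp: deltaR0_def split: if_splits)
qed

lemma kernel_bounds:
  fixes y t :: real
  assumes "0 \<le> y" "0 \<le> t"
  shows "0 < 1 + y * t" "0 < 1 / (1 + y * t)" "norm (1 / (1 + y * t)) \<le> 1"
proof -
  have "0 \<le> y * t" using assms by simp
  then show "0 < 1 + y * t" "0 < 1 / (1 + y * t)" "norm (1 / (1 + y * t)) \<le> 1"
    by (auto simp: divide_le_eq)
qed

context
  fixes M :: "real measure"
  assumes M: "M \<in> probRp"
begin

interpretation prob_space M by (rule probRp_D[OF M])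

lemma integrable_SR: assumes "0 \<le> y" shows "integrable M (\<lambda>t. 1 / (1 + y * t))"
proof (rule integrable_const_bound[where B=1])
  note [measurable_cong] = probRp_D(2)[OF M]
  show "AE t in M. norm (1 / (1 + y * t)) \<le> 1"
    using probRp_D(4)[OF M] by eventually_elim (rule kernel_bounds(3)[OF assms])
  show "(\<lambda>t. 1 / (1 + y * t)) \<in> borel_measurable M" by measurable
qed

lemma SR_0: "SR M 0 = 1" by (simp add: SR_def prob_space)

lemma SR_pos: assumes "0 \<le> y" shows "0 < SR M y"
proof -
  have ae: "AE t in M. 0 < 1 / (1 + y * t)"
    using probRp_D(4)[OF M] by eventually_elim (rule kernel_bounds(2)[OF assms])
  then have nn: "AE t in M. 0 \<le> 1 / (1 + y * t)" by eventually_elim (rule less_imp_le)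
  then have "0 \<le> SR M y" unfolding SR_def by (rule integral_nonneg_AE)
  moreover have "SR M y \<noteq> 0"
  proof
    assume "SR M y = 0"
    then have "AE t in M. 1 / (1 + y * t) = 0"
      using integral_nonneg_eq_0_iff_AE[OF integrable_SR[OF assms] nn] unfolding SR_def by (simp only:)
    with ae have "AE t in M. False" by eventually_elim auto
    then show False by simp
  qed
  ultimately show ?thesis by simp
qed

lemma SR_le: assumes "0 \<le> y" "y \<le> y'" shows "SR M y' \<le> SR M y"
  unfolding SR_def
proof (rule integral_mono_AE)
  show "AE t in M. 1 / (1 + y' * t) \<le> 1 / (1 + y * t)"
    using probRp_D(4)[OF M]
    by eventually_elim (use assms in \<open>auto intro!: divide_left_mono mult_right_mono mult_pos_pos add_pos_nonneg\<close>)
qed (use assms integrable_SR in auto)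

text \<open>Equality would make the nonnegative difference of the two kernels vanish almost
  everywhere, which forces t = 0.\<close>

lemma SR_less: assumes "M \<noteq> deltaR0" "0 \<le> y" "y < y'" shows "SR M y' < SR M y"
proof -
  have "SR M y' \<noteq> SR M y"
  proof
    assume eq: "SR M y' = SR M y"
    have i: "integrable M (\<lambda>t. 1 / (1 + y * t) - 1 / (1 + y' * t))"
      using integrable_SR assms by (intro Bochner_Integration.integrable_diff) auto
    have "(LINT t|M. 1 / (1 + y * t) - 1 / (1 + y' * t)) = 0"
      using eq integrable_SR[of y] integrable_SR[of y'] assms by (simp add: SR_def)
    moreover have "AE t in M. 0 \<le> 1 / (1 + y * t) - 1 / (1 + y' * t)"
      using probRp_D(4)[OF M]
      by eventually_elim (use assms in \<open>auto intro!: divide_left_mono mult_right_mono mult_pos_pos add_pos_nonneg\<close>)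
    ultimately have "AE t in M. 1 / (1 + y * t) - 1 / (1 + y' * t) = 0"
      using integral_nonneg_eq_0_iff_AE[OF i] by simp
    then have "AE t in M. t = 0" using probRp_D(4)[OF M]
    proof eventually_elim
      fix t :: real assume t: "1 / (1 + y * t) - 1 / (1 + y' * t) = 0" "0 \<le> t"
      have "1 + y * t > 0" "1 + y' * t > 0" using t assms by (auto intro!: add_pos_nonneg mult_nonneg_nonneg)
      then have "1 + y * t = 1 + y' * t" using t(1) by (simp add: frac_eq_eq)
      then have "y * t = y' * t" by simp
      then show "t = 0" using assms by auto
    qed
    then show False using probRp_eq_deltaR0[OF M] assms by simp
  qed
  then show ?thesis using SR_le assms by (metis less_eq_real_def)
qed

lemma SR_le_1: "0 \<le> y \<Longrightarrow> SR M y \<le> 1" using SR_le[of 0 y] SR_0 by simp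

lemma continuous_SR: "continuous_on {0..} (SR M)"
  unfolding continuous_on_sequentially
proof (intro allI impI ballI, elim conjE)
  note [measurable_cong] = probRp_D(2)[OF M]
  fix X :: "nat \<Rightarrow> real" and y assume X: "\<forall>n. X n \<in> {0..}" "X \<longlonglongrightarrow> y" and y: "y \<in> {0..}"
  have "(\<lambda>n. LINT t|M. 1 / (1 + X n * t)) \<longlonglongrightarrow> (LINT t|M. 1 / (1 + y * t))"
  proof (rule integral_dominated_convergence[where w="\<lambda>_. 1"])
    show "AE t in M. (\<lambda>n. 1 / (1 + X n * t)) \<longlonglongrightarrow> 1 / (1 + y * t)"
      using probRp_D(4)[OF M]
    proof eventually_elim
      fix t :: real assume "0 \<le> t"
      then have "0 < 1 + y * t" using y by (auto intro!: add_pos_nonneg)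
      then show "(\<lambda>n. 1 / (1 + X n * t)) \<longlonglongrightarrow> 1 / (1 + y * t)" by (intro tendsto_intros X) auto
    qed
    show "AE t in M. norm (1 / (1 + X n * t)) \<le> 1" for n
      using probRp_D(4)[OF M] by eventually_elim (use X kernel_bounds(3) in auto)
  qed measurable
  then show "(SR M \<circ> X) \<longlonglongrightarrow> SR M y" by (simp add: SR_def o_def)
qed

lemma fR_SR: assumes "0 \<le> y" shows "fR M y = 1 / SR M y - 1"
proof (cases "y = 0")
  case True then show ?thesis by (simp add: fR_def etaR_def SR_0)
next
  case False
  have "GR M (1 / (-y)) = (LINT t|M. (-y) * (1 / (1 + y * t)))"
    unfolding GR_def using False by (intro Bochner_Integration.integral_cong) (auto simp: divide_simps algebra_simps)
  then have "GR M (1 / (-y)) = (-y) * SR M y" by (simp only: integral_mult_right_zero SR_def)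
  then show ?thesis using False by (simp add: fR_def etaR_def)
qed

lemma fR_nonneg: "0 \<le> y \<Longrightarrow> 0 \<le> fR M y"
  using SR_pos[of y] SR_le_1[of y] by (simp add: fR_SR)

lemma fR_mono: "0 \<le> y \<Longrightarrow> y \<le> y' \<Longrightarrow> fR M y \<le> fR M y'"
  using SR_pos[of y] SR_pos[of y'] SR_le[of y y'] by (simp add: fR_SR frac_le)

lemma fR_less: "M \<noteq> deltaR0 \<Longrightarrow> 0 \<le> y \<Longrightarrow> y < y' \<Longrightarrow> fR M y < fR M y'"
  using SR_pos[of y] SR_pos[of y'] SR_less[of y y'] by (simp add: fR_SR frac_less2)

lemma fR_pos: "M \<noteq> deltaR0 \<Longrightarrow> 0 < y \<Longrightarrow> 0 < fR M y"
  using fR_less[of 0 y] by (simp add: fR_0)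

lemma fR_inj: "M \<noteq> deltaR0 \<Longrightarrow> 0 \<le> y \<Longrightarrow> 0 \<le> y' \<Longrightarrow> fR M y = fR M y' \<Longrightarrow> y = y'"
  using fR_less[of y y'] fR_less[of y' y] by (cases y y' rule: linorder_cases) auto

lemma continuous_fR: "continuous_on {0..} (fR M)"
proof -
  have "continuous_on {0..} (\<lambda>y. 1 / SR M y - 1)"
    by (intro continuous_intros continuous_SR) (use SR_pos in force)
  then show ?thesis by (rule continuous_on_eq) (simp add: fR_SR)
qed

lemma fR_small: assumes "0 < \<epsilon>" shows "\<exists>\<delta>>0. \<forall>y. 0 \<le> y \<and> y < \<delta> \<longrightarrow> fR M y < \<epsilon>"
proof -
  obtain d where "d > 0" "\<And>x. x \<in> {0..} \<Longrightarrow> dist x 0 < d \<Longrightarrow> dist (fR M x) (fR M 0) < \<epsilon>"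
    using continuous_fR assms unfolding continuous_on_iff by (metis atLeast_iff order_refl)
  then show ?thesis by (intro exI[of _ d]) (auto simp: fR_0 dist_real_def abs_less_iff)
qed

text \<open>Harmonic means are concave, so \<open>1 + fR M\<close>, the harmonic mean of \<open>1 + y t\<close>, is concave in \<open>y\<close>.\<close>

lemma fR_concave: assumes l: "0 \<le> l" "l \<le> 1" and y: "0 \<le> y" shows "l * fR M y \<le> fR M (l * y)"
proof -
  define a where "a = 1 / SR M y"
  define b where "b = (1 - l) + l * a"
  have a: "0 < a" "a * SR M y = 1" using SR_pos[OF y] by (auto simp: a_def)
  have b: "0 < b" using l a unfolding b_def by (cases "l = 1") (auto intro!: add_pos_nonneg)
  have ly: "0 \<le> l * y" using l y by simp
  have "b\<^sup>2 * SR M (l * y) = (LINT t|M. b\<^sup>2 * (1 / (1 + l * y * t)))"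
    by (simp only: SR_def integral_mult_right_zero)
  also have "\<dots> \<le> (LINT t|M. (1 - l) + l * a\<^sup>2 * (1 / (1 + y * t)))"
  proof (rule integral_mono_AE)
    show "AE t in M. b\<^sup>2 * (1 / (1 + l * y * t)) \<le> (1 - l) + l * a\<^sup>2 * (1 / (1 + y * t))"
      using probRp_D(4)[OF M]
    proof eventually_elim
      fix t :: real assume t: "0 \<le> t"
      define x where "x = 1 + y * t"
      have x: "0 < x" using t y by (auto simp: x_def intro!: add_pos_nonneg)
      have p: "0 < (1 - l) + l * x" using l x by (cases "l = 1") (auto intro!: add_pos_nonneg)
      \<comment> \<open>The Cauchy-Schwarz inequality for two terms with weights 1 - l and l, as an
        identity with a square as remainder. With a = 1 / SR M y the right side integrates to
        b.\<close>
      have "((1 - l) + l * a\<^sup>2 / x) * ((1 - l) + l * x) - b\<^sup>2 = l * (1 - l) * (x - a)\<^sup>2 / x"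
        unfolding b_def using x by (simp add: field_simps power2_eq_square)
      moreover have "0 \<le> l * (1 - l) * (x - a)\<^sup>2 / x" using l x by simp
      ultimately have "b\<^sup>2 \<le> ((1 - l) + l * a\<^sup>2 / x) * ((1 - l) + l * x)" by linarith
      then have "b\<^sup>2 / ((1 - l) + l * x) \<le> (1 - l) + l * a\<^sup>2 / x" using p by (simp add: divide_le_eq)
      moreover have "1 + l * y * t = (1 - l) + l * x" by (simp add: x_def algebra_simps)
      ultimately show "b\<^sup>2 * (1 / (1 + l * y * t)) \<le> (1 - l) + l * a\<^sup>2 * (1 / (1 + y * t))"
        unfolding x_def[symmetric] by (simp only: times_divide_eq_right mult_1_right)
    qed
    show "integrable M (\<lambda>t. b\<^sup>2 * (1 / (1 + l * y * t)))" by (intro integrable_mult_right integrable_SR ly)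
    show "integrable M (\<lambda>t. (1 - l) + l * a\<^sup>2 * (1 / (1 + y * t)))"
      by (intro Bochner_Integration.integrable_add integrable_mult_right integrable_SR y) simp
  qed
  also have "\<dots> = (1 - l) + l * a\<^sup>2 * SR M y"
    by (subst Bochner_Integration.integral_add[OF _ integrable_mult_right[OF integrable_SR[OF y]]])
       (simp_all only: integral_mult_right_zero SR_def integrable_const, simp add: prob_space)
  also have "\<dots> = b" using a by (simp add: b_def power2_eq_square)
  finally have "b * (b * SR M (l * y)) \<le> b * 1" by (simp add: power2_eq_square mult.assoc)
  then have "b * SR M (l * y) \<le> 1" using b by (simp only: mult_le_cancel_left_pos)
  then have "b \<le> 1 / SR M (l * y)" using SR_pos[OF ly] by (simp add: le_divide_eq)
  then show ?thesis unfolding fR_SR[OF ly] fR_SR[OF y] a_def b_def by (simp add: algebra_simps)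
qed

text \<open>Concavity together with f(0) = 0. This monotonicity of k(w) = f(w)/w drives the fixed
  point argument on the half-line.\<close>

lemma fR_div_antimono: assumes "0 < y" "y \<le> y'" shows "fR M y' / y' \<le> fR M y / y"
  using fR_concave[of "y / y'" y'] assms by (simp add: field_simps)

end

text \<open>The substitution Q = c t / (1 + c t) moves the half-line into [0,1), where moments exist
  and determine the measure. For y = c (1 - s) the kernel 1 / (1 + y t) is W / (1 - s Q) with W = 1
  - Q, so s tending to 0 means y tending to the interior point c of (0, e).\<close>

lemma SR_eqI:
  assumes M: "M \<in> probRp" and N: "N \<in> probRp" and e: "0 < e"
    and eq: "\<And>y. 0 < y \<Longrightarrow> y < e \<Longrightarrow> SR M y = SR N y"
  shows "M = N"
proof -
  define c where "c = e / 2"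
  have c: "0 < c" "c < e" using e by (auto simp: c_def)
  define W Q where "W t = 1 / (1 + c * t)" and "Q t = c * t / (1 + c * t)" for t :: real
  note m = probRp_D[OF M] and n = probRp_D[OF N]
  have [measurable]: "W \<in> borel_measurable borel" "Q \<in> borel_measurable borel"
    unfolding W_def[abs_def] Q_def[abs_def] by measurable
  have WQ: "0 < 1 + c * t" "W t = 1 - Q t" "0 \<le> Q t" "Q t \<le> 1" "0 \<le> W t" "W t \<le> 1" if "0 \<le> t" for t
  proof -
    show p: "0 < 1 + c * t" using that c by (auto intro!: add_pos_nonneg)
    then show "W t = 1 - Q t" by (simp add: W_def Q_def field_simps)
    show "0 \<le> Q t" "Q t \<le> 1" "0 \<le> W t" "W t \<le> 1" using p that c by (auto simp: Q_def W_def)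
  qed
  define s where "s n = 1 / (real n + 2)" for n
  have s: "s \<longlonglongrightarrow> 0" "0 < s n" "s n \<le> 1/2" for n
    unfolding s_def by real_asymp (auto simp: field_simps)
  have WQk: "(LINT t|M. W t * Q t ^ k) = (LINT t|N. W t * Q t ^ k)" for k
  proof (rule moments_eq[where s=s])
    show "W \<in> borel_measurable M" "Q \<in> borel_measurable M" "W \<in> borel_measurable N" "Q \<in> borel_measurable N"
      by (simp_all add: measurable_cong_sets[OF m(2) refl] measurable_cong_sets[OF n(2) refl])
    show "AE x in M. norm (W x) \<le> 1 \<and> norm (Q x) \<le> 1" using m(4) by eventually_elim (use WQ in auto)
    show "AE x in N. norm (W x) \<le> 1 \<and> norm (Q x) \<le> 1" using n(4) by eventually_elim (use WQ in auto)
    fix i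
    have "(LINT x|P. W x / (1 - s i * Q x)) = SR P (c * (1 - s i))" if P: "P \<in> probRp" for P
      unfolding SR_def
    proof (rule integral_cong_AE)
      note p = probRp_D[OF P]
      note [measurable_cong] = p(2)
      show "(\<lambda>x. W x / (1 - s i * Q x)) \<in> borel_measurable P" "(\<lambda>t. 1 / (1 + c * (1 - s i) * t)) \<in> borel_measurable P"
        by measurable
      show "AE x in P. W x / (1 - s i * Q x) = 1 / (1 + c * (1 - s i) * x)" using p(4)
      proof eventually_elim
        fix x :: real assume x: "0 \<le> x"
        have "1 - s i * Q x = (1 + c * (1 - s i) * x) / (1 + c * x)"
          using WQ(1)[OF x] by (simp add: Q_def field_simps)
        then show "W x / (1 - s i * Q x) = 1 / (1 + c * (1 - s i) * x)"
          using WQ(1)[OF x] by (simp add: W_def)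
      qed
    qed
    moreover have "SR M (c * (1 - s i)) = SR N (c * (1 - s i))"
    proof (rule eq)
      show "0 < c * (1 - s i)" using c s(3)[of i] by simp
      have "c * (1 - s i) \<le> c * 1" using c s(2)[of i] by (intro mult_left_mono) linarith+
      then show "c * (1 - s i) < e" using c by linarith
    qed
    ultimately show "(LINT x|M. W x / (1 - s i * Q x)) = (LINT x|N. W x / (1 - s i * Q x))" using M N by simp
  qed (use m n s in \<open>auto simp: less_imp_neq[symmetric] abs_le_iff less_imp_le order_trans[of _ 0]\<close>)
  have intQ: "integrable P (\<lambda>t. Q t ^ k)" if P: "P \<in> probRp" for P k
  proof -
    note p = probRp_D[OF P]
    interpret P: prob_space P by (rule p)
    note [measurable_cong] = p(2)
    show ?thesis
      by (rule P.integrable_const_bound[where B=1])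
         (use p(4) in eventually_elim, use WQ in \<open>auto intro!: power_le_one\<close>)
  qed
  have Qk: "(LINT t|M. Q t ^ k) = (LINT t|N. Q t ^ k)" for k
  proof (induction k)
    case 0 show ?case using m(1) n(1) by (simp add: prob_space.prob_space)
  next
    case (Suc k)
    \<comment> \<open>W = 1 - Q turns the weighted moments into differences of consecutive moments
      of Q; the induction starts from total mass 1.\<close>
    have "(LINT t|P. Q t ^ Suc k) = (LINT t|P. Q t ^ k) - (LINT t|P. W t * Q t ^ k)" if P: "P \<in> probRp" for P
    proof -
      note p = probRp_D[OF P]
      note [measurable_cong] = p(2)
      have "(LINT t|P. W t * Q t ^ k) = (LINT t|P. Q t ^ k - Q t ^ Suc k)"
        by (rule integral_cong_AE) (use p(4) in \<open>auto elim!: eventually_mono simp: WQ(2) algebra_simps\<close>)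
      then show ?thesis using intQ[OF P, of k] intQ[OF P, of "Suc k"] by simp
    qed
    then show ?case using Suc WQk M N by simp
  qed
  have d: "distr M borel Q = distr N borel Q"
  proof (rule measure_eqI_dense[where K="{0..1}"])
    have Pd: "prob_space (distr P borel Q)" "AE x in distr P borel Q. x \<in> {0..1}"
         "(LINT x|distr P borel Q. h x) = (LINT t|P. h (Q t))"
      if P: "P \<in> probRp" and [measurable]: "h \<in> borel_measurable borel" for P and h :: "real \<Rightarrow> real"
    proof -
      note p = probRp_D[OF P]
      note [measurable_cong] = p(2)
      show "prob_space (distr P borel Q)" by (rule prob_space.prob_space_distr[OF p(1)]) measurable
      show "AE x in distr P borel Q. x \<in> {0..1}"
        by (subst AE_distr_iff) (use p(4) WQ in \<open>auto elim: eventually_mono\<close>)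
      show "(LINT x|distr P borel Q. h x) = (LINT t|P. h (Q t))" by (rule integral_distr) measurable
    qed
    note h = borel_measurable_const[of 0]
    show "prob_space (distr M borel Q)" "prob_space (distr N borel Q)"
      "AE x in distr M borel Q. x \<in> {0..1}" "AE x in distr N borel Q. x \<in> {0..1}"
      using Pd(1,2)[OF M h] Pd(1,2)[OF N h] by auto
    fix f :: "real \<Rightarrow> real" and e :: real
    assume f: "continuous_on {0..1} f" "0 < e"
    obtain g where g: "real_polynomial_function g" "\<And>x. x \<in> {0..1} \<Longrightarrow> \<bar>f x - g x\<bar> < e"
      using Stone_Weierstrass_real_polynomial_function[OF _ f] by auto
    obtain a k where ak: "g = (\<lambda>x. \<Sum>i\<le>k. a i * x ^ i)" using g(1) real_polynomial_function_iff_sum by blast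
    have cg: "continuous_on UNIV g" unfolding ak by (intro continuous_intros)
    have "(LINT t|P. g (Q t)) = (\<Sum>i\<le>k. a i * (LINT t|P. Q t ^ i))" if "P \<in> probRp" for P
      unfolding ak using intQ[OF that] by simp
    then have "(LINT x|distr M borel Q. g x) = (LINT x|distr N borel Q. g x)"
      using Pd(3)[OF M borel_measurable_continuous_onI[OF cg]] Pd(3)[OF N borel_measurable_continuous_onI[OF cg]] Qk M N by simp
    then show "\<exists>g. continuous_on UNIV g \<and> (\<forall>x\<in>{0..1}. \<bar>f x - g x\<bar> < e) \<and>
      (LINT x|distr M borel Q. g x) = (LINT x|distr N borel Q. g x)" using g(2) cg by blast
  qed auto
  \<comment> \<open>The inverse of \<open>Q\<close> on the half-line, used to recover the measure
    from its image.\<close>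
  define R where "R q = q / (c * (1 - q))" for q :: real
  have [measurable]: "R \<in> borel_measurable borel" unfolding R_def[abs_def] by measurable
  have restore: "distr (distr P borel Q) borel R = P" if P: "P \<in> probRp" for P
  proof -
    note p = probRp_D[OF P]
    note [measurable_cong] = p(2)
    have RQ: "R (Q t) = t" if "0 \<le> t" for t
    proof -
      have "1 - Q t = 1 / (1 + c * t)" using WQ(2)[OF that] by (simp add: W_def)
      then show ?thesis using WQ(1)[OF that] c by (simp add: R_def) (simp add: Q_def)
    qed
    have "distr (distr P borel Q) borel R = distr P borel (R \<circ> Q)" by (rule distr_distr) measurable
    also have "\<dots> = distr P borel (\<lambda>t. t)"
      by (rule distr_cong_AE) (use p(4) RQ in \<open>auto elim: eventually_mono\<close>)
    also have "\<dots> = P" by (rule distr_id2) (simp add: p(2))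
    finally show ?thesis .
  qed
  show ?thesis by (rule restore[OF M, unfolded d restore[OF N], symmetric])
qed

lemma fR_eqI:
  assumes M: "M \<in> probRp" and N: "N \<in> probRp" and e: "0 < e"
    and eq: "\<And>y. 0 < y \<Longrightarrow> y < e \<Longrightarrow> fR M y = fR N y"
  shows "M = N"
proof (rule SR_eqI[OF M N e])
  fix y assume y: "0 < y" "y < e"
  then show "SR M y = SR N y" using eq[OF y] fR_SR[OF M, of y] fR_SR[OF N, of y] by simp
qed

section \<open>Complete Bernstein functions\<close>

abbreviation RHP :: "complex set" where "RHP \<equiv> {w. 0 < Re w}"

lemma open_RHP: "open RHP" by (rule open_halfspace_Re_gt)

lemma connected_RHP: "connected RHP"
  by (intro convex_connected convex_halfspace_Re_gt)

text \<open>Squaring maps the right half-plane onto the plane slit along the negative axis, so the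
  condition concerns the continuation of u to the slit plane. Vanishing at 0 enters separately, as
  the limit assumption of \<open>CBF_measure\<close>.\<close>

definition CBF :: "(real \<Rightarrow> real) \<Rightarrow> bool" where
  "CBF u \<longleftrightarrow> (\<forall>y>0. 0 < u y) \<and> (\<exists>H. H holomorphic_on RHP \<and> (\<forall>w\<in>RHP. 0 < Re (H w)) \<and>
     (\<forall>x>0. H (of_real x) = of_real (u (x\<^sup>2) / x)))"

lemma Re_one_div: "Re (1 / z) = Re z / (cmod z)\<^sup>2"
  by (simp add: Re_divide cmod_power2)

text \<open>If Re H vanished at w, the modulus of exp (-H), which is at most 1, would attain its
  maximum there; exp (-H) would be constant, contradicting its modulus at 1.\<close>

lemma Re_pos_RHP:
  assumes H: "H holomorphic_on RHP" and nn: "\<And>w. w \<in> RHP \<Longrightarrow> 0 \<le> Re (H w)" and 1: "0 < Re (H 1)" and w: "w \<in> RHP"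
  shows "0 < Re (H w)"
proof (rule ccontr)
  assume "\<not> 0 < Re (H w)"
  then have 0: "Re (H w) = 0" using nn[OF w] by simp
  have "(\<lambda>z. exp (- H z)) constant_on RHP"
    by (rule maximum_modulus_principle[OF _ open_RHP connected_RHP open_RHP order_refl w])
       (use H nn 0 in \<open>auto intro!: holomorphic_intros\<close>)
  then obtain c where c: "\<And>z. z \<in> RHP \<Longrightarrow> exp (- H z) = c" by (auto simp: constant_on_def)
  have "cmod (exp (- H 1)) = cmod (exp (- H w))" using c[of 1] c[OF w] by simp
  then show False using 0 1 by simp
qed

lemma CBF_I:
  assumes "\<And>y. 0 < y \<Longrightarrow> 0 < u y" "H holomorphic_on RHP" "\<And>w. w \<in> RHP \<Longrightarrow> 0 \<le> Re (H w)"
    and r: "\<And>x. 0 < x \<Longrightarrow> H (of_real x) = of_real (u (x\<^sup>2) / x)"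
  shows "CBF u"
proof -
  have "0 < Re (H 1)" using r[of 1] assms(1)[of 1] by simp
  then show ?thesis unfolding CBF_def using assms Re_pos_RHP[OF assms(2,3)] by blast
qed

lemma CBF_id: "CBF (\<lambda>y. y)"
  by (rule CBF_I[where H="\<lambda>w. w"]) (auto simp: power2_eq_square intro!: holomorphic_intros)

text \<open>The assumption \<open>\<rho> (cmod v)\<^sup>2 \<le> Re v\<close> says that \<open>v\<close> lies in the disc that inversion maps to the
  half-plane \<open>Re \<ge> \<rho>\<close>; averages stay in this disc by convexity.\<close>

lemma disc_integral:
  fixes v :: "'a \<Rightarrow> complex"
  assumes M: "prob_space M" and [measurable]: "v \<in> borel_measurable M" and B: "AE t in M. cmod (v t) \<le> B"
    and r: "0 \<le> \<rho>" and v: "AE t in M. \<rho> * (cmod (v t))\<^sup>2 \<le> Re (v t)"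
  shows "\<rho> * (cmod (LINT t|M. v t))\<^sup>2 \<le> Re (LINT t|M. v t)"
proof -
  interpret prob_space M by fact
  define m where "m = (LINT t|M. cmod (v t))"
  have iv: "integrable M v" by (rule integrable_const_bound[OF B]) simp
  have i1: "integrable M (\<lambda>t. cmod (v t))" using iv by simp
  have i2: "integrable M (\<lambda>t. (cmod (v t))\<^sup>2)"
    by (rule integrable_const_bound[where B="B\<^sup>2"]) (use B in \<open>auto elim!: eventually_mono intro: power_mono\<close>)
  have "(cmod (LINT t|M. v t))\<^sup>2 \<le> m\<^sup>2" unfolding m_def by (intro power_mono integral_norm_bound) simp
  \<comment> \<open>Nonnegativity of the variance of |v|.\<close>
  moreover have "m\<^sup>2 \<le> (LINT t|M. (cmod (v t))\<^sup>2)"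
  proof -
    have "0 \<le> (LINT t|M. (cmod (v t) - m)\<^sup>2)" by (intro integral_nonneg_AE) simp
    also have "\<dots> = (LINT t|M. (cmod (v t))\<^sup>2 - 2 * m * cmod (v t) + m\<^sup>2)"
      by (intro Bochner_Integration.integral_cong) (auto simp: power2_diff)
    also have "\<dots> = (LINT t|M. (cmod (v t))\<^sup>2) - 2 * m * m + m\<^sup>2"
      using i1 i2 by (simp add: prob_space m_def)
    finally show ?thesis by (simp add: power2_eq_square)
  qed
  ultimately have "\<rho> * (cmod (LINT t|M. v t))\<^sup>2 \<le> \<rho> * (LINT t|M. (cmod (v t))\<^sup>2)"
    using r by (intro mult_left_mono) auto
  also have "\<dots> = (LINT t|M. \<rho> * (cmod (v t))\<^sup>2)" by simp
  also have "\<dots> \<le> (LINT t|M. Re (v t))"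
    by (rule integral_mono_AE) (use i2 iv v in auto)
  also have "\<dots> = Re (LINT t|M. v t)" by (rule integral_Re[OF iv])
  finally show ?thesis .
qed

text \<open>Applied to 1/w and to H, it gives the locally uniform bounds on the integrands that
  \<open>holomorphic_on_integral\<close> asks for.\<close>

lemma local_lower_bound:
  assumes K: "K holomorphic_on RHP" and p: "\<And>w. w \<in> RHP \<Longrightarrow> 0 < Re (K w)" and w: "w \<in> RHP"
  shows "\<exists>r>0. \<exists>\<delta>>0. ball w r \<subseteq> RHP \<and> (\<forall>\<zeta>\<in>ball w r. \<delta> \<le> Re (K \<zeta>))"
proof -
  obtain r1 where r1: "r1 > 0" "ball w r1 \<subseteq> RHP" using open_RHP w openE by blast
  have "isCont K w" using holomorphic_on_imp_continuous_on[OF K] open_RHP w by (simp add: continuous_on_eq_continuous_at)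
  moreover have "0 < Re (K w) / 2" using p[OF w] by simp
  ultimately obtain r2 where r2: "r2 > 0" "\<And>\<zeta>. dist \<zeta> w < r2 \<Longrightarrow> dist (K \<zeta>) (K w) < Re (K w) / 2"
    unfolding continuous_at_eps_delta by metis
  have "Re (K w) / 2 \<le> Re (K \<zeta>)" if "dist \<zeta> w < r2" for \<zeta>
    using abs_Re_le_cmod[of "K \<zeta> - K w"] r2(2)[OF that] by (simp add: dist_norm)
  then have "\<forall>\<zeta>\<in>ball w (min r1 r2). Re (K w) / 2 \<le> Re (K \<zeta>)" by (simp add: dist_commute)
  moreover have "ball w (min r1 r2) \<subseteq> RHP" using r1(2) by auto
  ultimately show ?thesis using r1(1) r2(1) p[OF w]
    by (intro exI[of _ "min r1 r2"] conjI exI[of _ "Re (K w) / 2"]) simp_all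
qed

lemma Re_one_div_pos: "0 < Re w \<Longrightarrow> 0 < Re (1 / w)"
  unfolding Re_one_div by (intro divide_pos_pos) (auto simp: complex_eq_iff)

section \<open>Composition with \<open>fR\<close> preserves the class\<close>

context
  fixes M :: "real measure" and H :: "complex \<Rightarrow> complex" and u :: "real \<Rightarrow> real"
  assumes M: "M \<in> probRp" and M0: "M \<noteq> deltaR0"
    and H: "H holomorphic_on RHP" "\<And>w. w \<in> RHP \<Longrightarrow> 0 < Re (H w)"
    and upos: "\<And>y. 0 < y \<Longrightarrow> 0 < u y"
    and r: "\<And>x. 0 < x \<Longrightarrow> H (of_real x) = of_real (u (x\<^sup>2) / x)"
begin

interpretation prob_space M by (rule probRp_D[OF M])

text \<open>With u(w^2) = w H(w) the integrand is w / (1 + t u(w^2)), so \<open>eK\<close> continues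
  x SR(u(x^2)). In the form chosen, the denominator has positive real part term by term.\<close>

definition eK :: "complex \<Rightarrow> complex" where "eK w = (LINT t|M. 1 / (1 / w + of_real t * H w))"
text \<open>Continues x times the integral of t / (1 + t u(x^2)).\<close>

definition eL :: "complex \<Rightarrow> complex" where "eL w = (LINT t|M. of_real t / (1 / w + of_real t * H w))"

lemma denom:
  assumes "w \<in> RHP" "0 \<le> t"
  shows "Re (1 / w) \<le> Re (1 / w + of_real t * H w)" "t * Re (H w) \<le> Re (1 / w + of_real t * H w)"
    "0 < Re (1 / w + of_real t * H w)" "1 / w + of_real t * H w \<noteq> 0"
proof -
  have 1: "0 < Re (1 / w)" by (rule Re_one_div_pos) (use assms in simp)
  have 2: "0 \<le> t * Re (H w)" using assms H(2)[OF assms(1)] by simp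
  have e: "Re (1 / w + of_real t * H w) = Re (1 / w) + t * Re (H w)" by simp
  show "Re (1 / w) \<le> Re (1 / w + of_real t * H w)" "t * Re (H w) \<le> Re (1 / w + of_real t * H w)"
    and p: "0 < Re (1 / w + of_real t * H w)" unfolding e using 1 2 by linarith+
  show "1 / w + of_real t * H w \<noteq> 0" using p by (metis less_irrefl zero_complex.sel(1))
qed

lemma kernel_bound:
  assumes "w \<in> RHP" "0 \<le> t"
  shows "0 < \<delta> \<Longrightarrow> \<delta> \<le> Re (1 / w) \<Longrightarrow> cmod (1 / (1 / w + of_real t * H w)) \<le> 1 / \<delta>"
    and "0 < \<delta> \<Longrightarrow> \<delta> \<le> Re (H w) \<Longrightarrow> cmod (of_real t / (1 / w + of_real t * H w)) \<le> 1 / \<delta>"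
proof -
  have n: "Re (1 / w + of_real t * H w) \<le> cmod (1 / w + of_real t * H w)" by (rule complex_Re_le_cmod)
  show "cmod (1 / (1 / w + of_real t * H w)) \<le> 1 / \<delta>" if "0 < \<delta>" "\<delta> \<le> Re (1 / w)"
    unfolding norm_divide norm_one using denom[OF assms] n that by (intro divide_left_mono mult_pos_pos) linarith+
  show "cmod (of_real t / (1 / w + of_real t * H w)) \<le> 1 / \<delta>" if d: "0 < \<delta>" "\<delta> \<le> Re (H w)"
  proof -
    have "t * \<delta> \<le> t * Re (H w)" using d assms by (intro mult_left_mono) auto
    then have "t * \<delta> \<le> cmod (1 / w + of_real t * H w)" using denom(2)[OF assms] n by linarith
    moreover have "0 < cmod (1 / w + of_real t * H w)" using denom(4)[OF assms] by simp
    ultimately show ?thesis unfolding norm_divide using d assms by (simp add: divide_le_eq le_divide_eq mult.commute)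
  qed
qed

lemma kernel_measurable:
  "(\<lambda>t. 1 / (1 / w + complex_of_real t * H w)) \<in> borel_measurable M"
  "(\<lambda>t. complex_of_real t / (1 / w + complex_of_real t * H w)) \<in> borel_measurable M"
proof -
  note [measurable_cong] = probRp_D(2)[OF M]
  show "(\<lambda>t. 1 / (1 / w + complex_of_real t * H w)) \<in> borel_measurable M"
    "(\<lambda>t. complex_of_real t / (1 / w + complex_of_real t * H w)) \<in> borel_measurable M"
    by measurable
qed

lemma kernel_bound_AE:
  assumes "w \<in> RHP"
  shows "AE t in M. cmod (1 / (1 / w + of_real t * H w)) \<le> 1 / Re (1 / w)"
    and "AE t in M. cmod (of_real t / (1 / w + of_real t * H w)) \<le> 1 / Re (H w)"
proof -
  have p: "0 < Re (1 / w)" by (rule Re_one_div_pos) (use assms in simp)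
  show "AE t in M. cmod (1 / (1 / w + of_real t * H w)) \<le> 1 / Re (1 / w)"
    using probRp_D(4)[OF M] by eventually_elim (rule kernel_bound(1)[OF assms _ p order_refl])
  show "AE t in M. cmod (of_real t / (1 / w + of_real t * H w)) \<le> 1 / Re (H w)"
    using probRp_D(4)[OF M] by eventually_elim (rule kernel_bound(2)[OF assms _ H(2)[OF assms] order_refl])
qed

lemma holomorphic_one_div: "(\<lambda>w. 1 / w) holomorphic_on RHP"
  by (intro holomorphic_intros) auto

lemma eK_holomorphic: "eK holomorphic_on RHP"
  unfolding eK_def[abs_def]
proof (rule holomorphic_on_integral[OF open_RHP finite_measure_axioms kernel_measurable(1)])
  show "AE t in M. (\<lambda>w. 1 / (1 / w + of_real t * H w)) holomorphic_on RHP"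
    using probRp_D(4)[OF M]
    by eventually_elim (intro holomorphic_intros holomorphic_one_div H(1) denom(4))
  fix w assume w: "w \<in> RHP"
  have "\<exists>r>0. \<exists>\<delta>>0. ball w r \<subseteq> RHP \<and> (\<forall>\<zeta>\<in>ball w r. \<delta> \<le> Re (1 / \<zeta>))"
    by (rule local_lower_bound[OF holomorphic_one_div _ w], rule Re_one_div_pos, simp)
  then obtain r \<delta> where rd: "r > 0" "\<delta> > 0" "ball w r \<subseteq> RHP" "\<And>\<zeta>. \<zeta> \<in> ball w r \<Longrightarrow> \<delta> \<le> Re (1 / \<zeta>)" by blast
  have "AE t in M. \<forall>\<zeta>\<in>ball w r. cmod (1 / (1 / \<zeta> + of_real t * H \<zeta>)) \<le> 1 / \<delta>"
    using probRp_D(4)[OF M]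
  proof eventually_elim
    fix t :: real assume "0 \<le> t"
    from kernel_bound(1)[OF subsetD[OF rd(3)] this rd(2) rd(4)]
    show "\<forall>\<zeta>\<in>ball w r. cmod (1 / (1 / \<zeta> + of_real t * H \<zeta>)) \<le> 1 / \<delta>" by blast
  qed
  with rd(1,3) show "\<exists>r>0. \<exists>B. ball w r \<subseteq> RHP \<and> (AE t in M. \<forall>\<zeta>\<in>ball w r. cmod (1 / (1 / \<zeta> + of_real t * H \<zeta>)) \<le> B)"
    by (intro exI[of _ r] exI[of _ "1 / \<delta>"] conjI)
qed

lemma eL_holomorphic: "eL holomorphic_on RHP"
  unfolding eL_def[abs_def]
proof (rule holomorphic_on_integral[OF open_RHP finite_measure_axioms kernel_measurable(2)])
  show "AE t in M. (\<lambda>w. of_real t / (1 / w + of_real t * H w)) holomorphic_on RHP"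
    using probRp_D(4)[OF M]
    by eventually_elim (intro holomorphic_intros holomorphic_one_div H(1) denom(4))
  fix w assume w: "w \<in> RHP"
  have "\<exists>r>0. \<exists>\<delta>>0. ball w r \<subseteq> RHP \<and> (\<forall>\<zeta>\<in>ball w r. \<delta> \<le> Re (H \<zeta>))"
    by (rule local_lower_bound[OF H w])
  then obtain r \<delta> where rd: "r > 0" "\<delta> > 0" "ball w r \<subseteq> RHP" "\<And>\<zeta>. \<zeta> \<in> ball w r \<Longrightarrow> \<delta> \<le> Re (H \<zeta>)" by blast
  have "AE t in M. \<forall>\<zeta>\<in>ball w r. cmod (of_real t / (1 / \<zeta> + of_real t * H \<zeta>)) \<le> 1 / \<delta>"
    using probRp_D(4)[OF M]
  proof eventually_elim
    fix t :: real assume "0 \<le> t"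
    from kernel_bound(2)[OF subsetD[OF rd(3)] this rd(2) rd(4)]
    show "\<forall>\<zeta>\<in>ball w r. cmod (of_real t / (1 / \<zeta> + of_real t * H \<zeta>)) \<le> 1 / \<delta>" by blast
  qed
  with rd(1,3) show "\<exists>r>0. \<exists>B. ball w r \<subseteq> RHP \<and> (AE t in M. \<forall>\<zeta>\<in>ball w r. cmod (of_real t / (1 / \<zeta> + of_real t * H \<zeta>)) \<le> B)"
    by (intro exI[of _ r] exI[of _ "1 / \<delta>"] conjI)
qed

text \<open>Each integrand is the inverse of a point with real part at least Re (1/w), and averaging
  stays in the corresponding disc. Inverting back, Re (1 / \<open>eK w\<close>) \<ge> Re
  (1/w).\<close>

lemma eK_disc: assumes w: "w \<in> RHP" shows "Re (1 / w) * (cmod (eK w))\<^sup>2 \<le> Re (eK w)"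
  unfolding eK_def
proof (rule disc_integral[OF prob_space_axioms kernel_measurable(1) kernel_bound_AE(1)[OF w]])
  show "0 \<le> Re (1 / w)" using Re_one_div_pos[of w] w by simp
  show "AE t in M. Re (1 / w) * (cmod (1 / (1 / w + of_real t * H w)))\<^sup>2 \<le> Re (1 / (1 / w + of_real t * H w))"
    using probRp_D(4)[OF M]
  proof eventually_elim
    fix t :: real assume "0 \<le> t"
    then show "Re (1 / w) * (cmod (1 / (1 / w + of_real t * H w)))\<^sup>2 \<le> Re (1 / (1 / w + of_real t * H w))"
      using denom(1)[OF w] unfolding Re_one_div[of "1 / w + of_real t * H w"] norm_divide norm_one power_divide
      by (simp add: divide_right_mono del: plus_complex.sel)
  qed
qed

text \<open>For t > 0 the integrand is the inverse of 1/(t w) + H w, whose real part is at least Re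
  (H w); for t = 0 it is 0, a boundary point of the disc.\<close>

lemma eL_disc: assumes w: "w \<in> RHP" shows "Re (H w) * (cmod (eL w))\<^sup>2 \<le> Re (eL w)"
  unfolding eL_def
proof (rule disc_integral[OF prob_space_axioms kernel_measurable(2) kernel_bound_AE(2)[OF w]])
  show "0 \<le> Re (H w)" using H(2)[OF w] by simp
  show "AE t in M. Re (H w) * (cmod (of_real t / (1 / w + of_real t * H w)))\<^sup>2 \<le> Re (of_real t / (1 / w + of_real t * H w))"
    using probRp_D(4)[OF M]
  proof eventually_elim
    fix t :: real assume t: "0 \<le> t"
    define d where "d = 1 / w + of_real t * H w"
    have "Re (of_real t / d) = Re (of_real t * (1 / d))" by simp
    also have "\<dots> = t * Re (1 / d)" by (simp only: Re_complex_of_real Im_complex_of_real times_complex.sel)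
    also have "\<dots> = t * Re d / (cmod d)\<^sup>2" by (simp only: Re_one_div times_divide_eq_right)
    finally have e: "Re (of_real t / d) = t * Re d / (cmod d)\<^sup>2" .
    have "t * (t * Re (H w)) \<le> t * Re d" using denom(2)[OF w t] t unfolding d_def by (rule mult_left_mono)
    then have "t * (t * Re (H w)) / (cmod d)\<^sup>2 \<le> t * Re d / (cmod d)\<^sup>2" by (rule divide_right_mono) simp
    moreover have "Re (H w) * (cmod (of_real t / d))\<^sup>2 = t * (t * Re (H w)) / (cmod d)\<^sup>2"
      by (simp add: norm_divide power_divide power2_eq_square)
    ultimately show "Re (H w) * (cmod (of_real t / (1 / w + of_real t * H w)))\<^sup>2 \<le> Re (of_real t / (1 / w + of_real t * H w))"
      unfolding d_def[symmetric] e by simp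
  qed
qed

lemma eK_eL: assumes w: "w \<in> RHP" shows "eK w = w * (1 - H w * eL w)"
proof -
  have w0: "w \<noteq> 0" using w by auto
  have i: "integrable M (\<lambda>t. of_real t / (1 / w + of_real t * H w))"
    by (rule integrable_const_bound[OF kernel_bound_AE(2)[OF w] kernel_measurable(2)])
  have "eK w = (LINT t|M. w - (w * H w) * (of_real t / (1 / w + of_real t * H w)))"
    unfolding eK_def
  proof (rule integral_cong_AE[OF kernel_measurable(1)])
    show "(\<lambda>t. w - (w * H w) * (of_real t / (1 / w + of_real t * H w))) \<in> borel_measurable M"
      by (intro borel_measurable_diff borel_measurable_times borel_measurable_const kernel_measurable(2))
    show "AE t in M. 1 / (1 / w + of_real t * H w) = w - (w * H w) * (of_real t / (1 / w + of_real t * H w))"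
      using probRp_D(4)[OF M]
    proof eventually_elim
      fix t :: real assume t: "0 \<le> t"
      define d where "d = 1 / w + of_real t * H w"
      have d0: "d \<noteq> 0" using denom(4)[OF w t] by (simp add: d_def)
      have "w * d = 1 + w * H w * of_real t" using w0 by (simp add: d_def field_simps)
      then have "1 / d = (w * d - w * H w * of_real t) / d" by simp
      also have "\<dots> = w - (w * H w) * (of_real t / d)" using d0 by (simp add: diff_divide_distrib)
      finally show "1 / (1 / w + of_real t * H w) = w - (w * H w) * (of_real t / (1 / w + of_real t * H w))"
        by (simp only: d_def)
    qed
  qed
  also have "\<dots> = w - (w * H w) * eL w"
    unfolding eL_def
    by (subst Bochner_Integration.integral_diff[OF _ integrable_mult_right[OF i]])
       (simp_all only: integral_mult_right_zero integrable_const, simp add: prob_space)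
  finally show ?thesis by (simp add: algebra_simps)
qed

lemma eK_real: assumes x: "0 < x" shows "eK (of_real x) = of_real (x * SR M (u (x\<^sup>2)))"
proof -
  have "eK (of_real x) = (LINT t|M. of_real x * of_real (1 / (1 + u (x\<^sup>2) * t)))"
    unfolding eK_def r[OF x]
  proof (intro Bochner_Integration.integral_cong refl)
    fix t
    have "1 / (1 / x + t * (u (x\<^sup>2) / x)) = x * (1 / (1 + u (x\<^sup>2) * t))" using x by (simp add: field_simps)
    then have "complex_of_real (1 / (1 / x + t * (u (x\<^sup>2) / x))) = of_real (x * (1 / (1 + u (x\<^sup>2) * t)))" by (simp only:)
    then show "1 / (1 / complex_of_real x + of_real t * of_real (u (x\<^sup>2) / x)) = of_real x * of_real (1 / (1 + u (x\<^sup>2) * t))"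
      by simp
  qed
  also have "\<dots> = of_real x * of_real (SR M (u (x\<^sup>2)))"
    by (simp only: integral_mult_right_zero integral_complex_of_real SR_def)
  finally show ?thesis by simp
qed

lemma eK_ne_0: assumes w: "w \<in> RHP" shows "eK w \<noteq> 0"
proof -
  have re: "0 \<le> Re (eK \<zeta>)" if "\<zeta> \<in> RHP" for \<zeta>
    by (rule order_trans[OF _ eK_disc[OF that]]) (use Re_one_div_pos[of \<zeta>] that in auto)
  have "0 < SR M (u 1)" using SR_pos[OF M] upos[of 1] by simp
  then have "0 < Re (eK 1)" using eK_real[of 1] by simp
  then have "0 < Re (eK w)" using Re_pos_RHP[OF eK_holomorphic re _ w] by blast
  then show ?thesis by auto
qed

text \<open>Since f = 1/SR - 1, the function 1/\<open>eK\<close> - 1/w continues f(u(x^2))/x; its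
  real part is nonnegative by \<open>eK_disc\<close>.\<close>

lemma CBF_fR_comp': "CBF (\<lambda>y. fR M (u y))"
proof (rule CBF_I[where H="\<lambda>w. 1 / eK w - 1 / w"])
  show "0 < fR M (u y)" if "0 < y" for y using fR_pos[OF M M0 upos[OF that]] .
  show "(\<lambda>w. 1 / eK w - 1 / w) holomorphic_on RHP"
    by (intro holomorphic_intros eK_holomorphic eK_ne_0) auto
  show "0 \<le> Re (1 / eK w - 1 / w)" if w: "w \<in> RHP" for w
  proof -
    have "0 < (cmod (eK w))\<^sup>2" using eK_ne_0[OF w] by simp
    then have "Re (1 / w) \<le> Re (1 / eK w)"
      unfolding Re_one_div[of "eK w"] using eK_disc[OF w] by (simp only: pos_le_divide_eq)
    then show ?thesis by (simp only: minus_complex.sel)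
  qed
  show "1 / eK (of_real x) - 1 / of_real x = of_real (fR M (u (x\<^sup>2)) / x)" if x: "0 < x" for x
  proof -
    have s: "0 < SR M (u (x\<^sup>2))" "0 < u (x\<^sup>2)" using SR_pos[OF M] upos[of "x\<^sup>2"] x by auto
    have "fR M (u (x\<^sup>2)) = 1 / SR M (u (x\<^sup>2)) - 1" using fR_SR[OF M, of "u (x\<^sup>2)"] s by simp
    then have "1 / (x * SR M (u (x\<^sup>2))) - 1 / x = fR M (u (x\<^sup>2)) / x"
      by (simp add: diff_divide_distrib mult.commute)
    then have "complex_of_real (1 / (x * SR M (u (x\<^sup>2))) - 1 / x) = of_real (fR M (u (x\<^sup>2)) / x)" by (simp only:)
    then show ?thesis unfolding eK_real[OF x] by simp
  qed
qed

text \<open>On the positive axis 1 - SR(u(x^2)) is u(x^2)/x times \<open>eL\<close>, which makes w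
  \<open>eL\<close>/\<open>eK\<close> the continuation. Where \<open>eL\<close> is nonzero the
  inverse of this function is 1/\<open>eL\<close> - H, with nonnegative real part by
  \<open>eL_disc\<close>; a zero of \<open>eL\<close> is harmless because only Re \<ge> 0 is
  asked.\<close>

lemma CBF_fR_quotient': "CBF (\<lambda>y. y * (fR M (u y) / u y))"
proof (rule CBF_I[where H="\<lambda>w. w * eL w / eK w"])
  show "0 < y * (fR M (u y) / u y)" if "0 < y" for y using fR_pos[OF M M0 upos[OF that]] upos[OF that] that by simp
  show "(\<lambda>w. w * eL w / eK w) holomorphic_on RHP"
    by (intro holomorphic_intros eK_holomorphic eL_holomorphic eK_ne_0)
  show "0 \<le> Re (w * eL w / eK w)" if w: "w \<in> RHP" for w
  proof (cases "eL w = 0")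
    case False
    define q where "q = eK w / (w * eL w)"
    have w0: "w \<noteq> 0" using w by auto
    have q: "q = 1 / eL w - H w" unfolding q_def eK_eL[OF w] using False w0 by (simp add: diff_divide_distrib)
    have "0 < (cmod (eL w))\<^sup>2" using False by simp
    then have "Re (H w) \<le> Re (1 / eL w)"
      unfolding Re_one_div[of "eL w"] using eL_disc[OF w] by (simp only: pos_le_divide_eq)
    then have "0 \<le> Re q" unfolding q by (simp only: minus_complex.sel)
    then have "0 \<le> Re (1 / q)" unfolding Re_one_div by simp
    then show ?thesis by (simp add: q_def)
  qed simp
  show "of_real x * eL (of_real x) / eK (of_real x) = of_real (x\<^sup>2 * (fR M (u (x\<^sup>2)) / u (x\<^sup>2)) / x)" if x: "0 < x" for x
  proof -
    define s where "s = SR M (u (x\<^sup>2))"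
    have s: "0 < s" "0 < u (x\<^sup>2)" using SR_pos[OF M] upos[of "x\<^sup>2"] x by (auto simp: s_def)
    have "complex_of_real (x * s) = of_real x * (1 - of_real (u (x\<^sup>2) / x) * eL (of_real x))"
      using eK_eL[of "of_real x"] x eK_real[OF x] r[OF x] by (simp add: s_def)
    then have "of_real s = 1 - of_real (u (x\<^sup>2) / x) * eL (of_real x)" using x by simp
    then have "of_real (u (x\<^sup>2) / x) * eL (of_real x) = of_real (1 - s)" by simp
    then have "of_real (x * (1 - s) / u (x\<^sup>2)) = eL (of_real x)" using s x by (simp add: field_simps)
    then have l: "eL (of_real x) = of_real (x * (1 - s) / u (x\<^sup>2))" by simp
    have f: "fR M (u (x\<^sup>2)) = 1 / s - 1" using fR_SR[OF M, of "u (x\<^sup>2)"] s by (simp add: s_def)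
    have "x * (x * (1 - s) / u (x\<^sup>2)) / (x * s) = x\<^sup>2 * (fR M (u (x\<^sup>2)) / u (x\<^sup>2)) / x"
      unfolding f using s x by (simp add: field_simps power2_eq_square)
    then have "complex_of_real (x * (x * (1 - s) / u (x\<^sup>2)) / (x * s)) = of_real (x\<^sup>2 * (fR M (u (x\<^sup>2)) / u (x\<^sup>2)) / x)"
      by (simp only:)
    then show ?thesis unfolding l eK_real[OF x] s_def[symmetric] by (simp only: of_real_mult of_real_divide)
  qed
qed

end

lemma CBF_fR:
  assumes "M \<in> probRp" "M \<noteq> deltaR0" "CBF u"
  shows "CBF (\<lambda>y. fR M (u y))" "CBF (\<lambda>y. y * (fR M (u y) / u y))"
proof -
  obtain H where H: "H holomorphic_on RHP" "\<And>w. w \<in> RHP \<Longrightarrow> 0 < Re (H w)"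
    "\<And>x. 0 < x \<Longrightarrow> H (of_real x) = of_real (u (x\<^sup>2) / x)" and u: "\<And>y. 0 < y \<Longrightarrow> 0 < u y"
    using assms(3) unfolding CBF_def by metis
  show "CBF (\<lambda>y. fR M (u y))" by (rule CBF_fR_comp'[OF assms(1,2) H(1,2) u H(3)])
  show "CBF (\<lambda>y. y * (fR M (u y) / u y))" by (rule CBF_fR_quotient'[OF assms(1,2) H(1,2) u H(3)])
qed

lemma Re_Cayley: "Re ((1 + z) / (1 - z)) = (1 - (cmod z)\<^sup>2) / (cmod (1 - z))\<^sup>2"
  unfolding Re_divide cmod_power2 by (simp add: power2_eq_square algebra_simps)

lemma cmod_Cayley_less_1:
  assumes "0 < Re h"
  shows "cmod ((h - 1) / (h + 1)) < 1" "h + 1 \<noteq> 0"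
proof -
  show h: "h + 1 \<noteq> 0" using assms by (auto simp: complex_eq_iff)
  have "(cmod (h - 1))\<^sup>2 < (cmod (h + 1))\<^sup>2"
    unfolding cmod_power2 using assms by (simp add: power2_eq_square algebra_simps)
  then have "cmod (h - 1) < cmod (h + 1)" by (rule power2_less_imp_less) simp
  then show "cmod ((h - 1) / (h + 1)) < 1" using h by (simp add: norm_divide)
qed

text \<open>The Cayley transform makes the continuations uniformly bounded, so Montel's theorem
  applies, and the pointwise limits on the positive axis identify the limit function there. The
  maximum principle keeps it in the open disc, so that it can be transformed back.\<close>

lemma CBF_limit:
  assumes C: "\<And>n. CBF (f n)" and lim: "\<And>y. 0 < y \<Longrightarrow> (\<lambda>n. f n y) \<longlonglongrightarrow> u y" and u: "\<And>y. 0 < y \<Longrightarrow> 0 < u y"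
  shows "CBF u"
proof -
  have "\<exists>H. \<forall>n. H n holomorphic_on RHP \<and> (\<forall>w\<in>RHP. 0 < Re (H n w)) \<and>
     (\<forall>x>0. H n (of_real x) = of_real (f n (x\<^sup>2) / x))"
    using C unfolding CBF_def by (intro choice allI) blast
  then obtain H where H: "\<And>n. H n holomorphic_on RHP" "\<And>n w. w \<in> RHP \<Longrightarrow> 0 < Re (H n w)"
    "\<And>n x. 0 < x \<Longrightarrow> H n (of_real x) = of_real (f n (x\<^sup>2) / x)" by blast
  define E where "E n w = (H n w - 1) / (H n w + 1)" for n w
  have hE: "E n holomorphic_on RHP" for n
    unfolding E_def[abs_def] by (intro holomorphic_intros H(1) cmod_Cayley_less_1(2) H(2))
  have bE: "cmod (E n w) \<le> 1" if "w \<in> RHP" for n w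
    unfolding E_def using cmod_Cayley_less_1(1)[OF H(2)[OF that]] by (rule less_imp_le)
  obtain g k where g: "g holomorphic_on RHP" "strict_mono (k :: nat \<Rightarrow> nat)"
      "\<And>w. w \<in> RHP \<Longrightarrow> (\<lambda>n. E (k n) w) \<longlonglongrightarrow> g w"
  proof (rule Montel[of RHP "range E" E])
    show "open RHP" by (rule open_RHP)
    show "h holomorphic_on RHP" if "h \<in> range E" for h using that hE by auto
    show "\<exists>B. \<forall>h\<in>range E. \<forall>z\<in>K. cmod (h z) \<le> B" if "K \<subseteq> RHP" for K
      using that bE by (intro exI[of _ 1]) blast
  qed auto
  have bg: "cmod (g w) \<le> 1" if "w \<in> RHP" for w
    by (rule LIMSEQ_le_const2[OF tendsto_norm[OF g(3)[OF that]]]) (use bE that in auto)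
  have g_real: "g (of_real x) = of_real ((u (x\<^sup>2) / x - 1) / (u (x\<^sup>2) / x + 1))" if x: "0 < x" for x
  proof -
    have p: "u (x\<^sup>2) / x + 1 \<noteq> 0" using u[of "x\<^sup>2"] x by (smt (verit) divide_pos_pos zero_less_power)
    have "(\<lambda>n. f (k n) (x\<^sup>2)) \<longlonglongrightarrow> u (x\<^sup>2)"
      using LIMSEQ_subseq_LIMSEQ[OF lim[of "x\<^sup>2"] g(2)] x by (simp add: o_def)
    then have "(\<lambda>n. (f (k n) (x\<^sup>2) / x - 1) / (f (k n) (x\<^sup>2) / x + 1)) \<longlonglongrightarrow> (u (x\<^sup>2) / x - 1) / (u (x\<^sup>2) / x + 1)"
      using p by (intro tendsto_intros) (use x in auto)
    then have "(\<lambda>n. complex_of_real ((f (k n) (x\<^sup>2) / x - 1) / (f (k n) (x\<^sup>2) / x + 1))) \<longlonglongrightarrow>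
        of_real ((u (x\<^sup>2) / x - 1) / (u (x\<^sup>2) / x + 1))" by (rule tendsto_of_real)
    moreover have "E (k n) (of_real x) = of_real ((f (k n) (x\<^sup>2) / x - 1) / (f (k n) (x\<^sup>2) / x + 1))" for n
      unfolding E_def H(3)[OF x] by simp
    ultimately have "(\<lambda>n. E (k n) (of_real x)) \<longlonglongrightarrow> of_real ((u (x\<^sup>2) / x - 1) / (u (x\<^sup>2) / x + 1))" by (simp only:)
    then show ?thesis using g(3)[of "of_real x"] x LIMSEQ_unique by auto
  qed
  have g1: "cmod (g w) < 1" if w: "w \<in> RHP" for w
  proof (rule ccontr)
    assume "\<not> cmod (g w) < 1"
    then have e: "cmod (g w) = 1" using bg[OF w] by simp
    have "g constant_on RHP"
      by (rule maximum_modulus_principle[OF g(1) open_RHP connected_RHP open_RHP order_refl w]) (use bg e in auto)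
    then have "g w = g 1" using w by (auto simp: constant_on_def)
    moreover have "cmod (g 1) < 1"
    proof -
      have "g 1 = of_real ((u 1 - 1) / (u 1 + 1))" using g_real[of 1] by simp
      then have "cmod (g 1) = \<bar>(u 1 - 1) / (u 1 + 1)\<bar>" by (simp only: norm_of_real)
      also have "\<dots> < 1" using u[of 1] by (simp add: abs_less_iff field_simps)
      finally show ?thesis .
    qed
    ultimately show False using e by simp
  qed
  show ?thesis
  proof (rule CBF_I[OF u, where H="\<lambda>w. (1 + g w) / (1 - g w)"])
    show "(\<lambda>w. (1 + g w) / (1 - g w)) holomorphic_on RHP"
      by (intro holomorphic_intros g(1)) (use g1 in fastforce)
    show "0 \<le> Re ((1 + g w) / (1 - g w))" if "w \<in> RHP" for w
    proof -
      have "(cmod (g w))\<^sup>2 \<le> 1" using bg[OF that] by (simp add: power_le_one)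
      then show ?thesis unfolding Re_Cayley by simp
    qed
    show "(1 + g (of_real x)) / (1 - g (of_real x)) = of_real (u (x\<^sup>2) / x)" if x: "0 < x" for x
    proof -
      define h where "h = u (x\<^sup>2) / x"
      have h: "0 < h" using u[of "x\<^sup>2"] x by (simp add: h_def)
      have "(1 + (h - 1) / (h + 1)) / (1 - (h - 1) / (h + 1)) = h" using h by (simp add: divide_simps)
      then have "complex_of_real ((1 + (h - 1) / (h + 1)) / (1 - (h - 1) / (h + 1))) = of_real h" by (simp only:)
      then show ?thesis unfolding g_real[OF x] h_def[symmetric] by (simp only: of_real_1 of_real_add of_real_diff of_real_divide)
    qed
  qed
qed

section \<open>From complete Bernstein functions to measures\<close>

text \<open>The Poisson kernel of the disc at the real point z = (1 - w)/(1 + w). For Re x < 1,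
  dividing the denominator by 1 - Re x leaves 1 + t w^2 with t = (1 + Re x)/(1 - Re x), the kernel
  of \<open>SR\<close>.\<close>

lemma poisson_kernel_RHP:
  assumes x: "cmod x = 1" and w: "0 < w"
  shows "0 < (1 - Re x) + (1 + Re x) * w\<^sup>2"
    and "2 * Re (1 / (1 - of_real ((1 - w) / (1 + w)) * x)) - 1 = 2 * w / ((1 - Re x) + (1 + Re x) * w\<^sup>2)"
proof -
  define a D z where "a = Re x" and "D = (1 - Re x) + (1 + Re x) * w\<^sup>2" and "z = (1 - w) / (1 + w)"
  have a: "-1 \<le> a" "a \<le> 1" using abs_Re_le_cmod[of x] x by (auto simp: a_def)
  show D: "0 < (1 - Re x) + (1 + Re x) * w\<^sup>2"
  proof (cases "a = 1")
    case False
    have "0 \<le> (1 + a) * w\<^sup>2" using a by simp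
    moreover have "0 < 1 - a" using False a by simp
    ultimately show ?thesis unfolding a_def by linarith
  qed (use w in \<open>simp add: a_def\<close>)
  have zw: "z * (1 + w) = 1 - w" using w by (simp add: z_def)
  have n: "(cmod (1 - of_real z * x))\<^sup>2 = 1 - 2 * z * a + z\<^sup>2"
  proof -
    have "(Re x)\<^sup>2 + (Im x)\<^sup>2 = 1" using x by (simp add: cmod_power2[symmetric])
    moreover have "(cmod (1 - of_real z * x))\<^sup>2 = (1 - z * Re x)\<^sup>2 + (z * Im x)\<^sup>2" by (simp add: cmod_power2)
    ultimately show ?thesis unfolding a_def by algebra
  qed
  have n2: "(1 - 2 * z * a + z\<^sup>2) * (1 + w)\<^sup>2 = 2 * D" unfolding D_def a_def[symmetric] using zw by algebra
  have m2: "(1 - z\<^sup>2) * (1 + w)\<^sup>2 = 4 * w" using zw by algebra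
  have N: "0 < 1 - 2 * z * a + z\<^sup>2" using n2 D w unfolding D_def[symmetric]
    by (metis add_pos_pos mult_pos_pos zero_less_mult_pos2 zero_less_numeral zero_less_one zero_less_power)
  have "2 * Re (1 / (1 - of_real z * x)) - 1 = 2 * ((1 - z * a) / (1 - 2 * z * a + z\<^sup>2)) - 1"
    unfolding Re_one_div n by (simp add: a_def)
  also have "\<dots> = (1 - z\<^sup>2) / (1 - 2 * z * a + z\<^sup>2)" using N by (simp add: divide_simps)
  also have "\<dots> = ((1 - z\<^sup>2) * (1 + w)\<^sup>2) / ((1 - 2 * z * a + z\<^sup>2) * (1 + w)\<^sup>2)" using w by simp
  also have "\<dots> = 2 * w / D" unfolding n2 m2 by simp
  finally show "2 * Re (1 / (1 - of_real ((1 - w) / (1 + w)) * x)) - 1 = 2 * w / ((1 - Re x) + (1 + Re x) * w\<^sup>2)"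
    by (simp only: D_def z_def)
qed

text \<open>1 / (1/w + H w) has positive real part and equals x / (1 + u(x^2)) on the positive axis,
  which is x times the desired SR at x^2. Carried to the disc by the Cayley map it has a Herglotz
  measure.\<close>

lemma CBF_poisson:
  assumes "CBF u"
  shows "\<exists>N\<in>probT. \<forall>y>0. integrable N (\<lambda>x. 2 / (1 + u 1) / ((1 - Re x) + (1 + Re x) * y)) \<and>
     (LINT x|N. 2 / (1 + u 1) / ((1 - Re x) + (1 + Re x) * y)) = 1 / (1 + u y)"
proof -
  obtain H where H: "H holomorphic_on RHP" "\<And>w. w \<in> RHP \<Longrightarrow> 0 < Re (H w)"
    "\<And>x. 0 < x \<Longrightarrow> H (of_real x) = of_real (u (x\<^sup>2) / x)" and u: "\<And>y. 0 < y \<Longrightarrow> 0 < u y"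
    using assms unfolding CBF_def by metis
  define G where "G w = 1 / (1 / w + H w)" for w
  have den: "0 < Re (1 / w + H w)" if "w \<in> RHP" for w
    using H(2)[OF that] Re_one_div_pos[of w] that by simp
  have hG: "G holomorphic_on RHP"
  proof -
    have "1 / w + H w \<noteq> 0" if "w \<in> RHP" for w using den[OF that] by (metis less_irrefl zero_complex.sel(1))
    then show ?thesis unfolding G_def[abs_def] by (intro holomorphic_intros H(1)) auto
  qed
  have G0: "0 < Re (G w)" if "w \<in> RHP" for w unfolding G_def by (rule Re_one_div_pos[OF den[OF that]])
  have Gr: "G (of_real x) = of_real (x / (1 + u (x\<^sup>2)))" if x: "0 < x" for x
  proof -
    have "1 / (1 / x + u (x\<^sup>2) / x) = x / (1 + u (x\<^sup>2))" using x by (simp add: add_divide_distrib[symmetric])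
    then have "complex_of_real (1 / (1 / x + u (x\<^sup>2) / x)) = of_real (x / (1 + u (x\<^sup>2)))" by (simp only:)
    then show ?thesis unfolding G_def H(3)[OF x] by simp
  qed
  define c where "c = 1 / (1 + u 1)"
  have c: "0 < c" using u[of 1] by (simp add: c_def)
  define \<kappa> where "\<kappa> z = (1 - z) / (1 + z)" for z :: complex
  have z1: "1 + z \<noteq> 0" if "cmod z < 1" for z using that by (metis add.inverse_inverse add_eq_0_iff norm_minus_cancel norm_one order_less_irrefl)
  have \<kappa>: "\<kappa> z \<in> RHP" if "cmod z < 1" for z
  proof -
    have "0 < (cmod (1 + z))\<^sup>2" using z1[OF that] by simp
    moreover have "(cmod z)\<^sup>2 < 1" using that by (simp add: power_less_one_iff abs_square_less_1)
    ultimately have "0 < (1 - (cmod (-z))\<^sup>2) / (cmod (1 - (-z)))\<^sup>2" by simp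
    then show ?thesis using Re_Cayley[of "-z"] by (simp add: \<kappa>_def)
  qed
  have h\<kappa>: "\<kappa> holomorphic_on ball 0 1" unfolding \<kappa>_def[abs_def] using z1 by (intro holomorphic_intros) auto
  \<comment> \<open>Dividing by c, the value at the centre w = 1, and averaging with 1 turns Re > 0
    into Re \<ge> 1/2 and gives \<open>g 0 = 1\<close>.\<close>
  define g where "g z = (1 + G (\<kappa> z) / of_real c) / 2" for z
  have "\<exists>N\<in>probT. \<forall>z. norm z < 1 \<longrightarrow> (LINT x|N. 1 / (1 - z * x)) = g z"
  proof (rule herglotz)
    have "(G \<circ> \<kappa>) holomorphic_on ball 0 1"
      by (rule holomorphic_on_compose_gen[OF h\<kappa> hG]) (use \<kappa> in auto)
    then show "g holomorphic_on ball 0 1" unfolding g_def[abs_def]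
      by (intro holomorphic_intros) (use c in \<open>auto simp: o_def\<close>)
    have "G 1 = of_real c" using Gr[of 1] by (simp add: c_def)
    then show "g 0 = 1" using c by (simp add: g_def \<kappa>_def)
    show "1/2 \<le> Re (g z)" if "cmod z < 1" for z
      using G0[OF \<kappa>[OF that]] c by (simp add: g_def)
  qed
  then obtain N where N: "N \<in> probT" "\<And>z. cmod z < 1 \<Longrightarrow> (LINT x|N. 1 / (1 - z * x)) = g z" by blast
  interpret N: prob_space N by (rule probT_D[OF N(1)])
  note [measurable_cong] = probT_D(2)[OF N(1)]
  have "integrable N (\<lambda>x. 2 * c / ((1 - Re x) + (1 + Re x) * y)) \<and>
     (LINT x|N. 2 * c / ((1 - Re x) + (1 + Re x) * y)) = 1 / (1 + u y)" if y: "0 < y" for y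
  proof -
    define w where "w = sqrt y"
    have w: "0 < w" "w\<^sup>2 = y" using y by (auto simp: w_def)
    define z where "z = complex_of_real ((1 - w) / (1 + w))"
    have "\<bar>(1 - w) / (1 + w)\<bar> < 1" using w by (simp add: abs_less_iff field_simps)
    then have z: "cmod z < 1" unfolding z_def norm_of_real .
    have "\<kappa> z = of_real w"
    proof -
      have "(1 - (1 - w) / (1 + w)) / (1 + (1 - w) / (1 + w)) = w" using w by (simp add: divide_simps)
      then have "complex_of_real ((1 - (1 - w) / (1 + w)) / (1 + (1 - w) / (1 + w))) = of_real w" by (simp only:)
      then show ?thesis unfolding \<kappa>_def z_def by (simp only: of_real_1 of_real_add of_real_diff of_real_divide)
    qed
    then have "g z = of_real ((1 + w / (1 + u y) / c) / 2)" using Gr[OF w(1)] w(2) by (simp add: g_def)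
    then have "Re (g z) = (1 + w / (1 + u y) / c) / 2" by (simp only: Re_complex_of_real)
    then have gz: "2 * Re (g z) - 1 = w / (1 + u y) / c" by simp
    define q where "q x = 2 * Re (1 / (1 - z * x)) - 1" for x
    have iq: "integrable N q" unfolding q_def[abs_def]
      using integrable_Re[OF integrable_probT(1)[OF N(1) z]]
      by (intro Bochner_Integration.integrable_diff integrable_mult_right) auto
    have "(LINT x|N. q x) = 2 * Re (g z) - 1"
      unfolding q_def using integrable_Re[OF integrable_probT(1)[OF N(1) z]] integral_Re[OF integrable_probT(1)[OF N(1) z]] N(2)[OF z]
      by (simp add: N.prob_space)
    then have lq: "(LINT x|N. c / w * q x) = 1 / (1 + u y)" using gz w c by simp
    have ae: "AE x in N. c / w * q x = 2 * c / ((1 - Re x) + (1 + Re x) * y)"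
      using probT_D(4)[OF N(1)]
    proof eventually_elim
      fix x :: complex assume x: "cmod x = 1"
      have "q x = 2 * w / ((1 - Re x) + (1 + Re x) * w\<^sup>2)" unfolding q_def z_def by (rule poisson_kernel_RHP(2)[OF x w(1)])
      then show "c / w * q x = 2 * c / ((1 - Re x) + (1 + Re x) * y)" using w by simp
    qed
    have m: "(\<lambda>x. 2 * c / ((1 - Re x) + (1 + Re x) * y)) \<in> borel_measurable N" by measurable
    have i: "integrable N (\<lambda>x. c / w * q x)" using iq by (rule integrable_mult_right)
    show ?thesis using integrable_cong_AE_imp[OF i m] integral_cong_AE[OF _ m ae] i ae lq
      by (auto elim: eventually_mono)
  qed
  then show ?thesis using N(1) by (intro bexI[of _ N]) (simp_all add: c_def)
qed

lemma SR_deltaR0: "SR deltaR0 y = 1"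
  unfolding SR_def deltaR0_def by (subst integral_return) auto

lemma fR_deltaR0: "0 \<le> y \<Longrightarrow> fR deltaR0 y = 0"
  using fR_SR[OF deltaR0_probRp] by (simp add: SR_deltaR0)

text \<open>For Re x < 1 the kernel factors as k y x = k 0 x / (1 + y T x) with T = (1 + Re x)/(1 -
  Re x), so the measure is the image under T of N with density k 0. It remains to see that N does
  not charge Re x = 1, where T would be infinite, and that k 0 has integral 1; the latter is where u
  tending to 0 enters.\<close>

theorem CBF_measure:
  assumes C: "CBF u" and lim: "(\<lambda>n. u (1 / real (Suc n))) \<longlonglongrightarrow> 0"
  shows "\<exists>M\<in>probRp. M \<noteq> deltaR0 \<and> (\<forall>y>0. fR M y = u y)"
proof -
  have u: "\<And>y. 0 < y \<Longrightarrow> 0 < u y" using C by (simp add: CBF_def)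
  define c where "c = 1 / (1 + u 1)"
  have c: "0 < c" using u[of 1] by (simp add: c_def)
  define k where "k y x = 2 * c / ((1 - Re x) + (1 + Re x) * y)" for y and x :: complex
  obtain N where N: "N \<in> probT" "\<And>y. 0 < y \<Longrightarrow> integrable N (k y)" "\<And>y. 0 < y \<Longrightarrow> (LINT x|N. k y x) = 1 / (1 + u y)"
    using CBF_poisson[OF C] unfolding k_def[abs_def] c_def by auto
  interpret N: prob_space N by (rule probT_D[OF N(1)])
  note [measurable_cong] = probT_D(2)[OF N(1)]
  have mk: "k y \<in> borel_measurable N" for y unfolding k_def[abs_def] by measurable
  have Re1: "AE x in N. -1 \<le> Re x \<and> Re x \<le> 1"
    using probT_D(4)[OF N(1)]
  proof eventually_elim
    fix x :: complex assume "cmod x = 1"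
    then show "-1 \<le> Re x \<and> Re x \<le> 1" using abs_Re_le_cmod[of x] by auto
  qed
  have D: "0 < (1 - a) + (1 + a) * y" if "-1 \<le> a" "a \<le> 1" "0 < y" for a y :: real
  proof (cases "a = 1")
    case False
    have "0 \<le> (1 + a) * y" using that by simp
    moreover have "0 < 1 - a" using False that by simp
    ultimately show ?thesis by linarith
  qed (use that in simp)
  define A where "A = {x::complex. Re x = 1}"
  have A: "A \<in> sets N" using probT_D(2)[OF N(1)] by (simp add: A_def)
  \<comment> \<open>On \<open>A\<close> the kernel equals c / y, unbounded as y tends to 0, while
    its integral over N stays below 1.\<close>
  have "measure N A * (c / y) \<le> 1" if y: "0 < y" for y
  proof -
    have "measure N A * (c / y) = (LINT x|N. (c / y) * indicator A x)" using A by simp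
    also have "\<dots> \<le> (LINT x|N. k y x)"
    proof (rule integral_mono_AE)
      show "integrable N (\<lambda>x. (c / y) * indicator A x :: real)"
        using A by (intro integrable_mult_right) (simp add: N.emeasure_eq_measure)
      show "AE x in N. c / y * indicator A x \<le> k y x" using Re1
      proof eventually_elim
        fix x assume "-1 \<le> Re x \<and> Re x \<le> 1"
        then have "0 < (1 - Re x) + (1 + Re x) * y" using D y by blast
        then show "c / y * indicator A x \<le> k y x" using c by (auto simp: indicator_def A_def k_def)
      qed
    qed (rule N(2)[OF y])
    also have "\<dots> \<le> 1" using N(3)[OF y] u[OF y] by simp
    finally show ?thesis .
  qed
  note PA = this
  have "measure N A = 0"
  proof (rule ccontr)
    assume "measure N A \<noteq> 0"
    then have p: "0 < measure N A" by (simp add: zero_less_measure_iff)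
    \<comment> \<open>With y chosen as this number the left side of the bound \<open>PA\<close>
      would be 2.\<close>
    have "0 < measure N A * c / 2" using p c by simp
    from PA[OF this] show False using p c by simp
  qed
  then have "AE x in N. x \<notin> A" using A by (simp add: N.emeasure_eq_measure AE_iff_null_sets[symmetric] null_sets_def AE_not_in)
  then have Re1: "AE x in N. -1 \<le> Re x \<and> Re x < 1" using Re1
    by eventually_elim (auto simp: A_def)
  \<comment> \<open>The kernels increase as y decreases to 0, so monotone convergence carries
    integrability and the limit 1 of 1 / (1 + u y) over to y = 0.\<close>
  have Z: "integrable N (k 0)" "(LINT x|N. k 0 x) = 1"
  proof -
    define y where "y n = 1 / real (Suc n)" for n
    have y: "0 < y n" for n by (simp add: y_def)
    have yl: "y \<longlonglongrightarrow> 0" unfolding y_def by real_asymp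
    have 1: "AE x in N. mono (\<lambda>n. k (y n) x)" using Re1
    proof eventually_elim
      fix x assume x: "-1 \<le> Re x \<and> Re x < 1"
      show "mono (\<lambda>n. k (y n) x)"
      proof (rule monoI)
        fix n m :: nat assume "n \<le> m"
        then have "y m \<le> y n" unfolding y_def by (intro divide_left_mono) auto
        then have "(1 + Re x) * y m \<le> (1 + Re x) * y n" using x by (intro mult_left_mono) auto
        then show "k (y n) x \<le> k (y m) x"
          unfolding k_def using D[of "Re x" "y n"] D[of "Re x" "y m"] x y c by (intro divide_left_mono mult_pos_pos) auto
      qed
    qed
    have 2: "AE x in N. 0 \<le> k (y n) x" for n using Re1
      by eventually_elim (use D y c in \<open>auto simp: k_def intro!: divide_nonneg_nonneg less_imp_le\<close>)
    have 3: "AE x in N. (\<lambda>n. k (y n) x) \<longlonglongrightarrow> k 0 x" using Re1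
      by eventually_elim (auto simp: k_def intro!: tendsto_eq_intros yl)
    have "(\<lambda>n. 1 / (1 + u (y n))) \<longlonglongrightarrow> 1 / (1 + 0)"
      using lim by (intro tendsto_intros) (auto simp: y_def)
    then have 4: "(\<lambda>n. LINT x|N. k (y n) x) \<longlonglongrightarrow> 1" using N(3)[OF y] by simp
    show "integrable N (k 0)" "(LINT x|N. k 0 x) = 1"
      by (rule integral_monotone_convergence_nonneg[OF N(2)[OF y] 1 2 3 4 mk])+
  qed
  have k0: "AE x in N. 0 \<le> k 0 x" using Re1 by eventually_elim (use c in \<open>auto simp: k_def\<close>)
  define T where "T x = (1 + Re x) / (1 - Re x)" for x :: complex
  have mT: "T \<in> borel_measurable borel" unfolding T_def[abs_def] by measurable
  define K where "K = density N (\<lambda>x. ennreal (k 0 x))"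
  have mTK: "T \<in> borel_measurable K" using mT by (simp add: K_def measurable_cong_sets[OF probT_D(2)[OF N(1)] refl])
  have "prob_space K"
  proof (rule prob_spaceI)
    have "emeasure K (space K) = (\<integral>\<^sup>+ x. ennreal (k 0 x) * indicator (space N) x \<partial>N)"
      unfolding K_def space_density using mk by (intro emeasure_density) auto
    also have "\<dots> = (\<integral>\<^sup>+ x. ennreal (k 0 x) \<partial>N)" by (intro nn_integral_cong) auto
    also have "\<dots> = ennreal (LINT x|N. k 0 x)" by (rule nn_integral_eq_integral[OF Z(1) k0])
    finally show "emeasure K (space K) = 1" using Z(2) by simp
  qed
  define M where "M = distr K borel T"
  have "AE x in K. 0 \<le> T x"
    unfolding K_def by (subst AE_density) (use mk Re1 in \<open>auto simp: T_def elim: eventually_mono\<close>)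
  then have M: "M \<in> probRp"
    unfolding probRp_def M_def using prob_space.prob_space_distr[OF \<open>prob_space K\<close> mTK] mTK
    by (simp add: AE_distr_iff)
  have "fR M y = u y" if y: "0 < y" for y
  proof -
    have "SR M y = (LINT x|K. 1 / (1 + y * T x))"
      unfolding SR_def M_def by (rule integral_distr[OF mTK]) measurable
    also have "\<dots> = (LINT x|N. k 0 x *\<^sub>R (1 / (1 + y * T x)))"
      unfolding K_def
    proof (rule integral_density)
      show "(\<lambda>x. 1 / (1 + y * T x)) \<in> borel_measurable N" unfolding T_def by measurable
    qed (use mk k0 in auto)
    also have "\<dots> = (LINT x|N. k y x)"
    proof (rule integral_cong_AE)
      show "(\<lambda>x. k 0 x *\<^sub>R (1 / (1 + y * T x))) \<in> borel_measurable N" using mk[of 0] unfolding T_def by measurable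
      show "AE x in N. k 0 x *\<^sub>R (1 / (1 + y * T x)) = k y x" using Re1
      proof eventually_elim
        fix x assume x: "-1 \<le> Re x \<and> Re x < 1"
        then have p: "0 < (1 - Re x) + (1 + Re x) * y" "0 < 1 - Re x" using D[of "Re x" y] y by auto
        have "1 + y * T x = ((1 - Re x) + (1 + Re x) * y) / (1 - Re x)" using p(2) by (simp add: T_def field_simps)
        then show "k 0 x *\<^sub>R (1 / (1 + y * T x)) = k y x" using p by (simp add: k_def)
      qed
    qed (rule mk)
    also have "\<dots> = 1 / (1 + u y)" by (rule N(3)[OF y])
    finally show ?thesis using fR_SR[OF M, of y] y by simp
  qed
  moreover have "M \<noteq> deltaR0"
  proof
    assume "M = deltaR0"
    then have "fR M 1 = 0" using fR_deltaR0[of 1] by simp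
    then show False using calculation[of 1] u[of 1] by simp
  qed
  ultimately show ?thesis using M by blast
qed

section \<open>Subordination on the half-line\<close>

text \<open>Equivalent, for positive values, to u = y f_mu(v)/v and v = y f_sigma(u)/u, the
  half-line form of \<open>subordT\<close>. With t = f_sigma(u) = f_mu(v) it reads (u/t)(v/t) = y/t,
  which is the multiplicativity of Sigma.\<close>

definition subordR :: "real measure \<Rightarrow> real measure \<Rightarrow> (real \<Rightarrow> real) \<Rightarrow> (real \<Rightarrow> real) \<Rightarrow> bool" where
  "subordR \<sigma> \<mu> u v \<longleftrightarrow> (\<forall>y>0. 0 < u y \<and> 0 < v y \<and> u y * v y = y * fR \<sigma> (u y) \<and> fR \<sigma> (u y) = fR \<mu> (v y))"

context
  fixes \<sigma> \<mu> :: "real measure"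
  assumes S: "\<sigma> \<in> probRp" "\<sigma> \<noteq> deltaR0" and M: "\<mu> \<in> probRp" "\<mu> \<noteq> deltaR0"
begin

text \<open>If a < a', then b = y f_sigma(a)/a is at least b', so f_mu(b) \<ge> f_mu(b'), while
  f_sigma(a) < f_sigma(a'); the two cannot both be equalities of pairs.\<close>

lemma subordR_pair_unique:
  assumes "0 < y" "0 < a" "0 < b" "a * b = y * fR \<sigma> a" "fR \<sigma> a = fR \<mu> b"
    and "0 < a'" "0 < b'" "a' * b' = y * fR \<sigma> a'" "fR \<sigma> a' = fR \<mu> b'"
  shows "a = a' \<and> b = b'"
proof -
  have *: "\<not> a < a'" if "0 < a" "0 < b" "a * b = y * fR \<sigma> a" "fR \<sigma> a = fR \<mu> b"
    "0 < a'" "0 < b'" "a' * b' = y * fR \<sigma> a'" "fR \<sigma> a' = fR \<mu> b'" for a b a' b'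
  proof
    assume l: "a < a'"
    have "fR \<sigma> a' / a' \<le> fR \<sigma> a / a" using fR_div_antimono[OF S(1) that(1)] l by simp
    then have "y * (fR \<sigma> a' / a') \<le> y * (fR \<sigma> a / a)" using assms(1) by (intro mult_left_mono) auto
    moreover have "b = y * (fR \<sigma> a / a)" "b' = y * (fR \<sigma> a' / a')" using that by (simp_all add: field_simps)
    ultimately have "b' \<le> b" by simp
    then have "fR \<mu> b' \<le> fR \<mu> b" using fR_mono[OF M(1)] that by simp
    moreover have "fR \<sigma> a < fR \<sigma> a'" by (rule fR_less[OF S]) (use l that in auto)
    ultimately show False using that(4,8) by linarith
  qed
  have "a = a'" using *[OF assms(2-9)] *[OF assms(6-9) assms(2-5)] by simp
  then show ?thesis using assms by (metis mult_left_cancel less_irrefl)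
qed

text \<open>Spelled out with nested quotients so that two applications of the quotient part of
  \<open>CBF_fR\<close> match it; \<open>Tm_vm\<close> gives the short form.\<close>

definition Tm :: "real \<Rightarrow> real \<Rightarrow> real" where
  "Tm y w = y * (fR \<mu> (y * (fR \<sigma> w / w)) / (y * (fR \<sigma> w / w)))"

definition vm :: "real \<Rightarrow> real \<Rightarrow> real" where "vm y w = y * (fR \<sigma> w / w)"

lemma vm_pos: "0 < y \<Longrightarrow> 0 < w \<Longrightarrow> 0 < vm y w"
  unfolding vm_def using fR_pos[OF S] by simp

lemma mult_vm: "0 < w \<Longrightarrow> w * vm y w = y * fR \<sigma> w"
  by (simp add: vm_def)

lemma vm_antimono: "0 < y \<Longrightarrow> 0 < w \<Longrightarrow> w \<le> w' \<Longrightarrow> vm y w' \<le> vm y w"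
  unfolding vm_def using fR_div_antimono[OF S(1)] by (intro mult_left_mono) auto

lemma Tm_vm: "Tm y w = y * (fR \<mu> (vm y w) / vm y w)" by (simp add: Tm_def vm_def)

lemma Tm_pos: "0 < y \<Longrightarrow> 0 < w \<Longrightarrow> 0 < Tm y w"
  unfolding Tm_vm using fR_pos[OF M vm_pos] vm_pos by simp

lemma Tm_mono: "0 < y \<Longrightarrow> 0 < w \<Longrightarrow> w \<le> w' \<Longrightarrow> Tm y w \<le> Tm y w'"
  unfolding Tm_vm using fR_div_antimono[OF M(1) vm_pos vm_antimono] by (intro mult_left_mono) auto

text \<open>Multiplication by \<open>vm y w\<close> turns the comparison of w with its image into
  that of f_sigma(w), increasing in w, with f_mu(vm y w), nonincreasing in w. This decides the
  direction of the iteration.\<close>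

lemma Tm_le_iff: assumes "0 < y" "0 < w" shows "w \<le> Tm y w \<longleftrightarrow> fR \<sigma> w \<le> fR \<mu> (vm y w)"
proof -
  have v: "0 < vm y w" "vm y w * w = y * fR \<sigma> w" using vm_pos assms by (auto simp: vm_def)
  have "w \<le> Tm y w \<longleftrightarrow> w * vm y w \<le> y * fR \<mu> (vm y w)" unfolding Tm_vm using v(1) by (simp add: field_simps)
  also have "\<dots> \<longleftrightarrow> y * fR \<sigma> w \<le> y * fR \<mu> (vm y w)" using v(2) by (simp add: mult.commute)
  also have "\<dots> \<longleftrightarrow> fR \<sigma> w \<le> fR \<mu> (vm y w)" using assms by simp
  finally show ?thesis .
qed

lemma fR_continuous_pos: "M \<in> probRp \<Longrightarrow> continuous_on {0<..} (fR M)"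
  by (rule continuous_on_subset[OF continuous_fR]) auto

lemma continuous_vm: "0 < y \<Longrightarrow> continuous_on {0<..} (vm y)"
  unfolding vm_def[abs_def] by (intro continuous_intros fR_continuous_pos[OF S(1)]) auto

lemma continuous_Tm: "0 < y \<Longrightarrow> continuous_on {0<..} (Tm y)"
proof -
  assume y: "0 < y"
  have "continuous_on {0<..} (\<lambda>w. fR \<mu> (vm y w))"
    by (rule continuous_on_compose2[OF fR_continuous_pos[OF M(1)] continuous_vm[OF y]]) (use vm_pos[OF y] in auto)
  moreover have nz: "vm y w \<noteq> 0" if "0 < w" for w using vm_pos[OF y that] by simp
  ultimately show ?thesis unfolding Tm_vm[abs_def]
    by (intro continuous_intros continuous_vm[OF y]) (use nz in auto)
qed

lemma Tm_small: assumes y: "0 < y" shows "\<exists>w>0. fR \<sigma> w \<le> fR \<mu> (vm y w)"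
proof -
  have "0 < fR \<mu> (vm y 1)" using fR_pos[OF M vm_pos[OF y]] by simp
  from fR_small[OF S(1) this] obtain d where d: "d > 0" "\<And>w. 0 \<le> w \<Longrightarrow> w < d \<Longrightarrow> fR \<sigma> w < fR \<mu> (vm y 1)" by blast
  define w where "w = min 1 (d / 2)"
  have w: "0 < w" "w \<le> 1" "w < d" using d by (auto simp: w_def)
  have "fR \<mu> (vm y 1) \<le> fR \<mu> (vm y w)" using fR_mono[OF M(1)] vm_antimono[OF y w(1,2)] vm_pos[OF y, of 1] by simp
  then show ?thesis using d(2)[of w] w by (intro exI[of _ w]) auto
qed

text \<open>Otherwise f_sigma(w) \<le> f_mu(vm y w) \<le> f_mu(vm y 1) is bounded, so vm y w = y
  f_sigma(w)/w is small for large w; but f_mu(vm y w) \<ge> f_sigma(1) keeps vm y w away from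
  0.\<close>

lemma Tm_large: assumes y: "0 < y" shows "\<exists>w0>0. \<forall>w\<ge>w0. fR \<mu> (vm y w) < fR \<sigma> w"
proof -
  define C where "C = fR \<sigma> 1"
  have "0 < C" using fR_pos[OF S] by (simp add: C_def)
  from fR_small[OF M(1) this] obtain d where d: "d > 0" "\<And>v. 0 \<le> v \<Longrightarrow> v < d \<Longrightarrow> fR \<mu> v < C" by blast
  \<comment> \<open>The summand 1 makes the final comparison strict.\<close>
  define w0 where "w0 = max 1 (y * (fR \<mu> (vm y 1) + 1) / d)"
  have "fR \<mu> (vm y w) < fR \<sigma> w" if w: "w0 \<le> w" for w
  proof (rule ccontr)
    assume n: "\<not> fR \<mu> (vm y w) < fR \<sigma> w"
    have w1: "1 \<le> w" "y * (fR \<mu> (vm y 1) + 1) / d \<le> w" using w by (auto simp: w0_def)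
    have "C \<le> fR \<sigma> w" using fR_mono[OF S(1)] w1 by (simp add: C_def)
    then have "C \<le> fR \<mu> (vm y w)" using n by simp
    then have "d \<le> vm y w" using d(2)[of "vm y w"] vm_pos[OF y, of w] w1 by force
    then have "d * w \<le> y * fR \<sigma> w" unfolding vm_def using w1 by (simp add: field_simps)
    moreover have "fR \<mu> (vm y w) \<le> fR \<mu> (vm y 1)" using fR_mono[OF M(1)] vm_antimono[OF y _ w1(1)] vm_pos[OF y, of w] w1 by simp
    ultimately have "d * w \<le> y * fR \<mu> (vm y 1)" using n y by (smt (verit) mult_left_mono)
    moreover have "y * (fR \<mu> (vm y 1) + 1) \<le> d * w" using w1(2) d(1) by (simp add: divide_le_eq mult.commute)
    ultimately show False using y by (simp add: algebra_simps)
  qed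
  then show ?thesis by (intro exI[of _ w0]) (auto simp: w0_def)
qed

lemma Tm_fixpoint: assumes y: "0 < y" shows "\<exists>w>0. fR \<sigma> w = fR \<mu> (vm y w)"
proof -
  obtain a where a: "0 < a" "fR \<sigma> a \<le> fR \<mu> (vm y a)" using Tm_small[OF y] by blast
  obtain b0 where b0: "b0 > 0" "\<And>w. b0 \<le> w \<Longrightarrow> fR \<mu> (vm y w) < fR \<sigma> w" using Tm_large[OF y] by blast
  define b where "b = max a b0"
  have "continuous_on {0<..} (\<lambda>w. fR \<mu> (vm y w))"
    by (rule continuous_on_compose2[OF fR_continuous_pos[OF M(1)] continuous_vm[OF y]]) (use vm_pos[OF y] in auto)
  then have "continuous_on {0<..} (\<lambda>w. fR \<sigma> w - fR \<mu> (vm y w))"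
    by (intro continuous_intros fR_continuous_pos[OF S(1)])
  then have "continuous_on {a..b} (\<lambda>w. fR \<sigma> w - fR \<mu> (vm y w))" by (rule continuous_on_subset) (use a in auto)
  moreover have "fR \<sigma> a - fR \<mu> (vm y a) \<le> 0" "0 \<le> fR \<sigma> b - fR \<mu> (vm y b)" "a \<le> b"
    using a(2) b0(2)[of b] by (auto simp: b_def)
  ultimately obtain w where "a \<le> w" "w \<le> b" "fR \<sigma> w - fR \<mu> (vm y w) = 0"
    using IVT'[of "\<lambda>w. fR \<sigma> w - fR \<mu> (vm y w)" a 0 b] by blast
  then show ?thesis using a by (intro exI[of _ w]) auto
qed

lemma Tm_eq: assumes "0 < y" "0 < w" "fR \<sigma> w = fR \<mu> (vm y w)" shows "Tm y w = w"
  unfolding Tm_vm assms(3)[symmetric] using assms(1,2) fR_pos[OF S assms(2)] by (simp add: vm_def)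

text \<open>The start is y itself, so that as a function of y the zeroth iterate is the identity, a
  member of the class. \<open>Tm\<close> is monotone and keeps the iterates on one side of w; they
  move monotonically towards it, and a positive limit is a fixed point, hence w.\<close>

lemma Tm_iterates:
  assumes y: "0 < y" and w: "0 < w" "fR \<sigma> w = fR \<mu> (vm y w)"
  shows "(\<lambda>n. (Tm y ^^ n) y) \<longlonglongrightarrow> w"
proof -
  define u where "u n = (Tm y ^^ n) y" for n
  have up: "0 < u n" for n by (induction n) (use y Tm_pos in \<open>auto simp: u_def\<close>)
  have us: "u (Suc n) = Tm y (u n)" for n by (simp add: u_def)
  have limit: "L = w" if "u \<longlonglongrightarrow> L" "0 < L" for L
  proof -
    have "isCont (Tm y) L" using continuous_Tm[OF y] that(2) by (simp add: continuous_on_eq_continuous_at)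
    then have "(\<lambda>n. Tm y (u n)) \<longlonglongrightarrow> Tm y L" using isCont_tendsto_compose that(1) by blast
    moreover have "(\<lambda>n. u (Suc n)) \<longlonglongrightarrow> L" using that(1) by (rule LIMSEQ_Suc)
    ultimately have L: "Tm y L = L" using us LIMSEQ_unique by simp
    have v: "0 < vm y L" using vm_pos[OF y that(2)] .
    have "y * fR \<mu> (vm y L) = L * vm y L" using L v unfolding Tm_vm by (simp add: field_simps)
    also have "\<dots> = y * fR \<sigma> L" using that(2) by (simp add: vm_def)
    finally have "fR \<sigma> L = fR \<mu> (vm y L)" using y by simp
    from subordR_pair_unique[OF y that(2) v mult_vm[OF that(2)] this w(1) vm_pos[OF y w(1)] mult_vm[OF w(1)] w(2)]
    show ?thesis by blast
  qed
  have le: "fR \<sigma> x \<le> fR \<mu> (vm y x)" if "0 < x" "x \<le> w" for x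
    using fR_mono[OF S(1) _ that(2)] fR_mono[OF M(1) _ vm_antimono[OF y that]] vm_pos[OF y w(1)] that w(2) by simp
  have ge: "fR \<mu> (vm y x) \<le> fR \<sigma> x" if "0 < x" "w \<le> x" for x
    using fR_mono[OF S(1) _ that(2)] fR_mono[OF M(1) _ vm_antimono[OF y w(1) that(2)]] vm_pos[OF y that(1)] that w by simp
  have Tw: "Tm y w = w" by (rule Tm_eq[OF y w])
  show ?thesis
  proof (cases "y \<le> w")
    case True
    have uw: "u n \<le> w" for n
    proof (induction n)
      case 0 show ?case using True by (simp add: u_def)
    next
      case (Suc n) show ?case using Tm_mono[OF y up Suc] unfolding us Tw .
    qed
    have inc: "u n \<le> u (Suc n)" for n using Tm_le_iff[OF y up] le[OF up uw] us by simp
    have "incseq u" using inc by (rule incseq_SucI)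
    then obtain L where L: "u \<longlonglongrightarrow> L" "\<forall>i. u i \<le> L" using uw incseq_convergent by blast
    then have "0 < L" using up[of 0] by (meson less_le_trans)
    then show ?thesis using limit[OF L(1)] L(1) by (simp add: u_def[abs_def])
  next
    case False
    have uw: "w \<le> u n" for n
    proof (induction n)
      case 0 show ?case using False by (simp add: u_def)
    next
      case (Suc n) show ?case using Tm_mono[OF y w(1) Suc] unfolding us Tw .
    qed
    have dec: "u (Suc n) \<le> u n" for n
    \<comment> \<open>In this case both inequalities between f_sigma and f_mu hold, so the iterate
      is already fixed.\<close>
    proof (cases "u n \<le> Tm y (u n)")
      case True
      then have "fR \<sigma> (u n) = fR \<mu> (vm y (u n))" using Tm_le_iff[OF y up] ge[OF up uw] by (simp add: antisym)
      then show ?thesis using Tm_eq[OF y up] us by simp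
    qed (simp add: us)
    have "decseq u" using dec by (rule decseq_SucI)
    then obtain L where L: "u \<longlonglongrightarrow> L" using uw decseq_convergent by blast
    then have "w \<le> L" using uw by (intro LIMSEQ_le_const) auto
    then show ?thesis using limit[OF L(1)] w L(1) by (simp add: u_def[abs_def])
  qed
qed

lemma subordR_exists:
  "\<exists>u v. subordR \<sigma> \<mu> u v \<and> CBF u \<and> (\<lambda>n. u (1 / real (Suc n))) \<longlonglongrightarrow> 0"
proof -
  obtain u where u: "\<And>y. 0 < y \<Longrightarrow> 0 < u y \<and> fR \<sigma> (u y) = fR \<mu> (vm y (u y))" using Tm_fixpoint by metis
  have "CBF (\<lambda>y. (Tm y ^^ n) y)" for n
  proof (induction n)
    case 0 show ?case using CBF_id by simp
  next
    case (Suc n)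
    define a where "a y = (Tm y ^^ n) y" for y
    have "CBF a" using Suc by (simp add: a_def[abs_def])
    then have "CBF (\<lambda>y. Tm y (a y))"
      unfolding Tm_def by (rule CBF_fR(2)[OF M CBF_fR(2)[OF S]])
    then show ?case by (simp add: a_def)
  qed
  then have C: "CBF u"
    by (rule CBF_limit[where f="\<lambda>n y. (Tm y ^^ n) y"]) (use Tm_iterates u in auto)
  \<comment> \<open>If u y \<ge> e for small y, then vm y (u y) \<le> y f_sigma(e)/e is so small
    that f_mu there is below f_sigma(e) \<le> f_sigma(u y), against the fixed point
    equation.\<close>
  have "(\<lambda>n. u (1 / real (Suc n))) \<longlonglongrightarrow> 0"
  proof (rule LIMSEQ_I)
    fix e :: real assume e: "0 < e"
    define d where "d = fR \<sigma> e / e"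
    have d: "0 < d" using fR_pos[OF S e] e by (simp add: d_def)
    obtain b where b: "b > 0" "\<And>v. 0 \<le> v \<Longrightarrow> v < b \<Longrightarrow> fR \<mu> v < fR \<sigma> e"
      using fR_small[OF M(1) fR_pos[OF S e]] by blast
    obtain N :: nat where N: "real N > d / b" using reals_Archimedean2 by blast
    have "norm (u (1 / real (Suc n)) - 0) < e" if n: "N \<le> n" for n
    proof (rule ccontr)
      define y where "y = 1 / real (Suc n)"
      have y: "0 < y" by (simp add: y_def)
      assume "\<not> norm (u (1 / real (Suc n)) - 0) < e"
      then have ue: "e \<le> u y" using u[OF y] by (simp add: y_def)
      have "vm y (u y) \<le> vm y e" by (rule vm_antimono[OF y e ue])
      also have "vm y e = d / real (Suc n)" by (simp add: vm_def d_def y_def)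
      also have "\<dots> < b"
      proof -
        have "d < b * real N" using N b(1) by (simp add: divide_less_eq mult.commute)
        also have "\<dots> \<le> b * real (Suc n)" using n b(1) by (intro mult_left_mono) auto
        finally show ?thesis by (simp only: pos_divide_less_eq of_nat_0_less_iff zero_less_Suc)
      qed
      finally have "fR \<mu> (vm y (u y)) < fR \<sigma> e" using b(2) vm_pos[OF y] u[OF y] by (simp add: less_imp_le)
      moreover have "fR \<sigma> e \<le> fR \<sigma> (u y)" using fR_mono[OF S(1)] e ue by simp
      ultimately show False using u[OF y] by simp
    qed
    then show "\<exists>no. \<forall>n\<ge>no. norm (u (1 / real (Suc n)) - 0) < e" by blast
  qed
  moreover have "subordR \<sigma> \<mu> u (\<lambda>y. vm y (u y))"
    unfolding subordR_def using u vm_pos mult_vm by blast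
  ultimately show ?thesis using C by blast
qed

end

section \<open>Sigma and the convolutions on the half-line\<close>

text \<open>Writing the argument as -f(y) lets Sigma be read off without computing an inverse
  function.\<close>

lemma SigmaR_fR:
  assumes M: "M \<in> probRp" "M \<noteq> deltaR0" and y: "0 < y"
  shows "SigmaR M (- fR M y) = y / fR M y"
proof -
  have inj: "inj_on (etaR M) {..<0}"
  proof (rule inj_onI)
    fix a b assume ab: "a \<in> {..<0}" "b \<in> {..<0}" "etaR M a = etaR M b"
    then have "fR M (-a) = fR M (-b)" by (simp add: etaR_fR)
    with fR_inj[OF M, of "-a" "-b"] ab show "a = b" by simp
  qed
  have "inv_into {..<0} (etaR M) (etaR M (- y)) = - y" by (rule inv_into_f_f[OF inj]) (use y in simp)
  then show ?thesis by (simp add: SigmaR_def etaR_fR)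
qed

lemma fR_onto:
  assumes M: "M \<in> probRp" and w: "0 < w" "w < fR M 1"
  shows "\<exists>y>0. fR M y = w"
proof -
  have "continuous_on {0..1} (fR M)" by (rule continuous_on_subset[OF continuous_fR[OF M]]) auto
  then obtain y where y: "0 \<le> y" "fR M y = w"
    using IVT'[of "fR M" 0 w 1] w fR_0[of M] by auto
  then have "y \<noteq> 0" using w fR_0[of M] by auto
  then show ?thesis using y by (intro exI[of _ y]) auto
qed

lemma fR_tendsto_0:
  assumes M: "M \<in> probRp" and x: "x \<longlonglongrightarrow> 0" "\<And>n. 0 \<le> x n"
  shows "(\<lambda>n. fR M (x n)) \<longlonglongrightarrow> 0"
  using continuous_on_tendsto_compose[OF continuous_fR[OF M] x(1)] x(2) by (simp add: fR_0)

lemma one_div_Suc_tendsto: "(\<lambda>n. 1 / real (Suc n)) \<longlonglongrightarrow> 0"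
  by real_asymp

text \<open>The composition f_sigma(f_beta(y)) stays in the class and tends to 0 at 0, so
  \<open>CBF_measure\<close> applies; \<beta> = \<open>deltaR0\<close> is treated apart because
  \<open>CBF\<close> demands positive values.\<close>

lemma mconvR_char:
  assumes S: "\<sigma> \<in> probRp" "\<sigma> \<noteq> deltaR0" and B: "\<beta> \<in> probRp"
  shows "mconvR \<sigma> \<beta> \<in> probRp" "\<And>y. 0 \<le> y \<Longrightarrow> fR (mconvR \<sigma> \<beta>) y = fR \<sigma> (fR \<beta> y)"
proof -
  have "\<exists>R\<in>probRp. \<forall>y>0. fR R y = fR \<sigma> (fR \<beta> y)"
  proof (cases "\<beta> = deltaR0")
    case True
    then show ?thesis using deltaR0_probRp by (intro bexI[of _ deltaR0]) (auto simp: fR_deltaR0 fR_0)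
  next
    case False
    have "CBF (\<lambda>y. fR \<sigma> (fR \<beta> y))" by (rule CBF_fR(1)[OF S CBF_fR(1)[OF B False CBF_id]])
    moreover have "(\<lambda>n. fR \<sigma> (fR \<beta> (1 / real (Suc n)))) \<longlonglongrightarrow> 0"
      by (intro fR_tendsto_0 S B one_div_Suc_tendsto fR_nonneg) auto
    ultimately show ?thesis using CBF_measure by blast
  qed
  then obtain R where R: "R \<in> probRp" "\<And>y. 0 < y \<Longrightarrow> fR R y = fR \<sigma> (fR \<beta> y)" by blast
  have *: "mconvR \<sigma> \<beta> \<in> probRp \<and> (\<forall>x<0. etaR (mconvR \<sigma> \<beta>) x = etaR \<sigma> (etaR \<beta> x))"
    unfolding mconvR_def
  proof (rule theI[where a=R])
    show "R \<in> probRp \<and> (\<forall>x<0. etaR R x = etaR \<sigma> (etaR \<beta> x))"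
      using R by (simp add: etaR_fR)
    fix R' assume R': "R' \<in> probRp \<and> (\<forall>x<0. etaR R' x = etaR \<sigma> (etaR \<beta> x))"
    have "fR R' y = fR R y" if "0 < y" for y
      using conjunct2[OF R', rule_format, of "- y"] R(2)[OF that] that by (simp add: etaR_fR)
    then show "R' = R" using fR_eqI[of R' R 1] R' R(1) by simp
  qed
  then show "mconvR \<sigma> \<beta> \<in> probRp" by simp
  show "fR (mconvR \<sigma> \<beta>) y = fR \<sigma> (fR \<beta> y)" if "0 \<le> y" for y
  proof (cases "y = 0")
    case True then show ?thesis by (simp add: fR_0)
  next
    case False
    then show ?thesis using conjunct2[OF *, rule_format, of "- y"] that by (simp add: etaR_fR)
  qed
qed

lemma not_deltaR0: "0 < y \<Longrightarrow> 0 < fR M y \<Longrightarrow> M \<noteq> deltaR0"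
  using fR_deltaR0[of y] by auto

lemma mconvR_not_deltaR0:
  assumes S: "\<sigma> \<in> probRp" "\<sigma> \<noteq> deltaR0" and B: "\<beta> \<in> probRp" "\<beta> \<noteq> deltaR0"
  shows "mconvR \<sigma> \<beta> \<noteq> deltaR0"
  by (rule not_deltaR0[of 1]) (use mconvR_char(2)[OF S B(1), of 1] fR_pos[OF S fR_pos[OF B]] in auto)

text \<open>The outer function f_sigma is injective, so the inner one can be recovered from the
  composition.\<close>

lemma BR_eqI:
  assumes S: "\<sigma> \<in> probRp" "\<sigma> \<noteq> deltaR0" and B: "\<beta> \<in> probRp" and eq: "mfcR \<sigma> \<mu> = mconvR \<sigma> \<beta>"
  shows "BR \<sigma> \<mu> = \<beta>"
  unfolding BR_def
proof (rule the_equality)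
  show "\<beta> \<in> probRp \<and> mfcR \<sigma> \<mu> = mconvR \<sigma> \<beta>" using B eq by simp
  fix \<beta>' assume b: "\<beta>' \<in> probRp \<and> mfcR \<sigma> \<mu> = mconvR \<sigma> \<beta>'"
  have "fR \<beta>' y = fR \<beta> y" if "0 < y" for y
  proof (rule fR_inj[OF S])
    show "fR \<sigma> (fR \<beta>' y) = fR \<sigma> (fR \<beta> y)"
      using mconvR_char(2)[OF S B, of y] mconvR_char(2)[OF S conjunct1[OF b], of y] b eq that by simp
  qed (use fR_nonneg B b that in auto)
  then show "\<beta>' = \<beta>" using fR_eqI[of \<beta>' \<beta> 1] b B by simp
qed

text \<open>The measure R with f_R = f_sigma(u) exists by \<open>CBF_measure\<close>. At t = f_R(y)
  its Sigma is y/t, those of \<sigma> and \<mu> are u/t and v/t, and u v = y t gives the product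
  rule on the interval from -f_R(1) to 0.\<close>

lemma mfcR_char:
  assumes S: "\<sigma> \<in> probRp" "\<sigma> \<noteq> deltaR0" and M: "\<mu> \<in> probRp" "\<mu> \<noteq> deltaR0"
    and w: "subordR \<sigma> \<mu> u v" "CBF u" "(\<lambda>n. u (1 / real (Suc n))) \<longlonglongrightarrow> 0"
  shows "mfcR \<sigma> \<mu> \<in> probRp" "mfcR \<sigma> \<mu> \<noteq> deltaR0" "\<And>y. 0 < y \<Longrightarrow> fR (mfcR \<sigma> \<mu>) y = fR \<sigma> (u y)"
proof -
  have uv: "0 < u y" "0 < v y" "u y * v y = y * fR \<sigma> (u y)" "fR \<sigma> (u y) = fR \<mu> (v y)" if "0 < y" for y
    using w(1) that unfolding subordR_def by blast+
  have "(\<lambda>n. fR \<sigma> (u (1 / real (Suc n)))) \<longlonglongrightarrow> 0"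
    by (rule fR_tendsto_0[OF S(1) w(3)]) (use uv(1) in \<open>auto intro: less_imp_le\<close>)
  from CBF_measure[OF CBF_fR(1)[OF S w(2)] this]
  obtain R where R: "R \<in> probRp" "R \<noteq> deltaR0" "\<And>y. 0 < y \<Longrightarrow> fR R y = fR \<sigma> (u y)" by blast
  have Sig: "SigmaR R (- t) = SigmaR \<sigma> (- t) * SigmaR \<mu> (- t)" if t: "0 < t" "t < fR R 1" for t
  proof -
    obtain y where y: "0 < y" "fR R y = t" using fR_onto[OF R(1) t] by blast
    have t1: "fR \<sigma> (u y) = t" "fR \<mu> (v y) = t" using R(3)[OF y(1)] y(2) uv(4)[OF y(1)] by auto
    have "SigmaR R (- t) = y / t" "SigmaR \<sigma> (- t) = u y / t" "SigmaR \<mu> (- t) = v y / t"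
      using SigmaR_fR[OF R(1,2) y(1)] SigmaR_fR[OF S uv(1)[OF y(1)]] SigmaR_fR[OF M uv(2)[OF y(1)]] y(2) t1 by auto
    then show ?thesis using uv(3)[OF y(1)] t1 t by simp
  qed
  have "mfcR \<sigma> \<mu> = R"
    unfolding mfcR_def if_not_P[OF iffD2[OF de_Morgan_disj conjI[OF S(2) M(2)]]]
  proof (rule the_equality)
    have "\<forall>z\<in>{- fR R 1<..<0}. SigmaR R z = SigmaR \<sigma> z * SigmaR \<mu> z" using Sig[of "- z" for z] by force
    then show "R \<in> probRp \<and> R \<noteq> deltaR0 \<and> (\<exists>\<alpha>>0. \<forall>z\<in>{- \<alpha><..<0}. SigmaR R z = SigmaR \<sigma> z * SigmaR \<mu> z)"
      using R fR_pos[OF R(1,2), of 1] by auto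
    fix R' assume "R' \<in> probRp \<and> R' \<noteq> deltaR0 \<and> (\<exists>\<alpha>>0. \<forall>z\<in>{- \<alpha><..<0}. SigmaR R' z = SigmaR \<sigma> z * SigmaR \<mu> z)"
    then obtain \<alpha> where R': "R' \<in> probRp" "R' \<noteq> deltaR0" and \<alpha>: "\<alpha> > 0"
      "\<And>z. z \<in> {- \<alpha><..<0} \<Longrightarrow> SigmaR R' z = SigmaR \<sigma> z * SigmaR \<mu> z" by blast
    \<comment> \<open>Small y keep f of R' both inside the interval where its Sigma is known and
      inside the range of f_R on (0,1).\<close>
    have "0 < min \<alpha> (fR R 1)" using \<alpha>(1) fR_pos[OF R(1,2), of 1] by simp
    from fR_small[OF R'(1) this] obtain d where d: "d > 0" "\<And>y. 0 \<le> y \<Longrightarrow> y < d \<Longrightarrow> fR R' y < min \<alpha> (fR R 1)" by blast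
    show "R' = R"
    proof (rule fR_eqI[OF R'(1) R(1) d(1)])
      fix y assume y: "0 < y" "y < d"
      define t where "t = fR R' y"
      have t: "0 < t" "t < \<alpha>" "t < fR R 1" using fR_pos[OF R' y(1)] d(2)[of y] y by (auto simp: t_def)
      obtain x where x: "0 < x" "fR R x = t" using fR_onto[OF R(1) t(1,3)] by blast
      have "y / t = SigmaR R' (- t)" using SigmaR_fR[OF R' y(1)] by (simp add: t_def)
      also have "\<dots> = SigmaR R (- t)" using \<alpha>(2)[of "- t"] Sig[OF t(1,3)] t by simp
      also have "\<dots> = x / t" using SigmaR_fR[OF R(1,2) x(1)] x(2) by simp
      finally have "y = x" using t(1) by simp
      then show "fR R' y = fR R y" using x(2) by (simp add: t_def)
    qed
  qed
  then show "mfcR \<sigma> \<mu> \<in> probRp" "mfcR \<sigma> \<mu> \<noteq> deltaR0" "\<And>y. 0 < y \<Longrightarrow> fR (mfcR \<sigma> \<mu>) y = fR \<sigma> (u y)"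
    using R by auto
qed

text \<open>The subordination function u is itself in the class and tends to 0 at 0, so it is f of a
  measure, and that measure is \<open>BR \<sigma> \<mu>\<close>.\<close>

lemma mfcR_BR:
  assumes S: "\<sigma> \<in> probRp" "\<sigma> \<noteq> deltaR0" and M: "\<mu> \<in> probRp" "\<mu> \<noteq> deltaR0"
  obtains u v where "subordR \<sigma> \<mu> u v" "mfcR \<sigma> \<mu> \<in> probRp" "mfcR \<sigma> \<mu> \<noteq> deltaR0"
    "BR \<sigma> \<mu> \<in> probRp" "BR \<sigma> \<mu> \<noteq> deltaR0"
    "\<And>y. 0 < y \<Longrightarrow> fR (mfcR \<sigma> \<mu>) y = fR \<sigma> (u y) \<and> fR (BR \<sigma> \<mu>) y = u y"
proof -
  obtain u v where w: "subordR \<sigma> \<mu> u v" "CBF u" "(\<lambda>n. u (1 / real (Suc n))) \<longlonglongrightarrow> 0"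
    using subordR_exists[OF S M] by blast
  note m = mfcR_char[OF S M w]
  obtain \<beta> where \<beta>: "\<beta> \<in> probRp" "\<beta> \<noteq> deltaR0" "\<And>y. 0 < y \<Longrightarrow> fR \<beta> y = u y" using CBF_measure[OF w(2,3)] by blast
  have "mfcR \<sigma> \<mu> = mconvR \<sigma> \<beta>"
    by (rule fR_eqI[OF m(1) mconvR_char(1)[OF S \<beta>(1)] zero_less_one])
       (use m(3) \<beta>(3) mconvR_char(2)[OF S \<beta>(1)] in simp)
  then have "BR \<sigma> \<mu> = \<beta>" by (rule BR_eqI[OF S \<beta>(1)])
  then show ?thesis using that[OF w(1) m(1,2)] m(3) \<beta> by simp
qed

text \<open>Pointwise recognition: any positive pair solving the system at this single y consists of
  the subordination values, by \<open>subordR_pair_unique\<close>.\<close>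

lemma mfcR_I:
  assumes S: "\<sigma> \<in> probRp" "\<sigma> \<noteq> deltaR0" and M: "\<mu> \<in> probRp" "\<mu> \<noteq> deltaR0"
    and y: "0 < y" and ab: "0 < a" "0 < b" "a * b = y * fR \<sigma> a" "fR \<sigma> a = fR \<mu> b"
  shows "fR (mfcR \<sigma> \<mu>) y = fR \<sigma> a" "fR (BR \<sigma> \<mu>) y = a"
proof -
  obtain u v where w: "subordR \<sigma> \<mu> u v" "\<And>y. 0 < y \<Longrightarrow> fR (mfcR \<sigma> \<mu>) y = fR \<sigma> (u y) \<and> fR (BR \<sigma> \<mu>) y = u y"
    using mfcR_BR[OF S M] by metis
  have "u y = a" using subordR_pair_unique[OF S M y _ _ _ _ ab, of "u y" "v y"] w(1) y unfolding subordR_def by blast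
  then show "fR (mfcR \<sigma> \<mu>) y = fR \<sigma> a" "fR (BR \<sigma> \<mu>) y = a" using w(2)[OF y] by auto
qed

lemma BR_D:
  assumes S: "\<sigma> \<in> probRp" "\<sigma> \<noteq> deltaR0" and M: "\<mu> \<in> probRp" "\<mu> \<noteq> deltaR0" and y: "0 < y"
  obtains b where "0 < b" "fR (BR \<sigma> \<mu>) y * b = y * fR \<sigma> (fR (BR \<sigma> \<mu>) y)" "fR \<sigma> (fR (BR \<sigma> \<mu>) y) = fR \<mu> b"
    "fR (mfcR \<sigma> \<mu>) y = fR \<sigma> (fR (BR \<sigma> \<mu>) y)"
proof -
  obtain u v where w: "subordR \<sigma> \<mu> u v" "\<And>y. 0 < y \<Longrightarrow> fR (mfcR \<sigma> \<mu>) y = fR \<sigma> (u y) \<and> fR (BR \<sigma> \<mu>) y = u y"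
    using mfcR_BR[OF S M] by metis
  have "0 < v y" "u y * v y = y * fR \<sigma> (u y)" "fR \<sigma> (u y) = fR \<mu> (v y)" using w(1) y unfolding subordR_def by blast+
  then show ?thesis using w(2)[OF y] by (intro that[of "v y"]) auto
qed

lemma mfcR_closed:
  assumes "\<sigma> \<in> probRp" "\<sigma> \<noteq> deltaR0" "\<mu> \<in> probRp" "\<mu> \<noteq> deltaR0"
  shows "mfcR \<sigma> \<mu> \<in> probRp \<and> mfcR \<sigma> \<mu> \<noteq> deltaR0"
  by (rule mfcR_BR[OF assms]) blast

lemma BR_closed:
  assumes "\<sigma> \<in> probRp" "\<sigma> \<noteq> deltaR0" "\<mu> \<in> probRp" "\<mu> \<noteq> deltaR0"
  shows "BR \<sigma> \<mu> \<in> probRp \<and> BR \<sigma> \<mu> \<noteq> deltaR0"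
  by (rule mfcR_BR[OF assms]) blast

text \<open>Both sides of the defining equation collapse to \<open>deltaR0\<close>, since f_sigma(0)
  = 0.\<close>

lemma BR_deltaR0:
  assumes S: "\<sigma> \<in> probRp" "\<sigma> \<noteq> deltaR0"
  shows "BR \<sigma> deltaR0 = deltaR0"
proof (rule BR_eqI[OF S deltaR0_probRp])
  have "mconvR \<sigma> deltaR0 = deltaR0"
    by (rule fR_eqI[OF mconvR_char(1)[OF S deltaR0_probRp] deltaR0_probRp zero_less_one])
       (use mconvR_char(2)[OF S deltaR0_probRp] in \<open>simp add: fR_deltaR0 fR_0\<close>)
  then show "mfcR \<sigma> deltaR0 = mconvR \<sigma> deltaR0" by (simp add: mfcR_def)
qed

section \<open>The two identities on the half-line\<close>

text \<open>With W the common value of f at d1 and d2, and s = f_sigma(W), the relations d1 d2 = y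
  W, W A1 = d1 s, W A2 = d2 s and W V = y s combine to A1 A2 = V s. Thus (A1, A2) is the pair of
  \<mu>1, \<mu>2 at V, and then (W, V) is the pair of \<sigma>, \<rho> at y.\<close>

theorem BR_mfcR:
  assumes T: "\<sigma> \<in> probRp" "\<sigma> \<noteq> deltaR0" and m1: "\<mu>1 \<in> probRp" and m2: "\<mu>2 \<in> probRp"
  shows "BR \<sigma> (mfcR \<mu>1 \<mu>2) = mfcR (BR \<sigma> \<mu>1) (BR \<sigma> \<mu>2)"
proof (cases "\<mu>1 = deltaR0 \<or> \<mu>2 = deltaR0")
  case True
  then show ?thesis using BR_deltaR0[OF T] by (auto simp: mfcR_def)
next
  case False
  then have M1: "\<mu>1 \<in> probRp" "\<mu>1 \<noteq> deltaR0" and M2: "\<mu>2 \<in> probRp" "\<mu>2 \<noteq> deltaR0" using m1 m2 by auto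
  define \<beta>1 \<beta>2 where "\<beta>1 = BR \<sigma> \<mu>1" and "\<beta>2 = BR \<sigma> \<mu>2"
  have B1: "\<beta>1 \<in> probRp" "\<beta>1 \<noteq> deltaR0" and B2: "\<beta>2 \<in> probRp" "\<beta>2 \<noteq> deltaR0"
    using BR_closed[OF T M1] BR_closed[OF T M2] by (auto simp: \<beta>1_def \<beta>2_def)
  define \<rho> where "\<rho> = mfcR \<mu>1 \<mu>2"
  have R: "\<rho> \<in> probRp" "\<rho> \<noteq> deltaR0" using mfcR_closed[OF M1 M2] by (auto simp: \<rho>_def)
  have "fR (BR \<sigma> \<rho>) y = fR (mfcR \<beta>1 \<beta>2) y" if y: "0 < y" for y
  proof -
    define d1 where "d1 = fR (BR \<beta>1 \<beta>2) y"
    obtain d2 where d: "0 < d2" "d1 * d2 = y * fR \<beta>1 d1" "fR \<beta>1 d1 = fR \<beta>2 d2" "fR (mfcR \<beta>1 \<beta>2) y = fR \<beta>1 d1"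
      using BR_D[OF B1 B2 y] unfolding d1_def by blast
    have d1: "0 < d1" using fR_pos[OF _ _ y] BR_closed[OF B1 B2] by (simp add: d1_def)
    define W where "W = fR \<beta>1 d1"
    have W: "0 < W" using fR_pos[OF B1 d1] by (simp add: W_def)
    have e: "fR \<beta>1 d1 = W" "fR \<beta>2 d2 = W" using d by (auto simp: W_def)
    obtain A1 where A1: "0 < A1" "W * A1 = d1 * fR \<sigma> W" "fR \<sigma> W = fR \<mu>1 A1"
      using BR_D[OF T M1 d1] unfolding \<beta>1_def[symmetric] e by metis
    obtain A2 where A2: "0 < A2" "W * A2 = d2 * fR \<sigma> W" "fR \<sigma> W = fR \<mu>2 A2"
      using BR_D[OF T M2 d(1)] unfolding \<beta>2_def[symmetric] e by metis
    define s where "s = fR \<sigma> W"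
    have s: "0 < s" using fR_pos[OF T W] by (simp add: s_def)
    \<comment> \<open>Forced: the second coordinate that belongs to W in the system of \<sigma> and
      \<rho> at y.\<close>
    define V where "V = y * s / W"
    have V: "0 < V" "W * V = y * s" using y s W by (auto simp: V_def)
    have "W * W * (A1 * A2) = (W * A1) * (W * A2)" by (simp only: mult_ac)
    also have "\<dots> = (d1 * s) * (d2 * s)" by (simp only: A1(2) A2(2) s_def)
    also have "\<dots> = (d1 * d2) * (s * s)" by (simp only: mult_ac)
    also have "\<dots> = W * (y * s) * s" unfolding d(2) e by (simp only: mult_ac)
    also have "\<dots> = W * W * (V * s)" unfolding V(2)[symmetric] by (simp only: mult_ac)
    finally have "A1 * A2 = V * s" using W by simp
    then have "A1 * A2 = V * fR \<mu>1 A1" "fR \<mu>1 A1 = fR \<mu>2 A2" using A1(3) A2(3) by (auto simp: s_def)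
    from mfcR_I(1)[OF M1 M2 V(1) A1(1) A2(1) this] have "fR \<rho> V = s" using A1(3) by (simp add: \<rho>_def s_def)
    then have "fR \<sigma> W = fR \<rho> V" by (simp add: s_def)
    from mfcR_I(2)[OF T R y W V(1) V(2)[unfolded s_def] this] show ?thesis using d(4) e by simp
  qed
  then have "BR \<sigma> \<rho> = mfcR \<beta>1 \<beta>2"
    using fR_eqI[of "BR \<sigma> \<rho>" "mfcR \<beta>1 \<beta>2" 1] BR_closed[OF T R] mfcR_closed[OF B1 B2] by simp
  then show ?thesis by (simp add: \<rho>_def \<beta>1_def \<beta>2_def)
qed

text \<open>Here b = f(e) for \<sigma>1, which is also f(g) for \<beta>2. From e g = y b and b c = g
  f(b) for \<sigma>2 follows e c = y f(b), and f(b) for \<sigma>2 is f(e) for the monotone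
  convolution \<kappa> as well as f(c) for \<mu>. So (e, c) is the pair of \<kappa>, \<mu> at
  y.\<close>

theorem BR_BR:
  assumes S1: "\<sigma>1 \<in> probRp" "\<sigma>1 \<noteq> deltaR0" and S2: "\<sigma>2 \<in> probRp" "\<sigma>2 \<noteq> deltaR0" and m: "\<mu> \<in> probRp"
  shows "BR \<sigma>1 (BR \<sigma>2 \<mu>) = BR (mconvR \<sigma>2 \<sigma>1) \<mu>"
proof -
  define \<kappa> where "\<kappa> = mconvR \<sigma>2 \<sigma>1"
  have K: "\<kappa> \<in> probRp" "\<kappa> \<noteq> deltaR0"
    using mconvR_char(1)[OF S2 S1(1)] mconvR_not_deltaR0[OF S2 S1] by (auto simp: \<kappa>_def)
  show ?thesis
  proof (cases "\<mu> = deltaR0")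
    case True then show ?thesis using BR_deltaR0 S1 S2 K by (simp add: \<kappa>_def)
  next
    case False
    then have M: "\<mu> \<in> probRp" "\<mu> \<noteq> deltaR0" using m by auto
    define \<beta>2 where "\<beta>2 = BR \<sigma>2 \<mu>"
    have B2: "\<beta>2 \<in> probRp" "\<beta>2 \<noteq> deltaR0" using BR_closed[OF S2 M] by (auto simp: \<beta>2_def)
    have B: "BR \<sigma>1 \<beta>2 \<in> probRp" "BR \<sigma>1 \<beta>2 \<noteq> deltaR0" using BR_closed[OF S1 B2] by auto
    have "fR (BR \<sigma>1 \<beta>2) y = fR (BR \<kappa> \<mu>) y" if y: "0 < y" for y
    proof -
      define e where "e = fR (BR \<sigma>1 \<beta>2) y"
      have e: "0 < e" using fR_pos[OF B y] by (simp add: e_def)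
      obtain g where g: "0 < g" "e * g = y * fR \<sigma>1 e" "fR \<sigma>1 e = fR \<beta>2 g"
        using BR_D[OF S1 B2 y] unfolding e_def by metis
      define b where "b = fR \<beta>2 g"
      have b: "0 < b" using fR_pos[OF B2 g(1)] by (simp add: b_def)
      obtain c where c: "0 < c" "b * c = g * fR \<sigma>2 b" "fR \<sigma>2 b = fR \<mu> c"
        using BR_D[OF S2 M g(1)] unfolding \<beta>2_def[symmetric] b_def by metis
      have k: "fR \<kappa> e = fR \<sigma>2 b" using mconvR_char(2)[OF S2 S1(1), of e] e g(3) by (simp add: \<kappa>_def b_def)
      have "b * (e * c) = e * (b * c)" by (simp only: mult_ac)
      also have "\<dots> = (e * g) * fR \<sigma>2 b" by (simp only: c(2) mult_ac)
      also have "\<dots> = b * (y * fR \<kappa> e)" unfolding g(2,3) k b_def[symmetric] by (simp only: mult_ac)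
      finally have "e * c = y * fR \<kappa> e" using b by simp
      from mfcR_I(2)[OF K M y e c(1) this k[unfolded c(3)]] show ?thesis by (simp add: e_def)
    qed
    then have "BR \<sigma>1 \<beta>2 = BR \<kappa> \<mu>"
      using fR_eqI[of "BR \<sigma>1 \<beta>2" "BR \<kappa> \<mu>" 1] B BR_closed[OF K M] by simp
    then show ?thesis by (simp add: \<beta>2_def \<kappa>_def)
  qed
qed

theorem theorem1p1:
  fixes \<sigma> \<sigma>1 \<sigma>2 \<mu>1 \<mu>2 :: "real measure"
    and \<tau> \<tau>1 \<tau>2 \<nu>1 \<nu>2 :: "complex measure"
  shows
   "(\<sigma> \<in> probRp - {deltaR0} \<and> \<sigma>1 \<in> probRp - {deltaR0} \<and> \<sigma>2 \<in> probRp - {deltaR0} \<and>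
     \<mu>1 \<in> probRp \<and> \<mu>2 \<in> probRp \<longrightarrow>
       BR \<sigma> (mfcR \<mu>1 \<mu>2) = mfcR (BR \<sigma> \<mu>1) (BR \<sigma> \<mu>2) \<and>
       (\<forall>\<mu>\<in>probRp. BR \<sigma>1 (BR \<sigma>2 \<mu>) = BR (mconvR \<sigma>2 \<sigma>1) \<mu>))
    \<and>
    (\<tau> \<in> probT \<and> \<tau>1 \<in> probT \<and> \<tau>2 \<in> probT \<and> \<nu>1 \<in> probT \<and> \<nu>2 \<in> probT \<longrightarrow>
       BT \<tau> (mfcT \<nu>1 \<nu>2) = mfcT (BT \<tau> \<nu>1) (BT \<tau> \<nu>2) \<and>
       (\<forall>\<nu>\<in>probT. BT \<tau>1 (BT \<tau>2 \<nu>) = BT (mconvT \<tau>2 \<tau>1) \<nu>))"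
  using BR_mfcR BR_BR BT_mfcT BT_BT by blast

end
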